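(* Let $\mathscr P(W)$ be the set of model triples described in the context. Then: (i) for every integer $m\ge 1$, $\mathscr P(S_m)$ is a perfect model for $S_m$; (ii) for every integer $n\ge 2$, $\mathscr P(W^{\mathsf{BC}}_n)$ is a perfect model for $W^{\mathsf{BC}}_n$; (iii) for every integer $n\ge 2$, $\mathscr P(W^{\mathsf D}_{2n+1})$ is a perfect model for $W^{\mathsf D}_{2n+1}$.
   Context: Let $(W,S)$ be a finite Coxeter system with length function $\ell$ and reflections $T=\{wsw^{-1}:w\in W,s\in S\}$. Let $\mathrm{Aut}(W,S)$ be the group of automorphisms $\varphi$ of $W$ with $\varphi(S)=S$, and $W^+=W\rtimes\mathrm{Aut}(W,S)$ the group of pairs $(w,\varphi)$ with product $(v,\alpha)(w,\beta)=(v\,\alpha(w),\alpha\beta)$; set $\ell(w,\varphi)=\ell(w)$ and identify $w\in W$ with $(w,1)$. An element $z\in W^+$ is a perfect involution if $z^2=1$ and $(zt)^4=1$ for all $t\in T$. For $J\subseteq S$ let $W_J=\langle J\rangle$ (a Coxeter system $(W_J,J)$ with the restricted length), let $\mathscr I_J$ be the set of perfect involutions in $(W_J)^+=W_J\rtimes\mathrm{Aut}(W_J,J)$, on which $W_J$ acts by conjugation $v:(y,\theta)\mapsto(v\,y\,\theta(v)^{-1},\theta)$; $z\in\mathscr I_J$ is $W_J$-minimal if $\ell(szs)\ge\ell(z)$ for all $s\in J$. For $z\in\mathscr I_J$, $C_{W_J}(z)=\{w\in W_J: wz=zw\}$. A model triple $(J,z_{\min},\sigma)$ for $W$ consists of $J\subseteq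 S$, a $W_J$-minimal $z_{\min}\in\mathscr I_J$, and a group homomorphism $\sigma:W_J\to\{\pm1\}$. A set $\mathscr P$ of model triples is a perfect model for $W$ if $\sum_{(J,z_{\min},\sigma)\in\mathscr P}\mathrm{Ind}_{C_{W_J}(z_{\min})}^W\mathrm{Res}^{W_J}_{C_{W_J}(z_{\min})}(\sigma)=\sum_{\chi\in\mathrm{Irr}(W)}\chi$, where $\mathrm{Irr}(W)$ is the set of complex irreducible characters. Classical groups: for $i>0$ let $s_i=(i,i+1)(-i,-i-1)$, $s_0=(-1,1)$, $s_{-1}=(1,-2)(-1,2)$, as permutations of $\{\pm1,\dots,\pm N\}$. $W^{\mathsf{BC}}_N$ is the group of permutations $w$ of $\{\pm1,\dots,\pm N\}$ with $w(-i)=-w(i)$, a Coxeter group with generators $s_0,s_1,\dots,s_{N-1}$; $W^{\mathsf D}_N$ is its subgroup of $w$ with $|\{i\in[N]:w(i)<0\}|$ even, a Coxeter group with generators $s_{-1},s_1,\dots,s_{N-1}$; $S_N=\langle s_1,\dots,s_{N-1}\rangle$ is the symmetric group. Write $\mathbb 1$ for trivial characters and $\mathrm{sgn}:w\mapsto(-1)^{\ell(w)}$. $\mathscr P(W)$ consists of the following triples. (A) $W=S_n$, $n\ge1$: for each $0\le k\le\lfloor n/2\rfloor$, $J=\{s_1,\dots,s_{n-1}\}\setminus\{s_{2k}\}$ (so $W_J=S_{2k}\times S_{n-2k}$ with $S_{n-2k}=\langle s_{2k+1},\dots,s_{n-1}\rangle$), $z_{\min}=s_1s_3\cdots s_{2k-1}$,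 $\sigma=\mathbb 1_{S_{2k}}\times\mathrm{sgn}_{S_{n-2k}}$. (BC) $W=W^{\mathsf{BC}}_n$, $n\ge2$: for each $0\le k\le\lfloor n/2\rfloor$, $J=\{s_0,\dots,s_{n-1}\}\setminus\{s_{2k}\}$ (so $W_J=W^{\mathsf{BC}}_{2k}\times S_{n-2k}$), $z_{\min}=s_1s_3\cdots s_{2k-1}$, $\sigma=\mathbb 1_{W^{\mathsf{BC}}_{2k}}\times\mathrm{sgn}_{S_{n-2k}}$. (D) $W=W^{\mathsf D}_n$, $n\ge3$: for each $0<k\le\lfloor n/2\rfloor$, $J=\{s_{-1},s_1,\dots,s_{n-1}\}\setminus\{s_{2k}\}$ (so $W_J=W^{\mathsf D}_{2k}\times S_{n-2k}$), $z_{\min}=s_1s_3\cdots s_{2k-1}$, $\sigma=\mathbb 1_{W^{\mathsf D}_{2k}}\times\mathrm{sgn}_{S_{n-2k}}$; plus the triple $(\{s_1,\dots,s_{n-1}\},1,\mathrm{sgn}_{S_n})$. *)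

theory Defs
  imports Complex_Main "Jordan_Normal_Form.Matrix"
begin

(* Elements of the finite Coxeter groups are permutations of the integers,
   acting on {+-1,...,+-N} and fixing every other integer.
   Group product = composition. *)
type_synonym perm = "int \<Rightarrow> int"
type_synonym autom = "perm \<Rightarrow> perm"

definition wprod :: "perm list \<Rightarrow> perm" where
  "wprod ws = foldr (\<circ>) ws id"

(* the subgroup generated by J (all generators are involutions, so monoid
   generated = group generated) *)
definition gen :: "perm set \<Rightarrow> perm set" where
  "gen J = {wprod ws | ws. set ws \<subseteq> J}"

definition clength :: "perm set \<Rightarrow> perm \<Rightarrow> nat" where
  "clength S w = (LEAST n. \<exists>ws. set ws \<subseteq> S \<and> length ws = n \<and> wprod ws = w)"

definition reflections :: "perm set \<Rightarrow> perm set" where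
  "reflections J = {w \<circ> s \<circ> Hilbert_Choice.inv w | w s. w \<in> gen J \<and> s \<in> J}"

(* Aut(W_J, J); automorphisms are normalised to be the identity outside W_J *)
definition autJ :: "perm set \<Rightarrow> autom set" where
  "autJ J = {\<phi>. bij_betw \<phi> (gen J) (gen J)
               \<and> (\<forall>v\<in>gen J. \<forall>w\<in>gen J. \<phi> (v \<circ> w) = \<phi> v \<circ> \<phi> w)
               \<and> \<phi> ` J = J
               \<and> (\<forall>x. x \<notin> gen J \<longrightarrow> \<phi> x = x)}"

(* the semidirect product (W_J)^+ = W_J \<rtimes> Aut(W_J,J) *)
definition Wplus :: "perm set \<Rightarrow> (perm \<times> autom) set" where
  "Wplus J = gen J \<times> autJ J"

definition pmul :: "perm \<times> autom \<Rightarrow> perm \<times> autom \<Rightarrow> perm \<times> autom" where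
  "pmul x y = (fst x \<circ> (snd x) (fst y), snd x \<circ> snd y)"

definition pone :: "perm \<times> autom" where
  "pone = (id, id)"

definition ppow :: "perm \<times> autom \<Rightarrow> nat \<Rightarrow> perm \<times> autom" where
  "ppow x n = ((pmul x) ^^ n) pone"

definition perfect_inv :: "perm set \<Rightarrow> (perm \<times> autom) set" where
  "perfect_inv J = {z \<in> Wplus J. pmul z z = pone
                     \<and> (\<forall>t\<in>reflections J. ppow (pmul z (t, id)) 4 = pone)}"

(* W_J-minimality; S is the ambient generating set, the length on W_J being
   the restriction of the length of (W,S) *)
definition WJ_minimal :: "perm set \<Rightarrow> perm set \<Rightarrow> perm \<times> autom \<Rightarrow> bool" where
  "WJ_minimal S J z =
     (\<forall>s\<in>J. clength S (fst (pmul (pmul (s, id) z) (s, id))) \<ge> clength S (fst z))"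

definition centraliser :: "perm set \<Rightarrow> perm \<times> autom \<Rightarrow> perm set" where
  "centraliser J z = {w \<in> gen J. pmul (w, id) z = pmul z (w, id)}"

definition linear_char_hom :: "perm set \<Rightarrow> (perm \<Rightarrow> complex) \<Rightarrow> bool" where
  "linear_char_hom J \<sigma> =
     ((\<forall>w\<in>gen J. \<sigma> w \<in> {1, -1})
      \<and> (\<forall>v\<in>gen J. \<forall>w\<in>gen J. \<sigma> (v \<circ> w) = \<sigma> v * \<sigma> w))"

type_synonym triple = "perm set \<times> (perm \<times> autom) \<times> (perm \<Rightarrow> complex)"

definition model_triple :: "perm set \<Rightarrow> triple \<Rightarrow> bool" where
  "model_triple S tr = (case tr of (J, z, \<sigma>) \<Rightarrow>
      J \<subseteq> S \<and> z \<in> perfect_inv J \<and> WJ_minimal S J z \<and> linear_char_hom J \<sigma>)"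

definition induce :: "perm set \<Rightarrow> perm set \<Rightarrow> (perm \<Rightarrow> complex) \<Rightarrow> perm \<Rightarrow> complex" where
  "induce G H \<psi> g =
     (\<Sum>x\<in>G. if x \<circ> g \<circ> Hilbert_Choice.inv x \<in> H then \<psi> (x \<circ> g \<circ> Hilbert_Choice.inv x) else 0) / of_nat (card H)"

definition mat_trace :: "complex mat \<Rightarrow> complex" where
  "mat_trace A = (\<Sum>i<dim_row A. A $$ (i, i))"

definition representation :: "perm set \<Rightarrow> nat \<Rightarrow> (perm \<Rightarrow> complex mat) \<Rightarrow> bool" where
  "representation G d \<rho> =
     ((\<forall>g\<in>G. \<rho> g \<in> carrier_mat d d) \<and> \<rho> id = 1\<^sub>m d
      \<and> (\<forall>g\<in>G. \<forall>h\<in>G. \<rho> (g \<circ> h) = \<rho> g * \<rho> h))"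

definition subspace_vec :: "nat \<Rightarrow> complex vec set \<Rightarrow> bool" where
  "subspace_vec d U = (U \<subseteq> carrier_vec d \<and> 0\<^sub>v d \<in> U
      \<and> (\<forall>u\<in>U. \<forall>v\<in>U. u + v \<in> U) \<and> (\<forall>c. \<forall>u\<in>U. c \<cdot>\<^sub>v u \<in> U))"

definition irreducible_rep :: "perm set \<Rightarrow> nat \<Rightarrow> (perm \<Rightarrow> complex mat) \<Rightarrow> bool" where
  "irreducible_rep G d \<rho> =
     (representation G d \<rho> \<and> d > 0
      \<and> (\<forall>U. subspace_vec d U \<and> (\<forall>g\<in>G. \<forall>u\<in>U. \<rho> g *\<^sub>v u \<in> U)
             \<longrightarrow> U = {0\<^sub>v d} \<or> U = carrier_vec d))"

definition Irr :: "perm set \<Rightarrow> (perm \<Rightarrow> complex) set" where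
  "Irr G = {\<chi>. \<exists>d \<rho>. irreducible_rep G d \<rho>
               \<and> (\<forall>g\<in>G. \<chi> g = mat_trace (\<rho> g)) \<and> (\<forall>g. g \<notin> G \<longrightarrow> \<chi> g = 0)}"

definition perfect_model :: "perm set \<Rightarrow> perm set \<Rightarrow> triple set \<Rightarrow> bool" where
  "perfect_model W S P =
     ((\<forall>tr\<in>P. model_triple S tr)
      \<and> (\<forall>g\<in>W. (\<Sum>(J, z, \<sigma>)\<in>P. induce W (centraliser J z) \<sigma> g) = (\<Sum>\<chi>\<in>Irr W. \<chi> g)))"

definition sgen :: "int \<Rightarrow> perm" where
  "sgen i = (if i = 0 then (\<lambda>x. if x = -1 then 1 else if x = 1 then -1 else x)
             else if i = -1 then (\<lambda>x. if x = 1 then -2 else if x = -2 then 1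
                                   else if x = -1 then 2 else if x = 2 then -1 else x)
             else (\<lambda>x. if x = i then i + 1 else if x = i + 1 then i
                       else if x = -i then -i - 1 else if x = -i - 1 then -i else x))"

definition W_BC :: "nat \<Rightarrow> perm set" where
  "W_BC N = {w. bij w \<and> (\<forall>i. w (-i) = - w i) \<and> (\<forall>i. \<bar>i\<bar> > int N \<longrightarrow> w i = i)}"

definition W_D :: "nat \<Rightarrow> perm set" where
  "W_D N = {w \<in> W_BC N. even (card {i \<in> {1..int N}. w i < 0})}"

definition S_A :: "nat \<Rightarrow> perm set" where
  "S_A N = gen (sgen ` {1..int N - 1})"

definition gens_A :: "nat \<Rightarrow> perm set" where "gens_A N = sgen ` {1..int N - 1}"
definition gens_BC :: "nat \<Rightarrow> perm set" where "gens_BC N = sgen ` {0..int N - 1}"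
definition gens_D :: "nat \<Rightarrow> perm set" where "gens_D N = sgen ` ({-1} \<union> {1..int N - 1})"

definition sgnC :: "perm set \<Rightarrow> perm \<Rightarrow> complex" where
  "sgnC S w = (-1) ^ clength S w"

(* the S_{n-2k} = <s_{2k+1},...,s_{n-1}> component of w \<in> W_J *)
definition comp2 :: "nat \<Rightarrow> perm \<Rightarrow> perm" where
  "comp2 k w = (\<lambda>i. if \<bar>i\<bar> > 2 * int k then w i else i)"

definition zmin :: "nat \<Rightarrow> perm \<times> autom" where
  "zmin k = (wprod (map (\<lambda>j. sgen (2 * int j + 1)) [0..<k]), id)"

(* 1 x sgn_{S_{n-2k}} ; S is the ambient generating set (restricted length) *)
definition sigma_k :: "perm set \<Rightarrow> nat \<Rightarrow> perm \<Rightarrow> complex" where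
  "sigma_k S k w = sgnC S (comp2 k w)"

definition P_A :: "nat \<Rightarrow> triple set" where
  "P_A n = (\<lambda>k. (sgen ` ({1..int n - 1} - {2 * int k}), zmin k, sigma_k (gens_A n) k))
            ` {0..n div 2}"

definition P_BC :: "nat \<Rightarrow> triple set" where
  "P_BC n = (\<lambda>k. (sgen ` ({0..int n - 1} - {2 * int k}), zmin k, sigma_k (gens_BC n) k))
            ` {0..n div 2}"

definition P_D :: "nat \<Rightarrow> triple set" where
  "P_D n = (\<lambda>k. (sgen ` (({-1} \<union> {1..int n - 1}) - {2 * int k}), zmin k, sigma_k (gens_D n) k))
            ` {1..n div 2}
           \<union> {(sgen ` {1..int n - 1}, (id, id), sgnC (gens_D n))}"

end

theory Submission
  imports Defs "Jordan_Normal_Form.Spectral_Radius" "HOL-Combinatorics.Permutations"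
begin

text \<open>Write \<open>r(g)\<close> for the number of square roots of \<open>g\<close> in \<open>W\<close>, and \<open>F\<close> for the sum of the induced
  characters. It suffices to prove \<open>F = r\<close> and that every \<open>g\<close> is conjugate to its inverse: by
  Frobenius and Schur, \<open>\<langle>r, \<chi>\<rangle> = \<plusminus>1\<close> for every irreducible \<open>\<chi>\<close>, all characters being real, while
  \<open>\<langle>F, \<chi>\<rangle>\<close> is a multiplicity and hence nonnegative, so it equals 1.

  The value \<open>F(g)\<close> is the sum, over the signed involutions \<open>z\<close> commuting with \<open>g\<close> that have no point
  \<open>i \<mapsto> - i\<close> and over the \<open>g\<close>-invariant choices \<open>P\<close> of one point from each pair of fixed points \<open>i, - i\<close>,
  of the sign of \<open>g\<close> on \<open>P\<close>. If \<open>z\<close> preserves a cycle of even length, replacing the identity by the half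
  rotation on that cycle reverses the sign, so these terms cancel. The remaining terms have sign 1 and
  correspond to the square roots of \<open>g\<close>: an odd cycle has a unique square root on itself, up to \<open>\<plusminus>\<close>, and two
  cycles swapped by \<open>z\<close> interlace into one cycle of twice the length.

  Symmetric groups are the positive signed permutations, and the argument respects positivity. In type D
  of odd rank, \<open>-1\<close> is central in the hyperoctahedral group and does not lie in the subgroup of type D,
  so both sides are half of those in type BC.\<close>

section \<open>Linear algebra\<close>

text \<open>The set P enters because induction starts from the centralizer of z inside the parabolic
  subgroup, not inside W. Elements of the parabolic subgroup act on 2k+1, ..., n without sign
  changes, so this centralizer is the stabilizer in W of the pair (z, {2k+1, ..., n}), and a linear
  character induced from a stabilizer is a signed count of fixed points on an orbit. Coding the pair
  as one self-map of the integers lets a single commutation with g express that both z and P are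
  invariant.

  A cycle containing both a and -a supports no such pair by itself: the powers of g that square to 1
  there are 1 and -1; with the identity, P could not be both invariant and a choice between a and
  -a, and -1 is excluded. Such a cycle has to be swapped with another one, which matches the fact
  that it has no square root of its own.

  In type D these centralizers already lie in the subgroup, since z pairs up the positions of sign
  changes. Passing to type BC in odd rank therefore only doubles the induced characters. The
  separate triple of type D takes the place of k = 0, where there is no \<open>s_0\<close> to
  remove.\<close>

lemma index_mult_mat_sum:
  assumes "A \<in> carrier_mat n m" "B \<in> carrier_mat m p" "i < n" "j < p"
  shows "(A * B) $$ (i, j) = (\<Sum>l<m. A $$ (i, l) * B $$ (l, j))"
  using assms by (auto simp: scalar_prod_def atLeast0LessThan)

lemma index_mult_vec_sum:
  assumes "A \<in> carrier_mat n m" "v \<in> carrier_vec m" "i < n"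
  shows "(A *\<^sub>v v) $ i = (\<Sum>l<m. A $$ (i, l) * v $ l)"
  using assms by (auto simp: scalar_prod_def atLeast0LessThan)

lemma mat_trace_mult_comm:
  assumes "A \<in> carrier_mat n m" "B \<in> carrier_mat m n"
  shows "mat_trace (A * B) = mat_trace (B * A)"
proof -
  have "mat_trace (A * B) = (\<Sum>i<n. \<Sum>j<m. A $$ (i, j) * B $$ (j, i))"
    using assms by (auto simp: mat_trace_def index_mult_mat_sum[OF assms] index_mult_mat_sum[OF assms(2,1)] simp del: index_mult_mat(1) intro!: sum.cong)
  also have "\<dots> = (\<Sum>j<m. \<Sum>i<n. B $$ (j, i) * A $$ (i, j))"
    by (subst sum.swap) (simp add: mult.commute)
  also have "\<dots> = mat_trace (B * A)"
    using assms by (auto simp: mat_trace_def index_mult_mat_sum[OF assms] index_mult_mat_sum[OF assms(2,1)] simp del: index_mult_mat(1) intro!: sum.cong)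
  finally show ?thesis .
qed

lemma mat_trace_one [simp]: "mat_trace (1\<^sub>m d) = of_nat d"
  by (simp add: mat_trace_def)

lemma mat_trace_minus:
  assumes "A \<in> carrier_mat n n" "B \<in> carrier_mat n n"
  shows "mat_trace (A - B) = mat_trace A - mat_trace B"
  using assms by (simp add: mat_trace_def sum_subtractf)

text \<open>Padding both matrices with zeros to size r makes the one-sided inverse two-sided, while
  row d of the padded A vanishes. The bound makes a maximal rank exist in
  \<open>subspace_factorization\<close>.\<close>

lemma left_inverse_dim_le:
  fixes A B :: "complex mat"
  assumes A: "A \<in> carrier_mat d r" and B: "B \<in> carrier_mat r d" and BA: "B * A = 1\<^sub>m r"
  shows "r \<le> d"
proof (rule ccontr)
  assume "\<not> r \<le> d"
  hence dr: "d < r" by simp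
  define A0 where "A0 = mat r r (\<lambda>(i, j). if i < d then A $$ (i, j) else 0)"
  define B0 where "B0 = mat r r (\<lambda>(i, j). if j < d then B $$ (i, j) else 0)"
  have c: "A0 \<in> carrier_mat r r" "B0 \<in> carrier_mat r r" by (auto simp: A0_def B0_def)
  have "(B0 * A0) $$ (i, j) = (B * A) $$ (i, j)" if "i < r" "j < r" for i j
  proof -
    have "(B0 * A0) $$ (i, j) = (\<Sum>l<r. if l < d then B $$ (i, l) * A $$ (l, j) else 0)"
      using that by (subst index_mult_mat_sum[OF c(2,1)]) (auto simp: A0_def B0_def intro!: sum.cong)
    also have "\<dots> = (\<Sum>l<d. B $$ (i, l) * A $$ (l, j))"
      using dr by (intro sum.mono_neutral_cong_right) auto
    also have "\<dots> = (B * A) $$ (i, j)"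
      using index_mult_mat_sum[OF B A that] by simp
    finally show ?thesis .
  qed
  hence "B0 * A0 = 1\<^sub>m r" using c BA by (intro eq_matI) auto
  hence one: "A0 * B0 = 1\<^sub>m r" using c mat_mult_left_right_inverse by blast
  have "(A0 * B0) $$ (d, d) = 0"
    using dr by (subst index_mult_mat_sum[OF c]) (auto simp: A0_def)
  with one dr show False by simp
qed

text \<open>The columns of A are a basis of U and the rows of B are dual functionals, so that A * B
  is a projection onto U. Such an explicit pair of matrices is what the compression of a
  representation to a subspace needs. It is found by taking r maximal: a vector of U not fixed by A
  * B would yield one more column and one more row.\<close>

lemma subspace_factorization:
  assumes U: "subspace_vec d U"
  shows "\<exists>r A B. A \<in> carrier_mat d r \<and> B \<in> carrier_mat r d \<and> B * A = 1\<^sub>m r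
    \<and> (\<forall>v. v \<in> U \<longleftrightarrow> v \<in> carrier_vec d \<and> (A * B) *\<^sub>v v = v)"
proof -
  have z0: "c \<cdot>\<^sub>v 0\<^sub>v n = (0\<^sub>v n :: complex vec)" for c n by (intro eq_vecI) auto
  have z1: "X *\<^sub>v 0\<^sub>v m = 0\<^sub>v n" if "X \<in> carrier_mat n m" for X :: "complex mat" and n m
    using that by (intro eq_vecI) auto
  have Uc: "U \<subseteq> carrier_vec d" and U0: "0\<^sub>v d \<in> U"
    and Ua: "\<And>u v. u \<in> U \<Longrightarrow> v \<in> U \<Longrightarrow> u + v \<in> U"
    and Us: "\<And>c u. u \<in> U \<Longrightarrow> c \<cdot>\<^sub>v u \<in> U"
    using U by (auto simp: subspace_vec_def)
  define P where "P r \<longleftrightarrow> (\<exists>A B. A \<in> carrier_mat d r \<and> B \<in> carrier_mat r d \<and> B * A = 1\<^sub>m r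
    \<and> (\<forall>c \<in> carrier_vec r. A *\<^sub>v c \<in> U))" for r
  have P0: "P 0" unfolding P_def
  proof (intro exI conjI ballI)
    show "mat d 0 (\<lambda>_. 0::complex) \<in> carrier_mat d 0" "mat 0 d (\<lambda>_. 0::complex) \<in> carrier_mat 0 d" by auto
    show "mat 0 d (\<lambda>_. 0) * mat d 0 (\<lambda>_. 0) = (1\<^sub>m 0 :: complex mat)" by (intro eq_matI) auto
    fix c :: "complex vec" assume "c \<in> carrier_vec 0"
    hence "mat d 0 (\<lambda>_. 0::complex) *\<^sub>v c = 0\<^sub>v d"
      by (intro eq_vecI) (auto simp: scalar_prod_def)
    thus "mat d 0 (\<lambda>_. 0::complex) *\<^sub>v c \<in> U" using U0 by simp
  qed
  have bnd: "r \<le> d" if "P r" for r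
    using that left_inverse_dim_le unfolding P_def by blast
  define r where "r = (GREATEST r. P r)"
  have Pr: "P r" unfolding r_def using P0 bnd by (rule GreatestI_nat)
  have nPr: "\<not> P (Suc r)"
  proof
    assume "P (Suc r)"
    hence "Suc r \<le> r" unfolding r_def using bnd by (intro Greatest_le_nat) auto
    thus False by simp
  qed
  obtain A B where A: "A \<in> carrier_mat d r" and B: "B \<in> carrier_mat r d" and BA: "B * A = 1\<^sub>m r"
    and AU: "\<And>c. c \<in> carrier_vec r \<Longrightarrow> A *\<^sub>v c \<in> U" using Pr unfolding P_def by blast
  define E where "E = A * B"
  have E: "E \<in> carrier_mat d d" using A B by (auto simp: E_def)
  have EU: "E *\<^sub>v v \<in> U" if "v \<in> carrier_vec d" for v
  proof -
    have "E *\<^sub>v v = A *\<^sub>v (B *\<^sub>v v)" unfolding E_def using A B that by (simp add: assoc_mult_mat_vec)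
    thus ?thesis using AU B that by simp
  qed
  have EA: "E * A = A" unfolding E_def using A B BA by (simp add: assoc_mult_mat[of _ d r _ d _ r])
  have BE: "B * E = B" unfolding E_def using B BA
    by (simp add: assoc_mult_mat[OF B A B, symmetric])
  have fix1: "E *\<^sub>v u = u" if u: "u \<in> U" for u
  proof (rule ccontr)
    assume ne: "E *\<^sub>v u \<noteq> u"
    have uc: "u \<in> carrier_vec d" using u Uc by auto
    \<comment> \<open>The component of u that the current projection misses. It lies in U and is
      killed by B, which makes it a candidate for a new column.\<close>
    define w where "w = u + (-1) \<cdot>\<^sub>v (E *\<^sub>v u)"
    have wU: "w \<in> U" unfolding w_def by (intro Ua Us u EU uc)
    have wc: "w \<in> carrier_vec d" using wU Uc by auto
    have "\<exists>i<d. w $ i \<noteq> 0"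
    proof (rule ccontr)
      assume "\<not> (\<exists>i<d. w $ i \<noteq> 0)"
      hence "\<And>i. i < d \<Longrightarrow> u $ i = (E *\<^sub>v u) $ i" using uc E by (auto simp: w_def)
      hence "E *\<^sub>v u = u" using uc E by (intro eq_vecI) auto
      with ne show False by simp
    qed
    then obtain i0 where i0: "i0 < d" "w $ i0 \<noteq> 0" by blast
    have Bw: "B *\<^sub>v w = 0\<^sub>v r"
    proof -
      have "B *\<^sub>v w = B *\<^sub>v u + (-1) \<cdot>\<^sub>v (B *\<^sub>v (E *\<^sub>v u))"
        unfolding w_def using B E uc by (simp add: mult_add_distrib_mat_vec[of _ r d] mult_mat_vec)
      also have "B *\<^sub>v (E *\<^sub>v u) = B *\<^sub>v u"
          using BE by (simp add: assoc_mult_mat_vec[OF B E uc, symmetric])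
      finally show ?thesis using B uc by (intro eq_vecI) auto
    qed
    have Ew: "E *\<^sub>v w = 0\<^sub>v d"
      unfolding E_def using A B wc Bw by (simp add: assoc_mult_mat_vec z1)
    define a where "a = inverse (w $ i0) \<cdot>\<^sub>v w"
    have aU: "a \<in> U" and ac: "a \<in> carrier_vec d" and ai: "a $ i0 = 1"
      using wU Us wc i0 by (auto simp: a_def)
    have Ba: "B *\<^sub>v a = 0\<^sub>v r" using Bw B wc by (simp add: a_def mult_mat_vec[of _ r d] z0)
    have Ea: "E *\<^sub>v a = 0\<^sub>v d" using Ew E wc by (simp add: a_def mult_mat_vec[of _ d d] z0)
    define A' where "A' = mat d (Suc r) (\<lambda>(i, j). if j < r then A $$ (i, j) else a $ i)"
    \<comment> \<open>The new row is row i0 of 1 - E. It annihilates the columns of A because E * A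
      = A, and it takes the value 1 on a because E kills a and a is normalized at i0.\<close>
    define B' where "B' = mat (Suc r) d (\<lambda>(i, j). if i < r then B $$ (i, j)
        else (if j = i0 then 1 else 0) - E $$ (i0, j))"
    have A': "A' \<in> carrier_mat d (Suc r)" and B': "B' \<in> carrier_mat (Suc r) d"
      by (auto simp: A'_def B'_def)
    have "B' * A' = 1\<^sub>m (Suc r)"
    proof (intro eq_matI)
      fix i j assume "i < dim_row (1\<^sub>m (Suc r) :: complex mat)" "j < dim_col (1\<^sub>m (Suc r) :: complex mat)"
      hence ij: "i < Suc r" "j < Suc r" by auto
      have s: "(B' * A') $$ (i, j) = (\<Sum>l<d. B' $$ (i, l) * A' $$ (l, j))"
        by (rule index_mult_mat_sum[OF B' A' ij])
      consider "i < r" "j < r" | "i < r" "j = r" | "i = r" "j < r" | "i = r" "j = r" using ij by linarith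
      thus "(B' * A') $$ (i, j) = 1\<^sub>m (Suc r) $$ (i, j)"
      proof cases
        case 1
        have "(B' * A') $$ (i, j) = (B * A) $$ (i, j)"
          unfolding s index_mult_mat_sum[OF B A 1] using 1 by (intro sum.cong) (auto simp: A'_def B'_def)
        thus ?thesis using BA 1 by simp
      next
        case 2
        have "(B' * A') $$ (i, j) = (B *\<^sub>v a) $ i"
          unfolding s index_mult_vec_sum[OF B ac 2(1)] using 2 by (intro sum.cong) (auto simp: A'_def B'_def)
        thus ?thesis using Ba 2 by simp
      next
        case 3
        have "(B' * A') $$ (i, j) = (\<Sum>l<d. (if l = i0 then A $$ (l, j) else 0) - E $$ (i0, l) * A $$ (l, j))"
          unfolding s using 3 by (intro sum.cong) (auto simp: A'_def B'_def algebra_simps)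
        also have "\<dots> = A $$ (i0, j) - (E * A) $$ (i0, j)"
          unfolding index_mult_mat_sum[OF E A i0(1) 3(2)] using i0 by (simp add: sum_subtractf)
        finally show ?thesis using 3 EA by simp
      next
        case 4
        have "(B' * A') $$ (i, j) = (\<Sum>l<d. (if l = i0 then a $ l else 0) - E $$ (i0, l) * a $ l)"
          unfolding s using 4 by (intro sum.cong) (auto simp: A'_def B'_def algebra_simps)
        also have "\<dots> = a $ i0 - (E *\<^sub>v a) $ i0"
          unfolding index_mult_vec_sum[OF E ac i0(1)] using i0 by (simp add: sum_subtractf)
        finally show ?thesis using 4 Ea ai i0 by simp
      qed
    qed (use A' B' in auto)
    moreover have "A' *\<^sub>v c \<in> U" if c: "c \<in> carrier_vec (Suc r)" for c
    proof -
      define c' where "c' = vec r (\<lambda>i. c $ i)"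
      have c': "c' \<in> carrier_vec r" by (simp add: c'_def)
      have "A' *\<^sub>v c = A *\<^sub>v c' + (c $ r) \<cdot>\<^sub>v a"
      proof (intro eq_vecI)
        fix i assume "i < dim_vec (A *\<^sub>v c' + (c $ r) \<cdot>\<^sub>v a)"
        hence i: "i < d" using ac by simp
        have "(A' *\<^sub>v c) $ i = (\<Sum>l<Suc r. A' $$ (i, l) * c $ l)"
          by (rule index_mult_vec_sum[OF A' c i])
        also have "\<dots> = (\<Sum>l<r. A $$ (i, l) * c' $ l) + a $ i * c $ r"
          using i by (simp add: A'_def c'_def)
        finally show "(A' *\<^sub>v c) $ i = (A *\<^sub>v c' + (c $ r) \<cdot>\<^sub>v a) $ i"
          using i ac A index_mult_vec_sum[OF A c' i] by (simp del: index_mult_mat_vec)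
      qed (use A A' ac in auto)
      thus ?thesis using AU[OF c'] Us[OF aU] Ua by simp
    qed
    ultimately have "P (Suc r)" unfolding P_def using A' B' by blast
    with nPr show False by simp
  qed
  have "v \<in> U \<longleftrightarrow> v \<in> carrier_vec d \<and> (A * B) *\<^sub>v v = v" for v
    using fix1[of v] EU[of v] Uc unfolding E_def by auto
  thus ?thesis using A B BA by blast
qed

lemma mat_eqI_mult_vec:
  fixes X Y :: "complex mat"
  assumes X: "X \<in> carrier_mat n m" and Y: "Y \<in> carrier_mat n m"
    and eq: "\<And>v. v \<in> carrier_vec m \<Longrightarrow> X *\<^sub>v v = Y *\<^sub>v v"
  shows "X = Y"
proof (rule eq_matI)
  have *: "Z $$ (i, j) = (Z *\<^sub>v unit_vec m j) $ i"
    if "Z \<in> carrier_mat n m" "i < n" "j < m" for Z :: "complex mat" and i j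
  proof -
    have "(Z *\<^sub>v unit_vec m j) $ i = (\<Sum>l<m. Z $$ (i, l) * unit_vec m j $ l)"
      using that by (intro index_mult_vec_sum) auto
    also have "\<dots> = (\<Sum>l<m. if l = j then Z $$ (i, l) else 0)"
      using that by (intro sum.cong) auto
    finally show ?thesis using that by simp
  qed
  fix i j assume "i < dim_row Y" "j < dim_col Y"
  hence ij: "i < n" "j < m" using Y by auto
  have "X $$ (i, j) = (X *\<^sub>v unit_vec m j) $ i" by (rule *[OF X ij])
  also have "X *\<^sub>v unit_vec m j = Y *\<^sub>v unit_vec m j" by (rule eq) simp
  also have "\<dots> $ i = Y $$ (i, j)" by (rule *[OF Y ij, symmetric])
  finally show "X $$ (i, j) = Y $$ (i, j)" .
qed (use X Y in auto)

text \<open>Applied to the fixed space of E, \<open>subspace_factorization\<close> gives a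
  projection with the image of E but possibly another kernel. Replacing B by B * E corrects the
  kernel.\<close>

lemma idempotent_factorization:
  fixes E :: "complex mat"
  assumes E: "E \<in> carrier_mat d d" and idem: "E * E = E"
  shows "\<exists>r A B. A \<in> carrier_mat d r \<and> B \<in> carrier_mat r d \<and> B * A = 1\<^sub>m r \<and> A * B = E"
proof -
  define U where "U = {v \<in> carrier_vec d. E *\<^sub>v v = v}"
  have "E *\<^sub>v 0\<^sub>v d = 0\<^sub>v d" using E by (intro eq_vecI) auto
  moreover have "E *\<^sub>v (u + v) = u + v"
    if "u \<in> carrier_vec d" "v \<in> carrier_vec d" "E *\<^sub>v u = u" "E *\<^sub>v v = v" for u v
    using mult_add_distrib_mat_vec[OF E that(1,2)] that by simp
  moreover have "E *\<^sub>v (c \<cdot>\<^sub>v u) = c \<cdot>\<^sub>v u" if "u \<in> carrier_vec d" "E *\<^sub>v u = u" for u c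
    using mult_mat_vec[OF E that(1)] that by simp
  ultimately have "subspace_vec d U" unfolding subspace_vec_def U_def by simp
  from subspace_factorization[OF this] obtain r A B where A: "A \<in> carrier_mat d r"
    and B: "B \<in> carrier_mat r d" and BA: "B * A = 1\<^sub>m r"
    and U: "\<And>v. v \<in> U \<longleftrightarrow> v \<in> carrier_vec d \<and> (A * B) *\<^sub>v v = v" by blast
  have AB: "A * B \<in> carrier_mat d d" using A B by auto
  have ABA: "A * B * (A * B) = A * B"
    using B BA by (simp add: assoc_mult_mat[OF A B AB] assoc_mult_mat[OF B A B, symmetric])
  have 1: "A * B * E = E"
  proof (rule mat_eqI_mult_vec)
    fix v :: "complex vec" assume v: "v \<in> carrier_vec d"
    have "E *\<^sub>v v \<in> U" unfolding U_def using E v idem by (simp add: assoc_mult_mat_vec[OF E E v, symmetric])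
    thus "(A * B * E) *\<^sub>v v = E *\<^sub>v v" using U by (simp add: assoc_mult_mat_vec[OF AB E v])
  qed (use AB E in auto)
  have 2: "E * (A * B) = A * B"
  proof (rule mat_eqI_mult_vec)
    fix v :: "complex vec" assume v: "v \<in> carrier_vec d"
    have "(A * B) *\<^sub>v v \<in> U" unfolding U
      using mult_mat_vec_carrier[OF AB v] ABA by (simp add: assoc_mult_mat_vec[OF AB AB v, symmetric])
    thus "(E * (A * B)) *\<^sub>v v = (A * B) *\<^sub>v v" by (simp add: U_def assoc_mult_mat_vec[OF E AB v])
  qed (use AB E in auto)
  have BE: "B * E \<in> carrier_mat r d" using B E by auto
  have "E * A = A"
  proof -
    have "E * A = E * (A * B) * A"
      using A BA by (simp add: assoc_mult_mat[OF E AB A] assoc_mult_mat[OF A B A])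
    also have "\<dots> = A" unfolding 2 using A BA by (simp add: assoc_mult_mat[OF A B A])
    finally show ?thesis .
  qed
  hence "(B * E) * A = 1\<^sub>m r" using BA by (simp add: assoc_mult_mat[OF B E A])
  moreover have "A * (B * E) = E" using 1 unfolding assoc_mult_mat[OF A B E] .
  ultimately show ?thesis using A BE by blast
qed

section \<open>Representations of finite permutation groups\<close>

lemma representationD:
  assumes "representation G d \<rho>"
  shows "g \<in> G \<Longrightarrow> \<rho> g \<in> carrier_mat d d" "\<rho> id = 1\<^sub>m d"
    "g \<in> G \<Longrightarrow> h \<in> G \<Longrightarrow> \<rho> (g \<circ> h) = \<rho> g * \<rho> h"
  using assms by (auto simp: representation_def)

text \<open>Compression to the image of E: with E = A * B the group acts by B * \<rho> g * A, and
  this is multiplicative because E can be moved past \<rho> h and absorbed by A. The dimension is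
  reported as the trace of E so that complementary dimensions add up; the case r = 0 serves to
  exclude trivial splittings.\<close>

lemma idempotent_subrepresentation:
  assumes \<rho>: "representation G d \<rho>"
    and E: "E \<in> carrier_mat d d" and idem: "E * E = E"
    and comm: "\<And>g. g \<in> G \<Longrightarrow> \<rho> g * E = E * \<rho> g"
  shows "\<exists>r \<tau>. representation G r \<tau> \<and> of_nat r = mat_trace E \<and> (r = 0 \<longrightarrow> E = 0\<^sub>m d d)
    \<and> (\<forall>g\<in>G. mat_trace (\<tau> g) = mat_trace (\<rho> g * E))"
proof -
  note R = representationD[OF \<rho>]
  obtain r A B where A: "A \<in> carrier_mat d r" and B: "B \<in> carrier_mat r d"
    and BA: "B * A = 1\<^sub>m r" and AB: "A * B = E"
    using idempotent_factorization[OF E idem] by blast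
  have BE: "B * E = B" using B BA assoc_mult_mat[OF B A B] by (simp add: AB)
  have EA: "E * A = A" using A BA assoc_mult_mat[OF A B A] by (simp add: AB)
  define \<tau> where "\<tau> g = B * (\<rho> g * A)" for g
  have c: "\<tau> g \<in> carrier_mat r r" if "g \<in> G" for g
    using A B R(1)[OF that] by (auto simp: \<tau>_def)
  have m: "\<tau> (g \<circ> h) = \<tau> g * \<tau> h" if g: "g \<in> G" and h: "h \<in> G" for g h
  proof -
    note Rg = R(1)[OF g] and Rh = R(1)[OF h]
    have gA: "\<rho> g * A \<in> carrier_mat d r" and hA: "\<rho> h * A \<in> carrier_mat d r" using Rg Rh A by auto
    have "\<tau> g * \<tau> h = B * ((\<rho> g * A) * (B * (\<rho> h * A)))"
      unfolding \<tau>_def using B hA by (intro assoc_mult_mat[OF B gA]) auto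
    also have "(\<rho> g * A) * (B * (\<rho> h * A)) = \<rho> g * (A * (B * (\<rho> h * A)))"
      using B hA by (intro assoc_mult_mat[OF Rg A]) auto
    also have "A * (B * (\<rho> h * A)) = E * (\<rho> h * A)"
      using assoc_mult_mat[OF A B hA] by (simp add: AB)
    also have "\<dots> = \<rho> h * A"
      using assoc_mult_mat[OF E Rh A] assoc_mult_mat[OF Rh E A] comm[OF h] EA by simp
    also have "\<rho> g * (\<rho> h * A) = \<rho> (g \<circ> h) * A"
      using assoc_mult_mat[OF Rg Rh A] R(3)[OF g h] by simp
    finally show ?thesis by (simp add: \<tau>_def)
  qed
  have "\<tau> id = 1\<^sub>m r" using A BA R(2) by (simp add: \<tau>_def)
  hence rep: "representation G r \<tau>" unfolding representation_def using c m by blast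
  have tr: "mat_trace (\<tau> g) = mat_trace (\<rho> g * E)" if g: "g \<in> G" for g
  proof -
    note Rg = R(1)[OF g]
    have gA: "\<rho> g * A \<in> carrier_mat d r" using Rg A by auto
    have "mat_trace (\<tau> g) = mat_trace ((\<rho> g * A) * B)"
      unfolding \<tau>_def by (rule mat_trace_mult_comm[OF B gA])
    thus ?thesis using assoc_mult_mat[OF Rg A B] AB by simp
  qed
  have "mat_trace E = of_nat r" using mat_trace_mult_comm[OF A B] AB BA by simp
  moreover have "E = 0\<^sub>m d d" if "r = 0"
  proof (intro eq_matI)
    fix i j assume "i < dim_row (0\<^sub>m d d :: complex mat)" "j < dim_col (0\<^sub>m d d :: complex mat)"
    thus "E $$ (i, j) = 0\<^sub>m d d $$ (i, j)"
      using index_mult_mat_sum[OF A B, of i j] AB that by simp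
  qed (use E in auto)
  ultimately show ?thesis using rep tr by (intro exI[of _ r] exI[of _ \<tau>]) simp
qed

section \<open>Averaging over the group and complete reducibility\<close>

definition mat_sum :: "nat \<Rightarrow> nat \<Rightarrow> ('a \<Rightarrow> complex mat) \<Rightarrow> 'a set \<Rightarrow> complex mat" where
  "mat_sum n m F S = mat n m (\<lambda>(i, j). \<Sum>g\<in>S. F g $$ (i, j))"

lemma mat_sum_carrier [simp]: "mat_sum n m F S \<in> carrier_mat n m"
  by (simp add: mat_sum_def)

lemma dim_mat_sum [simp]: "dim_row (mat_sum n m F S) = n" "dim_col (mat_sum n m F S) = m"
  by (simp_all add: mat_sum_def)

lemma mat_sum_index [simp]: "i < n \<Longrightarrow> j < m \<Longrightarrow> mat_sum n m F S $$ (i, j) = (\<Sum>g\<in>S. F g $$ (i, j))"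
  by (simp add: mat_sum_def)

lemma mult_mat_sum:
  assumes "C \<in> carrier_mat k n" "\<And>g. g \<in> S \<Longrightarrow> F g \<in> carrier_mat n m"
  shows "C * mat_sum n m F S = mat_sum k m (\<lambda>g. C * F g) S"
proof (intro eq_matI)
  fix i j assume ij: "i < dim_row (mat_sum k m (\<lambda>g. C * F g) S)" "j < dim_col (mat_sum k m (\<lambda>g. C * F g) S)"
  hence ij: "i < k" "j < m" by (auto simp: mat_sum_def)
  have "(C * mat_sum n m F S) $$ (i, j) = (\<Sum>l<n. C $$ (i, l) * (\<Sum>g\<in>S. F g $$ (l, j)))"
    using ij by (subst index_mult_mat_sum[OF assms(1) mat_sum_carrier]) auto
  also have "\<dots> = (\<Sum>g\<in>S. \<Sum>l<n. C $$ (i, l) * F g $$ (l, j))"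
    by (subst sum.swap) (simp add: sum_distrib_left)
  also have "\<dots> = (\<Sum>g\<in>S. (C * F g) $$ (i, j))"
    using ij assms by (intro sum.cong) (auto simp: index_mult_mat_sum[OF assms] simp del: index_mult_mat(1))
  finally show "(C * mat_sum n m F S) $$ (i, j) = mat_sum k m (\<lambda>g. C * F g) S $$ (i, j)"
    using ij by simp
qed (use assms in \<open>auto simp: mat_sum_def\<close>)

lemma mat_sum_mult:
  assumes "C \<in> carrier_mat m k" "\<And>g. g \<in> S \<Longrightarrow> F g \<in> carrier_mat n m"
  shows "mat_sum n m F S * C = mat_sum n k (\<lambda>g. F g * C) S"
proof (intro eq_matI)
  fix i j assume ij: "i < dim_row (mat_sum n k (\<lambda>g. F g * C) S)" "j < dim_col (mat_sum n k (\<lambda>g. F g * C) S)"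
  hence ij: "i < n" "j < k" by (auto simp: mat_sum_def)
  have "(mat_sum n m F S * C) $$ (i, j) = (\<Sum>l<m. (\<Sum>g\<in>S. F g $$ (i, l)) * C $$ (l, j))"
    using ij by (subst index_mult_mat_sum[OF mat_sum_carrier assms(1)]) auto
  also have "\<dots> = (\<Sum>g\<in>S. \<Sum>l<m. F g $$ (i, l) * C $$ (l, j))"
    by (subst sum.swap) (simp add: sum_distrib_right)
  also have "\<dots> = (\<Sum>g\<in>S. (F g * C) $$ (i, j))"
    using ij assms by (intro sum.cong) (auto simp: index_mult_mat_sum[OF assms(2,1)] simp del: index_mult_mat(1))
  finally show "(mat_sum n m F S * C) $$ (i, j) = mat_sum n k (\<lambda>g. F g * C) S $$ (i, j)"
    using ij by simp
qed (use assms in \<open>auto simp: mat_sum_def\<close>)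

lemma mat_sum_cong:
  assumes "\<And>g. g \<in> S \<Longrightarrow> F g = F' g"
  shows "mat_sum n m F S = mat_sum n m F' S"
  using assms by (simp add: mat_sum_def cong: sum.cong)

lemma mat_sum_const:
  assumes "C \<in> carrier_mat n m"
  shows "mat_sum n m (\<lambda>_. C) S = of_nat (card S) \<cdot>\<^sub>m C"
  using assms by (intro eq_matI) auto

abbreviation pinv :: "perm \<Rightarrow> perm" where "pinv g \<equiv> Hilbert_Choice.inv g"

locale perm_group =
  fixes G :: "perm set"
  assumes finite_carrier: "finite G"
    and id_mem: "id \<in> G"
    and bij_mem: "g \<in> G \<Longrightarrow> bij g"
    and comp_mem: "g \<in> G \<Longrightarrow> h \<in> G \<Longrightarrow> g \<circ> h \<in> G"
    and inv_mem: "g \<in> G \<Longrightarrow> Hilbert_Choice.inv g \<in> G"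
begin

lemma inv_comp: "g \<in> G \<Longrightarrow> pinv g \<circ> g = id"
  and comp_inv: "g \<in> G \<Longrightarrow> g \<circ> pinv g = id"
  using bij_mem[of g] by (auto simp: fun_eq_iff bij_is_inj bij_is_surj surj_f_inv_f)

lemma inv_inv: "g \<in> G \<Longrightarrow> pinv (pinv g) = g"
  using bij_mem by (simp add: inv_inv_eq)

lemma inv_of_comp: "g \<in> G \<Longrightarrow> h \<in> G \<Longrightarrow> pinv (g \<circ> h) = pinv h \<circ> pinv g"
  using bij_mem by (simp add: o_inv_distrib)

lemma card_pos: "card G > 0"
  using finite_carrier id_mem by (auto simp: card_gt_0_iff)

lemma cancel:
  assumes "g \<in> G"
  shows "g \<circ> (pinv g \<circ> h) = h" "pinv g \<circ> (g \<circ> h) = h" "(h \<circ> g) \<circ> pinv g = h" "(h \<circ> pinv g) \<circ> g = h"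
proof -
  show "g \<circ> (pinv g \<circ> h) = h" "pinv g \<circ> (g \<circ> h) = h"
    using comp_inv[OF assms] inv_comp[OF assms] by (simp_all add: o_assoc)
  show "(h \<circ> g) \<circ> pinv g = h" "(h \<circ> pinv g) \<circ> g = h"
    using comp_inv[OF assms] inv_comp[OF assms] by (simp_all add: o_assoc[symmetric])
qed

lemma sum_left_translate: "h \<in> G \<Longrightarrow> (\<Sum>g\<in>G. f (h \<circ> g)) = (\<Sum>g\<in>G. f g)"
  by (rule sum.reindex_bij_witness[of _ "\<lambda>g. pinv h \<circ> g" "\<lambda>g. h \<circ> g"])
    (auto simp: cancel comp_mem inv_mem)

lemma sum_inv: "(\<Sum>g\<in>G. f (pinv g)) = (\<Sum>g\<in>G. f g)"
  by (rule sum.reindex_bij_witness[of _ pinv pinv]) (auto simp: inv_inv inv_mem)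

lemma rep_inv:
  assumes "representation G d \<rho>" "g \<in> G"
  shows "\<rho> g * \<rho> (pinv g) = 1\<^sub>m d" "\<rho> (pinv g) * \<rho> g = 1\<^sub>m d"
proof -
  note R = representationD[OF assms(1)]
  show "\<rho> g * \<rho> (pinv g) = 1\<^sub>m d" using R(3)[OF assms(2) inv_mem[OF assms(2)]] R(2) comp_inv[OF assms(2)] by simp
  show "\<rho> (pinv g) * \<rho> g = 1\<^sub>m d" using R(3)[OF inv_mem[OF assms(2)] assms(2)] R(2) inv_comp[OF assms(2)] by simp
qed

text \<open>Maschke's averaging: the conjugates of a projection P onto U are averaged over the
  group. Invariance of U means P * \<rho> g * P = \<rho> g * P, whence the average E satisfies P * E
  = E and E * P = P. So E is again a projection onto U, and it commutes with the group.\<close>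

lemma invariant_idempotent:
  assumes \<rho>: "representation G d \<rho>" and U: "subspace_vec d U"
    and inv: "\<And>g u. g \<in> G \<Longrightarrow> u \<in> U \<Longrightarrow> \<rho> g *\<^sub>v u \<in> U"
    and ne: "U \<noteq> {0\<^sub>v d}" "U \<noteq> carrier_vec d"
  shows "\<exists>E. E \<in> carrier_mat d d \<and> E * E = E \<and> (\<forall>g\<in>G. \<rho> g * E = E * \<rho> g) \<and> E \<noteq> 0\<^sub>m d d \<and> E \<noteq> 1\<^sub>m d"
proof -
  note R = representationD[OF \<rho>]
  obtain r A B where A: "A \<in> carrier_mat d r" and B: "B \<in> carrier_mat r d" and BA: "B * A = 1\<^sub>m r"
    and UE: "\<And>v. v \<in> U \<longleftrightarrow> v \<in> carrier_vec d \<and> (A * B) *\<^sub>v v = v"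
    using subspace_factorization[OF U] by blast
  define P where "P = A * B"
  have P: "P \<in> carrier_mat d d" using A B by (auto simp: P_def)
  have PP: "P * P = P"
  proof -
    have "B * P = B" using assoc_mult_mat[OF B A B, symmetric] B BA by (simp add: P_def)
    thus ?thesis using assoc_mult_mat[OF A B P] by (simp add: P_def)
  qed
  \<comment> \<open>Checked column by column, since every column of P lies in U.\<close>
  have PrP: "P * (\<rho> g * P) = \<rho> g * P" if g: "g \<in> G" for g
  proof (rule eq_matI)
    note Rg = R(1)[OF g]
    fix i j assume "i < dim_row (\<rho> g * P)" "j < dim_col (\<rho> g * P)"
    hence ij: "i < d" "j < d" using Rg P by auto
    have cj: "col P j \<in> carrier_vec d" using P ij by auto
    have "P *\<^sub>v col P j = col P j"
      using col_mult2[OF P P ij(2)] unfolding PP by (rule sym)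
    hence "col P j \<in> U" unfolding UE P_def[symmetric] using cj by simp
    hence "\<rho> g *\<^sub>v col P j \<in> U" using inv g by blast
    hence *: "P *\<^sub>v (\<rho> g *\<^sub>v col P j) = \<rho> g *\<^sub>v col P j" unfolding UE P_def[symmetric] by simp
    have gP: "\<rho> g * P \<in> carrier_mat d d" using Rg P by auto
    have "col (P * (\<rho> g * P)) j = col (\<rho> g * P) j"
      unfolding col_mult2[OF P gP ij(2)] col_mult2[OF Rg P ij(2)] by (rule *)
    hence "col (P * (\<rho> g * P)) j $ i = col (\<rho> g * P) j $ i" by simp
    moreover have "X $$ (i, j) = col X j $ i" if "X \<in> carrier_mat d d" for X :: "complex mat"
      using that ij by simp
    ultimately show "(P * (\<rho> g * P)) $$ (i, j) = (\<rho> g * P) $$ (i, j)"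
      using gP mult_carrier_mat[OF P gP] by simp
  qed (use R(1)[OF g] P in auto)
  define F where "F g = \<rho> g * P * \<rho> (pinv g)" for g
  have Fc: "F g \<in> carrier_mat d d" if "g \<in> G" for g
    using R(1)[OF that] R(1)[OF inv_mem[OF that]] P by (auto simp: F_def)
  define c :: complex where "c = inverse (of_nat (card G))"
  have cG: "c * of_nat (card G) = 1" using card_pos by (simp add: c_def)
  define M where "M = mat_sum d d F G"
  have M: "M \<in> carrier_mat d d" by (simp add: M_def)
  define E where "E = c \<cdot>\<^sub>m M"
  have E: "E \<in> carrier_mat d d" using M by (simp add: E_def)
  have "P * M = mat_sum d d (\<lambda>g. P * F g) G" unfolding M_def by (rule mult_mat_sum[OF P Fc])
  also have "\<dots> = M" unfolding M_def
  proof (intro mat_sum_cong)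
    fix g assume g: "g \<in> G"
    note Rg = R(1)[OF g] and Ri = R(1)[OF inv_mem[OF g]]
    have gP: "\<rho> g * P \<in> carrier_mat d d" using Rg P by auto
    show "P * F g = F g" unfolding F_def using assoc_mult_mat[OF P gP Ri] PrP[OF g] by simp
  qed
  finally have PE: "P * E = E" using P M by (simp add: E_def mult_smult_distrib)
  have "M * P = mat_sum d d (\<lambda>g. F g * P) G" unfolding M_def by (rule mat_sum_mult[OF P Fc])
  also have "\<dots> = mat_sum d d (\<lambda>_. P) G"
  proof (intro mat_sum_cong)
    fix g assume g: "g \<in> G"
    note Rg = R(1)[OF g] and Ri = R(1)[OF inv_mem[OF g]]
    have gP: "\<rho> g * P \<in> carrier_mat d d" and iP: "\<rho> (pinv g) * P \<in> carrier_mat d d" using Rg Ri P by auto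
    have "F g * P = \<rho> g * (P * (\<rho> (pinv g) * P))"
      unfolding F_def using assoc_mult_mat[OF gP Ri P] assoc_mult_mat[OF Rg P iP] by simp
    also have "\<dots> = \<rho> g * (\<rho> (pinv g) * P)" using PrP[OF inv_mem[OF g]] by simp
    also have "\<dots> = P" using assoc_mult_mat[OF Rg Ri P] rep_inv[OF \<rho> g] P by simp
    finally show "F g * P = P" .
  qed
  finally have "M * P = of_nat (card G) \<cdot>\<^sub>m P" using mat_sum_const[OF P] by simp
  moreover have "c \<cdot>\<^sub>m (of_nat (card G) \<cdot>\<^sub>m P) = P"
    using cG by (intro eq_matI) (auto simp: mult.assoc[symmetric])
  ultimately have EP: "E * P = P" using mult_smult_assoc_mat[OF M P] by (simp add: E_def)
  have "E * (P * E) = E * P * E" using assoc_mult_mat[OF E P E] by simp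
  hence EE: "E * E = E" by (simp add: EP PE)
  have comm: "\<rho> h * E = E * \<rho> h" if h: "h \<in> G" for h
  proof -
    note Rh = R(1)[OF h]
    have "\<rho> h * M = mat_sum d d (\<lambda>g. \<rho> h * F g) G" unfolding M_def by (rule mult_mat_sum[OF Rh Fc])
    also have "\<dots> = mat_sum d d (\<lambda>g. F (h \<circ> g) * \<rho> h) G"
    proof (intro mat_sum_cong)
      fix g assume g: "g \<in> G"
      note Rg = R(1)[OF g] and Ri = R(1)[OF inv_mem[OF g]] and Rj = R(1)[OF inv_mem[OF h]]
      have gP: "\<rho> g * P \<in> carrier_mat d d" and hgP: "\<rho> (h \<circ> g) * P \<in> carrier_mat d d"
        using Rg R(1)[OF comp_mem[OF h g]] P by auto
      have ij: "\<rho> (pinv g) * \<rho> (pinv h) \<in> carrier_mat d d" using Ri Rj by auto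
      have "F (h \<circ> g) * \<rho> h = \<rho> (h \<circ> g) * P * (\<rho> (pinv g) * \<rho> (pinv h)) * \<rho> h"
        unfolding F_def inv_of_comp[OF h g] R(3)[OF inv_mem[OF g] inv_mem[OF h]] by simp
      also have "\<dots> = \<rho> (h \<circ> g) * P * (\<rho> (pinv g) * \<rho> (pinv h) * \<rho> h)"
        by (rule assoc_mult_mat[OF hgP ij Rh])
      also have "\<rho> (pinv g) * \<rho> (pinv h) * \<rho> h = \<rho> (pinv g)"
        using assoc_mult_mat[OF Ri Rj Rh] rep_inv(2)[OF \<rho> h] Ri by simp
      also have "\<rho> (h \<circ> g) * P * \<rho> (pinv g) = \<rho> h * F g"
        unfolding F_def R(3)[OF h g] using assoc_mult_mat[OF Rh Rg P] assoc_mult_mat[OF Rh gP Ri] by simp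
      finally show "\<rho> h * F g = F (h \<circ> g) * \<rho> h" by (rule sym)
    qed
    also have "\<dots> = mat_sum d d (\<lambda>g. F g * \<rho> h) G"
      unfolding mat_sum_def by (simp only: sum_left_translate[OF h, of "\<lambda>g. (F g * \<rho> h) $$ _"])
    also have "\<dots> = M * \<rho> h" unfolding M_def by (rule mat_sum_mult[OF Rh Fc, symmetric])
    finally show ?thesis using Rh M by (simp add: E_def mult_smult_assoc_mat[of _ d d] mult_smult_distrib[of _ d d])
  qed
  have "E \<noteq> 0\<^sub>m d d"
  proof
    assume "E = 0\<^sub>m d d"
    hence "P = 0\<^sub>m d d" using EP P by simp
    moreover have "0\<^sub>m d d *\<^sub>v v = 0\<^sub>v d" if "v \<in> carrier_vec d" for v :: "complex vec"
      using that by (intro eq_vecI) auto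
    ultimately have "v = 0\<^sub>v d" if "v \<in> U" for v
      using that UE[of v] unfolding P_def[symmetric] by auto
    moreover have "0\<^sub>v d \<in> U" using U by (simp add: subspace_vec_def)
    ultimately show False using ne by blast
  qed
  moreover have "E \<noteq> 1\<^sub>m d"
  proof
    assume "E = 1\<^sub>m d"
    hence "P = 1\<^sub>m d" using PE P by simp
    hence "v \<in> U \<longleftrightarrow> v \<in> carrier_vec d" for v
      using UE[of v] unfolding P_def[symmetric] by (cases "v \<in> carrier_vec d") simp_all
    hence "U = carrier_vec d" by blast
    thus False using ne by blast
  qed
  ultimately show ?thesis using E EE comm by blast
qed

lemma character_in_Irr:
  assumes "irreducible_rep G d \<rho>"
  shows "(\<lambda>g. if g \<in> G then mat_trace (\<rho> g) else 0) \<in> Irr G"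
  unfolding Irr_def using assms by auto

text \<open>Splitting along an invariant idempotent E and 1 - E lowers both dimensions, so induction
  on the dimension applies. A list is used rather than a set because multiplicities matter: they are
  what must finally be shown to equal 1.\<close>

theorem character_sum_irreducibles:
  assumes "representation G d \<rho>"
  shows "\<exists>xs. set xs \<subseteq> Irr G \<and> (\<forall>g\<in>G. mat_trace (\<rho> g) = (\<Sum>\<chi>\<leftarrow>xs. \<chi> g))"
  using assms
proof (induction d arbitrary: \<rho> rule: less_induct)
  case (less d)
  note \<rho> = less.prems
  note R = representationD[OF \<rho>]
  consider "d = 0" | "irreducible_rep G d \<rho>" | "d > 0" "\<not> irreducible_rep G d \<rho>" by blast
  thus ?case
  proof cases
    case 1
    have "mat_trace (\<rho> g) = 0" if "g \<in> G" for g using R(1)[OF that] 1 by (simp add: mat_trace_def)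
    thus ?thesis by (intro exI[of _ "[]"]) simp
  next
    case 2
    thus ?thesis using character_in_Irr[OF 2]
      by (intro exI[of _ "[\<lambda>g. if g \<in> G then mat_trace (\<rho> g) else 0]"]) simp
  next
    case 3
    then obtain U where U: "subspace_vec d U" "\<And>g u. g \<in> G \<Longrightarrow> u \<in> U \<Longrightarrow> \<rho> g *\<^sub>v u \<in> U"
      "U \<noteq> {0\<^sub>v d}" "U \<noteq> carrier_vec d" unfolding irreducible_rep_def using \<rho> by blast
    obtain E where E: "E \<in> carrier_mat d d" and EE: "E * E = E"
      and comm: "\<And>g. g \<in> G \<Longrightarrow> \<rho> g * E = E * \<rho> g" and ne: "E \<noteq> 0\<^sub>m d d" "E \<noteq> 1\<^sub>m d"
      using invariant_idempotent[OF \<rho> U] by blast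
    define E' where "E' = 1\<^sub>m d - E"
    have E': "E' \<in> carrier_mat d d" using E by (auto simp: E'_def)
    have dl: "C * E' = C - C * E" and dr: "E' * C = C - E * C" if "C \<in> carrier_mat d d" for C
      unfolding E'_def using that mult_minus_distrib_mat[OF that one_carrier_mat E]
        minus_mult_distrib_mat[OF one_carrier_mat E that] by simp_all
    have EE': "E' * E' = E'"
      unfolding dr[OF E'] dl[OF E] EE using E E' by (intro eq_matI) auto
    have comm': "\<rho> g * E' = E' * \<rho> g" if "g \<in> G" for g
      using dl[OF R(1)[OF that]] dr[OF R(1)[OF that]] comm[OF that] by simp
    obtain r1 \<tau>1 where 1: "representation G r1 \<tau>1" "of_nat r1 = mat_trace E" "r1 = 0 \<longrightarrow> E = 0\<^sub>m d d"
      "\<And>g. g \<in> G \<Longrightarrow> mat_trace (\<tau>1 g) = mat_trace (\<rho> g * E)"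
      using idempotent_subrepresentation[OF \<rho> E EE comm] by blast
    obtain r2 \<tau>2 where 2: "representation G r2 \<tau>2" "of_nat r2 = mat_trace E'" "r2 = 0 \<longrightarrow> E' = 0\<^sub>m d d"
      "\<And>g. g \<in> G \<Longrightarrow> mat_trace (\<tau>2 g) = mat_trace (\<rho> g * E')"
      using idempotent_subrepresentation[OF \<rho> E' EE' comm'] by blast
    have "of_nat (r1 + r2) = (of_nat d :: complex)"
      using 1(2) 2(2) mat_trace_minus[OF one_carrier_mat E] by (simp add: E'_def)
    hence sum: "r1 + r2 = d" by (simp only: of_nat_eq_iff)
    have "E' \<noteq> 0\<^sub>m d d"
    proof
      assume z: "E' = 0\<^sub>m d d"
      have "E = 1\<^sub>m d"
      proof (rule eq_matI)
        fix i j assume "i < dim_row (1\<^sub>m d :: complex mat)" "j < dim_col (1\<^sub>m d :: complex mat)"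
        hence "i < d" "j < d" by auto
        moreover from this have "E' $$ (i, j) = 0" using z by simp
        ultimately show "E $$ (i, j) = 1\<^sub>m d $$ (i, j)" using E by (simp add: E'_def)
      qed (use E in auto)
      with ne show False by simp
    qed
    hence lt: "r1 < d" "r2 < d" using sum 1(3) 2(3) ne by auto
    obtain xs where xs: "set xs \<subseteq> Irr G" "\<And>g. g \<in> G \<Longrightarrow> mat_trace (\<tau>1 g) = (\<Sum>\<chi>\<leftarrow>xs. \<chi> g)"
      using less.IH[OF lt(1) 1(1)] by blast
    obtain ys where ys: "set ys \<subseteq> Irr G" "\<And>g. g \<in> G \<Longrightarrow> mat_trace (\<tau>2 g) = (\<Sum>\<chi>\<leftarrow>ys. \<chi> g)"
      using less.IH[OF lt(2) 2(1)] by blast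
    have "mat_trace (\<rho> g) = (\<Sum>\<chi>\<leftarrow>xs @ ys. \<chi> g)" if g: "g \<in> G" for g
    proof -
      have "mat_trace (\<rho> g * E') = mat_trace (\<rho> g) - mat_trace (\<rho> g * E)"
        unfolding dl[OF R(1)[OF g]] using R(1)[OF g] E by (intro mat_trace_minus) auto
      thus ?thesis using xs(2)[OF g] ys(2)[OF g] 1(4)[OF g] 2(4)[OF g]
        by (simp add: algebra_simps)
    qed
    thus ?thesis using xs(1) ys(1) by (intro exI[of _ "xs @ ys"]) simp
  qed
qed

section \<open>Schur's lemma\<close>

lemma intertwiner_right_inverse:
  assumes irr: "irreducible_rep G d \<rho>" and M: "M \<in> carrier_mat d e" and ne: "M \<noteq> 0\<^sub>m d e"
    and \<tau>: "\<And>g. g \<in> G \<Longrightarrow> \<tau> g \<in> carrier_mat e e"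
    and tw: "\<And>g. g \<in> G \<Longrightarrow> \<rho> g * M = M * \<tau> g"
  shows "\<exists>N \<in> carrier_mat e d. M * N = 1\<^sub>m d"
proof -
  have \<rho>: "representation G d \<rho>" using irr by (simp add: irreducible_rep_def)
  note R = representationD[OF \<rho>]
  \<comment> \<open>The image of M is invariant and nonzero, hence everything by irreducibility.
    Preimages of the unit vectors then serve as the columns of N.\<close>
  define U where "U = {M *\<^sub>v c | c. c \<in> carrier_vec e}"
  have "M *\<^sub>v 0\<^sub>v e = 0\<^sub>v d" using M by (intro eq_vecI) auto
  hence "0\<^sub>v d \<in> U" unfolding U_def by (metis (mono_tags, lifting) mem_Collect_eq zero_carrier_vec)
  moreover have "u + v \<in> U" if uv: "u \<in> U" "v \<in> U" for u v
  proof -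
    obtain a b where "u = M *\<^sub>v a" "v = M *\<^sub>v b" "a \<in> carrier_vec e" "b \<in> carrier_vec e"
      using uv unfolding U_def by blast
    hence "u + v = M *\<^sub>v (a + b)" "a + b \<in> carrier_vec e"
      using mult_add_distrib_mat_vec[OF M] by auto
    thus ?thesis unfolding U_def by blast
  qed
  moreover have "c \<cdot>\<^sub>v u \<in> U" if u: "u \<in> U" for c u
  proof -
    obtain a where "u = M *\<^sub>v a" "a \<in> carrier_vec e" using u unfolding U_def by blast
    hence "c \<cdot>\<^sub>v u = M *\<^sub>v (c \<cdot>\<^sub>v a)" "c \<cdot>\<^sub>v a \<in> carrier_vec e"
      using mult_mat_vec[OF M] by auto
    thus ?thesis unfolding U_def by blast
  qed
  moreover have "U \<subseteq> carrier_vec d" unfolding U_def using M by auto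
  ultimately have sub: "subspace_vec d U" unfolding subspace_vec_def by blast
  have inv: "\<rho> g *\<^sub>v u \<in> U" if g: "g \<in> G" and u: "u \<in> U" for g u
  proof -
    obtain a where a: "u = M *\<^sub>v a" "a \<in> carrier_vec e" using u unfolding U_def by blast
    have "\<rho> g *\<^sub>v u = M *\<^sub>v (\<tau> g *\<^sub>v a)"
      using assoc_mult_mat_vec[OF R(1)[OF g] M a(2)] assoc_mult_mat_vec[OF M \<tau>[OF g] a(2)] tw[OF g] a(1) by simp
    moreover have "\<tau> g *\<^sub>v a \<in> carrier_vec e" using \<tau>[OF g] a by auto
    ultimately show ?thesis unfolding U_def by blast
  qed
  have "U \<noteq> {0\<^sub>v d}"
  proof
    assume U: "U = {0\<^sub>v d}"
    have "M = 0\<^sub>m d e"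
    proof (rule mat_eqI_mult_vec[OF M])
      fix v :: "complex vec" assume v: "v \<in> carrier_vec e"
      hence "M *\<^sub>v v = 0\<^sub>v d" using U unfolding U_def by blast
      also have "0\<^sub>v d = 0\<^sub>m d e *\<^sub>v v" using v by (intro eq_vecI) auto
      finally show "M *\<^sub>v v = 0\<^sub>m d e *\<^sub>v v" .
    qed simp
    with ne show False ..
  qed
  hence full: "U = carrier_vec d" using irr sub inv unfolding irreducible_rep_def by blast
  have "\<exists>c. c \<in> carrier_vec e \<and> M *\<^sub>v c = unit_vec d j" if "j < d" for j
  proof -
    have "unit_vec d j \<in> U" unfolding full by simp
    thus ?thesis unfolding U_def by auto
  qed
  then obtain c where c: "\<And>j. j < d \<Longrightarrow> c j \<in> carrier_vec e" "\<And>j. j < d \<Longrightarrow> M *\<^sub>v c j = unit_vec d j"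
    by metis
  define N where "N = mat e d (\<lambda>(i, j). c j $ i)"
  have N: "N \<in> carrier_mat e d" by (simp add: N_def)
  have "M * N = 1\<^sub>m d"
  proof (rule eq_matI)
    fix i j assume "i < dim_row (1\<^sub>m d :: complex mat)" "j < dim_col (1\<^sub>m d :: complex mat)"
    hence ij: "i < d" "j < d" by auto
    have "(M * N) $$ (i, j) = (\<Sum>l<e. M $$ (i, l) * c j $ l)"
      unfolding index_mult_mat_sum[OF M N ij] using ij by (simp add: N_def)
    also have "\<dots> = (M *\<^sub>v c j) $ i" using index_mult_vec_sum[OF M c(1)[OF ij(2)] ij(1)] by simp
    finally show "(M * N) $$ (i, j) = 1\<^sub>m d $$ (i, j)" using c(2)[OF ij(2)] ij by (simp add: unit_vec_def)
  qed (use M N in auto)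
  thus ?thesis using N by blast
qed

text \<open>The kernel of M is invariant, so irreducibility of \<tau> makes it either 0 or
  everything, and v excludes the former.\<close>

lemma intertwiner_kernel:
  assumes irr: "irreducible_rep G e \<tau>" and M: "M \<in> carrier_mat d e"
    and \<rho>: "\<And>g. g \<in> G \<Longrightarrow> \<rho> g \<in> carrier_mat d d"
    and tw: "\<And>g. g \<in> G \<Longrightarrow> \<rho> g * M = M * \<tau> g"
    and v: "v \<in> carrier_vec e" "v \<noteq> 0\<^sub>v e" "M *\<^sub>v v = 0\<^sub>v d"
  shows "M = 0\<^sub>m d e"
proof -
  have \<tau>: "representation G e \<tau>" using irr by (simp add: irreducible_rep_def)
  note T = representationD[OF \<tau>]
  define U where "U = {v \<in> carrier_vec e. M *\<^sub>v v = 0\<^sub>v d}"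
  have z: "X *\<^sub>v 0\<^sub>v n = 0\<^sub>v m" if "X \<in> carrier_mat m n" for X :: "complex mat" and n m
    using that by (intro eq_vecI) auto
  have zs: "c \<cdot>\<^sub>v 0\<^sub>v n = (0\<^sub>v n :: complex vec)" for c n by (intro eq_vecI) auto
  have sub: "subspace_vec e U" unfolding subspace_vec_def U_def
    using z[OF M] mult_add_distrib_mat_vec[OF M] mult_mat_vec[OF M] zs by simp
  have inv: "\<tau> g *\<^sub>v u \<in> U" if g: "g \<in> G" and u: "u \<in> U" for g u
  proof -
    have a: "u \<in> carrier_vec e" "M *\<^sub>v u = 0\<^sub>v d" using u by (auto simp: U_def)
    have "M *\<^sub>v (\<tau> g *\<^sub>v u) = \<rho> g *\<^sub>v (M *\<^sub>v u)"
      using assoc_mult_mat_vec[OF \<rho>[OF g] M a(1)] assoc_mult_mat_vec[OF M T(1)[OF g] a(1)] tw[OF g] by simp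
    also have "\<dots> = 0\<^sub>v d" using a z[OF \<rho>[OF g]] by simp
    finally show ?thesis using T(1)[OF g] a by (simp add: U_def)
  qed
  have "v \<in> U" using v by (simp add: U_def)
  hence "U \<noteq> {0\<^sub>v e}" using v by auto
  hence full: "U = carrier_vec e" using irr sub inv unfolding irreducible_rep_def by blast
  show ?thesis
  proof (rule mat_eqI_mult_vec[OF M])
    fix w :: "complex vec" assume w: "w \<in> carrier_vec e"
    hence "w \<in> U" unfolding full .
    hence "M *\<^sub>v w = 0\<^sub>v d" by (simp add: U_def)
    also have "0\<^sub>v d = 0\<^sub>m d e *\<^sub>v w" using w by (intro eq_vecI) auto
    finally show "M *\<^sub>v w = 0\<^sub>m d e *\<^sub>v w" .
  qed simp
qed

text \<open>Over the complex numbers M has an eigenvalue k. The difference M - k commutes with the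
  group and kills an eigenvector, so it vanishes by \<open>intertwiner_kernel\<close>.\<close>

lemma schur_scalar:
  assumes irr: "irreducible_rep G d \<rho>" and M: "M \<in> carrier_mat d d"
    and comm: "\<And>g. g \<in> G \<Longrightarrow> \<rho> g * M = M * \<rho> g"
  shows "\<exists>c. M = c \<cdot>\<^sub>m 1\<^sub>m d"
proof -
  have \<rho>: "representation G d \<rho>" and d: "d > 0" using irr by (simp_all add: irreducible_rep_def)
  note R = representationD[OF \<rho>]
  obtain k where "eigenvalue M k" using spectrum_non_empty[OF M d] by (auto simp: spectrum_def)
  then obtain v where v: "v \<in> carrier_vec d" "v \<noteq> 0\<^sub>v d" "M *\<^sub>v v = k \<cdot>\<^sub>v v"
    using M by (auto simp: eigenvalue_def eigenvector_def)
  define K where "K = k \<cdot>\<^sub>m 1\<^sub>m d"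
  have K: "K \<in> carrier_mat d d" by (simp add: K_def)
  have MK: "M - K \<in> carrier_mat d d" using K by auto
  have tw: "\<rho> g * (M - K) = (M - K) * \<rho> g" if g: "g \<in> G" for g
  proof -
    have "\<rho> g * K = k \<cdot>\<^sub>m \<rho> g" "K * \<rho> g = k \<cdot>\<^sub>m \<rho> g"
      using mult_smult_distrib[OF R(1)[OF g] one_carrier_mat] mult_smult_assoc_mat[OF one_carrier_mat R(1)[OF g]] R(1)[OF g]
      by (simp_all add: K_def)
    thus ?thesis
      using mult_minus_distrib_mat[OF R(1)[OF g] M K] minus_mult_distrib_mat[OF M K R(1)[OF g]] comm[OF g] by simp
  qed
  have "(M - K) *\<^sub>v v = 0\<^sub>v d"
  proof -
    have "(M - K) *\<^sub>v v = M *\<^sub>v v - K *\<^sub>v v" by (rule minus_mult_distrib_mat_vec[OF M K v(1)])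
    also have "K *\<^sub>v v = k \<cdot>\<^sub>v v"
      using v(1) by (intro eq_vecI) (auto simp: K_def)
    finally show ?thesis using v by simp
  qed
  hence "M - K = 0\<^sub>m d d" by (intro intertwiner_kernel[OF irr MK _ tw v(1,2)] R(1))
  hence z: "(M - K) $$ (i, j) = 0" if "i < d" "j < d" for i j using that by simp
  have "M = K"
  proof (rule eq_matI)
    fix i j assume "i < dim_row K" "j < dim_col K"
    thus "M $$ (i, j) = K $$ (i, j)" using z[of i j] M K by simp
  qed (use M K in auto)
  thus ?thesis by (auto simp: K_def)
qed

section \<open>Orthogonality of characters and the Frobenius-Schur indicator\<close>

definition coeff_avg :: "nat \<Rightarrow> nat \<Rightarrow> (perm \<Rightarrow> complex mat) \<Rightarrow> (perm \<Rightarrow> complex mat) \<Rightarrow> nat \<Rightarrow> nat \<Rightarrow> complex mat" where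
  "coeff_avg d e \<rho> \<tau> i j = mat d e (\<lambda>(a, b). \<Sum>g\<in>G. \<rho> g $$ (a, i) * \<tau> (pinv g) $$ (j, b))"

lemma coeff_avg_carrier [simp]: "coeff_avg d e \<rho> \<tau> i j \<in> carrier_mat d e"
  by (simp add: coeff_avg_def)

lemma coeff_avg_index [simp]: "a < d \<Longrightarrow> b < e \<Longrightarrow>
   coeff_avg d e \<rho> \<tau> i j $$ (a, b) = (\<Sum>g\<in>G. \<rho> g $$ (a, i) * \<tau> (pinv g) $$ (j, b))"
  by (simp add: coeff_avg_def)

text \<open>\<open>coeff_avg d e \<rho> \<tau> i j\<close> is the unnormalized average of \<rho>(g)
  E \<tau>(g)^-1, where E is the matrix unit at (i, j). Multiplying by \<rho> h on the left only
  reindexes the sum by g -> h g.\<close>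

lemma coeff_avg_intertwines:
  assumes \<rho>: "representation G d \<rho>" and \<tau>: "representation G e \<tau>" and ij: "i < d" "j < e" and h: "h \<in> G"
  shows "\<rho> h * coeff_avg d e \<rho> \<tau> i j = coeff_avg d e \<rho> \<tau> i j * \<tau> h" (is "\<rho> h * ?M = _")
proof (rule eq_matI)
  note R = representationD[OF \<rho>] and T = representationD[OF \<tau>]
  fix a b assume "a < dim_row (?M * \<tau> h)" "b < dim_col (?M * \<tau> h)"
  hence ab: "a < d" "b < e" using T(1)[OF h] by (auto simp: coeff_avg_def)
  define f where "f g = \<rho> g $$ (a, i) * \<tau> (pinv g \<circ> h) $$ (j, b)" for g
  have "(\<rho> h * ?M) $$ (a, b) = (\<Sum>l<d. \<rho> h $$ (a, l) * (\<Sum>g\<in>G. \<rho> g $$ (l, i) * \<tau> (pinv g) $$ (j, b)))"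
    using ab by (subst index_mult_mat_sum[OF R(1)[OF h] coeff_avg_carrier]) auto
  also have "\<dots> = (\<Sum>g\<in>G. (\<Sum>l<d. \<rho> h $$ (a, l) * \<rho> g $$ (l, i)) * \<tau> (pinv g) $$ (j, b))"
    unfolding sum_distrib_left sum_distrib_right by (subst sum.swap) (simp add: mult.assoc)
  also have "\<dots> = (\<Sum>g\<in>G. f (h \<circ> g))"
  proof (intro sum.cong refl)
    fix g assume g: "g \<in> G"
    have "(\<Sum>l<d. \<rho> h $$ (a, l) * \<rho> g $$ (l, i)) = \<rho> (h \<circ> g) $$ (a, i)"
      unfolding R(3)[OF h g] by (rule index_mult_mat_sum[OF R(1)[OF h] R(1)[OF g] ab(1) ij(1), symmetric])
    moreover have "pinv (h \<circ> g) \<circ> h = pinv g"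
      unfolding inv_of_comp[OF h g] by (rule cancel(4)[OF h])
    ultimately show "(\<Sum>l<d. \<rho> h $$ (a, l) * \<rho> g $$ (l, i)) * \<tau> (pinv g) $$ (j, b) = f (h \<circ> g)"
      by (simp only: f_def)
  qed
  also have "\<dots> = (\<Sum>g\<in>G. f g)" by (rule sum_left_translate[OF h])
  also have "\<dots> = (\<Sum>g\<in>G. \<rho> g $$ (a, i) * (\<Sum>l<e. \<tau> (pinv g) $$ (j, l) * \<tau> h $$ (l, b)))"
  proof (intro sum.cong refl)
    fix g assume g: "g \<in> G"
    show "f g = \<rho> g $$ (a, i) * (\<Sum>l<e. \<tau> (pinv g) $$ (j, l) * \<tau> h $$ (l, b))"
      unfolding f_def T(3)[OF inv_mem[OF g] h]
        index_mult_mat_sum[OF T(1)[OF inv_mem[OF g]] T(1)[OF h] ij(2) ab(2)] ..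
  qed
  also have "\<dots> = (\<Sum>l<e. (\<Sum>g\<in>G. \<rho> g $$ (a, i) * \<tau> (pinv g) $$ (j, l)) * \<tau> h $$ (l, b))"
    unfolding sum_distrib_left sum_distrib_right by (subst sum.swap) (simp add: mult.assoc)
  also have "\<dots> = (?M * \<tau> h) $$ (a, b)"
    using ab by (subst index_mult_mat_sum[OF coeff_avg_carrier T(1)[OF h]]) auto
  finally show "(\<rho> h * ?M) $$ (a, b) = (?M * \<tau> h) $$ (a, b)" .
qed (use representationD(1)[OF \<rho> h] representationD(1)[OF \<tau> h] in \<open>auto simp: coeff_avg_def\<close>)

text \<open>Taking the matrix unit at (a, b) and reading the entry at (a, b) isolates the product of
  one diagonal entry of \<rho>(g) and one of \<tau>(g^-1).\<close>

lemma sum_traces_coeff_avg: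
  assumes \<rho>: "representation G d \<rho>" and \<tau>: "representation G e \<tau>"
  shows "(\<Sum>g\<in>G. mat_trace (\<rho> g) * mat_trace (\<tau> (pinv g)))
    = (\<Sum>a<d. \<Sum>b<e. coeff_avg d e \<rho> \<tau> a b $$ (a, b))"
proof -
  note R = representationD[OF \<rho>] and T = representationD[OF \<tau>]
  have "(\<Sum>g\<in>G. mat_trace (\<rho> g) * mat_trace (\<tau> (pinv g)))
     = (\<Sum>g\<in>G. \<Sum>a<d. \<Sum>b<e. \<rho> g $$ (a, a) * \<tau> (pinv g) $$ (b, b))"
  proof (intro sum.cong refl)
    fix g assume g: "g \<in> G"
    show "mat_trace (\<rho> g) * mat_trace (\<tau> (pinv g)) = (\<Sum>a<d. \<Sum>b<e. \<rho> g $$ (a, a) * \<tau> (pinv g) $$ (b, b))"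
      using R(1)[OF g] T(1)[OF inv_mem[OF g]] by (simp add: mat_trace_def sum_product)
  qed
  also have "\<dots> = (\<Sum>a<d. \<Sum>g\<in>G. \<Sum>b<e. \<rho> g $$ (a, a) * \<tau> (pinv g) $$ (b, b))"
    by (rule sum.swap)
  also have "\<dots> = (\<Sum>a<d. \<Sum>b<e. \<Sum>g\<in>G. \<rho> g $$ (a, a) * \<tau> (pinv g) $$ (b, b))"
    by (intro sum.cong refl sum.swap)
  finally show ?thesis by simp
qed

text \<open>If some average were nonzero, Schur's lemma would make it an isomorphism, and the two
  traces would agree everywhere. Distinctness is phrased through one element with different traces
  because this is how distinct members of \<open>Irr\<close> differ.\<close>

lemma orthogonality_distinct:
  assumes \<rho>: "irreducible_rep G d \<rho>" and \<tau>: "irreducible_rep G e \<tau>"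
    and g0: "g0 \<in> G" "mat_trace (\<rho> g0) \<noteq> mat_trace (\<tau> g0)"
  shows "(\<Sum>g\<in>G. mat_trace (\<rho> g) * mat_trace (\<tau> (pinv g))) = 0"
proof -
  have r: "representation G d \<rho>" "representation G e \<tau>" using \<rho> \<tau> by (simp_all add: irreducible_rep_def)
  note R = representationD[OF r(1)] and T = representationD[OF r(2)]
  have "coeff_avg d e \<rho> \<tau> i j = 0\<^sub>m d e" if ij: "i < d" "j < e" for i j
  proof (rule ccontr)
    define M where "M = coeff_avg d e \<rho> \<tau> i j"
    assume "coeff_avg d e \<rho> \<tau> i j \<noteq> 0\<^sub>m d e"
    hence ne: "M \<noteq> 0\<^sub>m d e" by (simp add: M_def)
    have M: "M \<in> carrier_mat d e" by (simp add: M_def)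
    have tw: "\<rho> g * M = M * \<tau> g" if "g \<in> G" for g
      unfolding M_def using coeff_avg_intertwines[OF r ij that] .
    obtain N where N: "N \<in> carrier_mat e d" and MN: "M * N = 1\<^sub>m d"
      using intertwiner_right_inverse[OF \<rho> M ne T(1) tw] by blast
    have NM: "N * M \<in> carrier_mat e e" using N M by auto
    \<comment> \<open>So far N is only a right inverse. The vector N M v - v lies in the kernel of
      M, which is 0 because M is nonzero and \<tau> is irreducible.\<close>
    have "N * M = 1\<^sub>m e"
    proof (rule mat_eqI_mult_vec[OF NM one_carrier_mat])
      fix v :: "complex vec" assume v: "v \<in> carrier_vec e"
      define w where "w = (N * M) *\<^sub>v v - v"
      have w: "w \<in> carrier_vec e" using NM v by (auto simp: w_def)
      have NMv: "(N * M) *\<^sub>v v \<in> carrier_vec e" using NM v by auto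
      have "M *\<^sub>v w = M *\<^sub>v ((N * M) *\<^sub>v v) - M *\<^sub>v v"
        unfolding w_def by (rule mult_minus_distrib_mat_vec[OF M NMv v])
      also have "M *\<^sub>v ((N * M) *\<^sub>v v) = (M * N * M) *\<^sub>v v"
        using assoc_mult_mat_vec[OF M NM v] assoc_mult_mat[OF M N M] by simp
      also have "\<dots> = M *\<^sub>v v" using MN M by simp
      finally have "M *\<^sub>v w = 0\<^sub>v d" using M v by simp
      hence "w = 0\<^sub>v e" using intertwiner_kernel[OF \<tau> M R(1) tw w] ne by blast
      show "(N * M) *\<^sub>v v = 1\<^sub>m e *\<^sub>v v"
      proof (rule eq_vecI)
        fix i assume "i < dim_vec (1\<^sub>m e *\<^sub>v v)"
        hence i: "i < e" by simp
        have "w $ i = 0" using \<open>w = 0\<^sub>v e\<close> i by simp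
        thus "((N * M) *\<^sub>v v) $ i = (1\<^sub>m e *\<^sub>v v) $ i"
          using i v NMv by (simp add: w_def del: index_mult_mat_vec)
      qed (use NM in auto)
    qed
    have "mat_trace (\<tau> g0) = mat_trace (N * M * \<tau> g0)" using \<open>N * M = 1\<^sub>m e\<close> T(1)[OF g0(1)] by simp
    also have "N * M * \<tau> g0 = N * (\<rho> g0 * M)" using assoc_mult_mat[OF N M T(1)[OF g0(1)]] tw[OF g0(1)] by simp
    also have "mat_trace \<dots> = mat_trace (\<rho> g0 * M * N)"
      using R(1)[OF g0(1)] M by (intro mat_trace_mult_comm[OF N]) auto
    also have "\<rho> g0 * M * N = \<rho> g0" using assoc_mult_mat[OF R(1)[OF g0(1)] M N] MN R(1)[OF g0(1)] by simp
    finally show False using g0 by simp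
  qed
  thus ?thesis unfolding sum_traces_coeff_avg[OF r] by simp
qed

text \<open>By Schur's lemma each average is a scalar c. Comparing traces gives c * d = card G for i
  = j and 0 otherwise, because \<rho>(g^-1) \<rho>(g) = 1.\<close>

lemma orthogonality_same:
  assumes \<rho>: "irreducible_rep G d \<rho>"
  shows "(\<Sum>g\<in>G. mat_trace (\<rho> g) * mat_trace (\<rho> (pinv g))) = of_nat (card G)"
proof -
  have r: "representation G d \<rho>" and d: "d > 0" using \<rho> by (simp_all add: irreducible_rep_def)
  note R = representationD[OF r]
  have 1: "coeff_avg d d \<rho> \<rho> i j $$ (i, j) = (if i = j then of_nat (card G) / of_nat d else 0)"
    if ij: "i < d" "j < d" for i j
  proof -
    obtain c where c: "coeff_avg d d \<rho> \<rho> i j = c \<cdot>\<^sub>m 1\<^sub>m d"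
      using schur_scalar[OF \<rho> coeff_avg_carrier coeff_avg_intertwines[OF r r ij]] by blast
    have "c * of_nat d = (\<Sum>a<d. coeff_avg d d \<rho> \<rho> i j $$ (a, a))" unfolding c by simp
    also have "\<dots> = (\<Sum>a<d. \<Sum>g\<in>G. \<rho> (pinv g) $$ (j, a) * \<rho> g $$ (a, i))" by (simp add: mult.commute)
    also have "\<dots> = (\<Sum>g\<in>G. \<Sum>a<d. \<rho> (pinv g) $$ (j, a) * \<rho> g $$ (a, i))" by (rule sum.swap)
    also have "\<dots> = (\<Sum>g\<in>G. 1\<^sub>m d $$ (j, i))"
    proof (intro sum.cong refl)
      fix g assume g: "g \<in> G"
      show "(\<Sum>a<d. \<rho> (pinv g) $$ (j, a) * \<rho> g $$ (a, i)) = 1\<^sub>m d $$ (j, i)"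
        using index_mult_mat_sum[OF R(1)[OF inv_mem[OF g]] R(1)[OF g] ij(2,1)] rep_inv(2)[OF r g] by simp
    qed
    finally have "c * of_nat d = (if i = j then of_nat (card G) else 0)" using ij by auto
    hence "c = (if i = j then of_nat (card G) / of_nat d else 0)" using d by (auto simp: field_simps)
    thus ?thesis unfolding c using ij by auto
  qed
  have "(\<Sum>a<d. \<Sum>b<d. coeff_avg d d \<rho> \<rho> a b $$ (a, b)) = (\<Sum>a<d. \<Sum>b<d. if a = b then of_nat (card G) / of_nat d else 0)"
    by (intro sum.cong refl 1) auto
  also have "\<dots> = of_nat (card G)" using d by simp
  finally show ?thesis unfolding sum_traces_coeff_avg[OF r r] .
qed

text \<open>The dual representation is equivalent to \<open>\<rho>\<close>, so there is an invariant bilinear form, unique up to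
  a scalar; it is symmetric or alternating, and its symmetry sign is the indicator.\<close>

lemma frobenius_schur_real:
  assumes \<rho>: "irreducible_rep G d \<rho>"
    and real: "\<And>g. g \<in> G \<Longrightarrow> mat_trace (\<rho> (pinv g)) = mat_trace (\<rho> g)"
  shows "(\<Sum>g\<in>G. mat_trace (\<rho> (g \<circ> g))) \<in> {of_nat (card G), - of_nat (card G)}"
proof -
  have r: "representation G d \<rho>" using \<rho> by (simp_all add: irreducible_rep_def)
  note R = representationD[OF r]
  define \<tau> where "\<tau> g = transpose_mat (\<rho> (pinv g))" for g
  have t: "representation G d \<tau>"
    unfolding representation_def
  proof (intro conjI ballI)
    fix g assume g: "g \<in> G"
    show "\<tau> g \<in> carrier_mat d d" using R(1)[OF inv_mem[OF g]] by (simp add: \<tau>_def)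
    fix h assume h: "h \<in> G"
    show "\<tau> (g \<circ> h) = \<tau> g * \<tau> h"
      unfolding \<tau>_def inv_of_comp[OF g h] R(3)[OF inv_mem[OF h] inv_mem[OF g]]
      by (rule transpose_mult[OF R(1)[OF inv_mem[OF h]] R(1)[OF inv_mem[OF g]]])
  next
    show "\<tau> id = 1\<^sub>m d" using R(2) by (simp add: \<tau>_def)
  qed
  note T = representationD[OF t]
  \<comment> \<open>For fixed i and j these numbers form a matrix M with \<rho>(g) M \<rho>(g)^T =
    M, an invariant bilinear form. The symmetry in the pairs (a, i) and (b, j) ties transposition of
    the form to the exchange of i and j.\<close>
  define S where "S a i b j = (\<Sum>g\<in>G. \<rho> g $$ (a, i) * \<rho> g $$ (b, j))" for a i b j
  have S_sym: "S a i b j = S b j a i" for a i b j unfolding S_def by (simp add: mult.commute)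
  have S: "coeff_avg d d \<rho> \<tau> i j $$ (a, b) = S a i b j" if "i < d" "j < d" "a < d" "b < d" for a b i j
    unfolding S_def coeff_avg_index[OF that(3,4)]
  proof (intro sum.cong refl)
    fix g assume g: "g \<in> G"
    show "\<rho> g $$ (a, i) * \<tau> (pinv g) $$ (j, b) = \<rho> g $$ (a, i) * \<rho> g $$ (b, j)"
      using R(1)[OF g] that by (simp add: \<tau>_def inv_inv[OF g])
  qed
  have tot: "(\<Sum>a<d. \<Sum>b<d. S a a b b) = of_nat (card G)"
  proof -
    have "(\<Sum>a<d. \<Sum>b<d. S a a b b) = (\<Sum>g\<in>G. mat_trace (\<rho> g) * mat_trace (\<tau> (pinv g)))"
      unfolding sum_traces_coeff_avg[OF r t] by (intro sum.cong refl S[symmetric]) auto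
    also have "\<dots> = (\<Sum>g\<in>G. mat_trace (\<rho> g) * mat_trace (\<rho> (pinv g)))"
    proof (intro sum.cong refl)
      fix g assume g: "g \<in> G"
      have "mat_trace (\<tau> (pinv g)) = mat_trace (\<rho> g)"
        using R(1)[OF g] by (simp add: \<tau>_def inv_inv[OF g] mat_trace_def)
      thus "mat_trace (\<rho> g) * mat_trace (\<tau> (pinv g)) = mat_trace (\<rho> g) * mat_trace (\<rho> (pinv g))"
        using real[OF g] by simp
    qed
    finally show ?thesis using orthogonality_same[OF \<rho>] by simp
  qed
  \<comment> \<open>As the character is real, its unnormalized scalar product with the dual
    character is card G, so not all averages can vanish.\<close>
  have "\<exists>a<d. \<exists>b<d. S a a b b \<noteq> 0"
  proof (rule ccontr)
    assume "\<not> ?thesis"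
    hence "(\<Sum>a<d. \<Sum>b<d. S a a b b) = 0" by (intro sum.neutral ballI) auto
    thus False using tot card_pos by simp
  qed
  then obtain i0 j0 where ij0: "i0 < d" "j0 < d" and ne0: "S i0 i0 j0 j0 \<noteq> 0" by blast
  define M where "M = coeff_avg d d \<rho> \<tau> i0 j0"
  have M: "M \<in> carrier_mat d d" by (simp add: M_def)
  have Mi: "M $$ (a, b) = S a i0 b j0" if "a < d" "b < d" for a b
    unfolding M_def using S ij0 that by simp
  have ne: "M \<noteq> 0\<^sub>m d d" using Mi[OF ij0] ne0 ij0 by auto
  have tw: "\<rho> g * M = M * \<tau> g" if "g \<in> G" for g
    unfolding M_def using coeff_avg_intertwines[OF r t ij0 that] .
  obtain N where N: "N \<in> carrier_mat d d" and MN: "M * N = 1\<^sub>m d"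
    using intertwiner_right_inverse[OF \<rho> M ne T(1) tw] by blast
  have NM: "N * M = 1\<^sub>m d" using mat_mult_left_right_inverse[OF M N MN] .
  have TN: "\<tau> g * N = N * \<rho> g" if g: "g \<in> G" for g
  proof -
    have TgN: "\<tau> g * N \<in> carrier_mat d d" using T(1)[OF g] N by auto
    have "\<tau> g * N = N * M * (\<tau> g * N)" unfolding NM by (rule left_mult_one_mat[OF TgN, symmetric])
    also have "\<dots> = N * (M * \<tau> g * N)"
      using assoc_mult_mat[OF N M TgN] assoc_mult_mat[OF M T(1)[OF g] N] by simp
    also have "M * \<tau> g * N = \<rho> g" using tw[OF g, symmetric] assoc_mult_mat[OF R(1)[OF g] M N] MN R(1)[OF g] by simp
    finally show ?thesis .
  qed
  \<comment> \<open>Every form obtained from another pair i, j is a multiple of the one for i0, j0: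
    multiplication by N turns it into a matrix commuting with the group, to which Schur's lemma
    applies.\<close>
  have ex: "\<exists>c. \<forall>a<d. \<forall>b<d. S a i b j = c * S a i0 b j0" if ij: "i < d" "j < d" for i j
  proof -
    define X where "X = coeff_avg d d \<rho> \<tau> i j"
    have X: "X \<in> carrier_mat d d" by (simp add: X_def)
    have XN: "X * N \<in> carrier_mat d d" using X N by auto
    have "\<rho> g * (X * N) = (X * N) * \<rho> g" if g: "g \<in> G" for g
    proof -
      have "\<rho> g * (X * N) = \<rho> g * X * N" using assoc_mult_mat[OF R(1)[OF g] X N] by simp
      also have "\<rho> g * X = X * \<tau> g" unfolding X_def using coeff_avg_intertwines[OF r t ij g] .
      also have "X * \<tau> g * N = X * (N * \<rho> g)" using assoc_mult_mat[OF X T(1)[OF g] N] TN[OF g] by simp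
      also have "\<dots> = X * N * \<rho> g" using assoc_mult_mat[OF X N R(1)[OF g]] by simp
      finally show ?thesis .
    qed
    then obtain c where c: "X * N = c \<cdot>\<^sub>m 1\<^sub>m d" using schur_scalar[OF \<rho> XN] by blast
    have "X = X * N * M" using assoc_mult_mat[OF X N M] NM X by simp
    also have "\<dots> = c \<cdot>\<^sub>m M" unfolding c using mult_smult_assoc_mat[OF one_carrier_mat M] M by simp
    finally have Xc: "X = c \<cdot>\<^sub>m M" .
    have "S a i b j = c * S a i0 b j0" if "a < d" "b < d" for a b
    proof -
      have "S a i b j = X $$ (a, b)" unfolding X_def using S ij that by simp
      also have "\<dots> = c * M $$ (a, b)" unfolding Xc using M that by simp
      finally show ?thesis using Mi that by simp
    qed
    thus ?thesis by blast
  qed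
  define c where "c i j = (SOME c. \<forall>a<d. \<forall>b<d. S a i b j = c * S a i0 b j0)" for i j
  have c: "S a i b j = c i j * S a i0 b j0" if "a < d" "b < d" "i < d" "j < d" for a b i j
    using someI_ex[OF ex[OF that(3,4)]] that(1,2) unfolding c_def by blast
  \<comment> \<open>The factor \<epsilon> compares the form with its transpose; transposing twice
    gives \<epsilon> * \<epsilon> = 1.\<close>
  define \<epsilon> where "\<epsilon> = c j0 i0"
  have sw: "S b i0 a j0 = \<epsilon> * S a i0 b j0" if "a < d" "b < d" for a b
    using S_sym[of b i0 a j0] c[OF that ij0(2,1)] by (simp add: \<epsilon>_def)
  have "\<epsilon> * \<epsilon> = 1"
  proof -
    have "S i0 i0 j0 j0 = \<epsilon> * (\<epsilon> * S i0 i0 j0 j0)"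
      unfolding sw[OF ij0, symmetric] by (rule sw[OF ij0(2,1)])
    thus ?thesis using ne0 by (metis mult.assoc mult_cancel_right1)
  qed
  have cs: "c j i = \<epsilon> * c i j" if ij: "i < d" "j < d" for i j
  proof -
    have "c j i * S i0 i0 j0 j0 = S i0 j j0 i" using c[OF ij0 ij(2,1)] by simp
    also have "\<dots> = c i j * (\<epsilon> * S i0 i0 j0 j0)" using S_sym[of i0 j j0 i] c[OF ij0(2,1) ij] sw[OF ij0] by simp
    finally show ?thesis using ne0 by simp
  qed
  have "(\<Sum>g\<in>G. mat_trace (\<rho> (g \<circ> g))) = (\<Sum>g\<in>G. \<Sum>a<d. \<Sum>b<d. \<rho> g $$ (a, b) * \<rho> g $$ (b, a))"
  proof (intro sum.cong refl)
    fix g assume g: "g \<in> G"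
    show "mat_trace (\<rho> (g \<circ> g)) = (\<Sum>a<d. \<Sum>b<d. \<rho> g $$ (a, b) * \<rho> g $$ (b, a))"
      unfolding R(3)[OF g g] mat_trace_def using R(1)[OF g]
      by (auto simp: index_mult_mat_sum[OF R(1)[OF g] R(1)[OF g]] simp del: index_mult_mat(1) intro!: sum.cong)
  qed
  also have "\<dots> = (\<Sum>a<d. \<Sum>g\<in>G. \<Sum>b<d. \<rho> g $$ (a, b) * \<rho> g $$ (b, a))"
    by (rule sum.swap)
  also have "\<dots> = (\<Sum>a<d. \<Sum>b<d. S a b b a)"
    unfolding S_def by (intro sum.cong refl sum.swap)
  \<comment> \<open>Exchanging the second and fourth index of S costs \<epsilon>. It turns the sum
    of traces of squares into the sum of squared traces, which is card G.\<close>
  also have "\<dots> = (\<Sum>a<d. \<Sum>b<d. \<epsilon> * S a a b b)"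
  proof (intro sum.cong refl)
    fix a b assume "a \<in> {..<d}" "b \<in> {..<d}"
    hence ab: "a < d" "b < d" by auto
    show "S a b b a = \<epsilon> * S a a b b"
      unfolding c[OF ab ab(2,1)] c[OF ab ab] cs[OF ab] by simp
  qed
  also have "\<dots> = \<epsilon> * of_nat (card G)" unfolding tot[symmetric] by (simp add: sum_distrib_left)
  finally have "(\<Sum>g\<in>G. mat_trace (\<rho> (g \<circ> g))) = \<epsilon> * of_nat (card G)" .
  moreover have "\<epsilon> = 1 \<or> \<epsilon> = -1" using \<open>\<epsilon> * \<epsilon> = 1\<close> by (simp add: square_eq_1_iff)
  ultimately show ?thesis by auto
qed

end

section \<open>Induced characters and multiplicities\<close>

lemma sum_list_indicator:
  "(\<Sum>\<psi>\<leftarrow>xs. if \<psi> = \<chi> then c else 0) = of_nat (count_list xs \<chi>) * (c::complex)"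
  by (induction xs) (auto simp: algebra_simps)

lemma distinct_if_count_list_1: "(\<And>x. x \<in> set xs \<Longrightarrow> count_list xs x = 1) \<Longrightarrow> distinct xs"
proof (induction xs)
  case (Cons a xs)
  have "count_list xs a = 0" using Cons.prems[of a] by simp
  hence "a \<notin> set xs" by (simp add: count_list_0_iff)
  moreover have "count_list xs x = 1" if "x \<in> set xs" for x
    using Cons.prems[of x] that calculation by (auto split: if_splits)
  ultimately show ?case using Cons.IH by simp
qed simp

context perm_group begin

text \<open>Operators on functions on G are described by kernels k x y. The enumeration e only
  serves to turn them into matrices; products become sums over G.\<close>

definition kernel_mat :: "(nat \<Rightarrow> perm) \<Rightarrow> (perm \<Rightarrow> perm \<Rightarrow> complex) \<Rightarrow> complex mat" where
  "kernel_mat e k = mat (card G) (card G) (\<lambda>(i, j). k (e i) (e j))"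

lemma kernel_mat_carrier [simp]: "kernel_mat e k \<in> carrier_mat (card G) (card G)"
  by (simp add: kernel_mat_def)

lemma kernel_mat_index [simp]:
  "i < card G \<Longrightarrow> j < card G \<Longrightarrow> kernel_mat e k $$ (i, j) = k (e i) (e j)"
  by (simp add: kernel_mat_def)

lemma kernel_mat_cong:
  assumes "bij_betw e {..<card G} G" "\<And>x y. x \<in> G \<Longrightarrow> y \<in> G \<Longrightarrow> k x y = k' x y"
  shows "kernel_mat e k = kernel_mat e k'"
  unfolding kernel_mat_def using assms by (intro cong_mat) (auto simp: bij_betw_def)

lemma kernel_mat_mult:
  assumes e: "bij_betw e {..<card G} G"
  shows "kernel_mat e k * kernel_mat e k' = kernel_mat e (\<lambda>x y. \<Sum>z\<in>G. k x z * k' z y)"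
proof (rule eq_matI)
  let ?n = "card G"
  fix i j assume "i < dim_row (kernel_mat e (\<lambda>x y. \<Sum>z\<in>G. k x z * k' z y))"
    "j < dim_col (kernel_mat e (\<lambda>x y. \<Sum>z\<in>G. k x z * k' z y))"
  hence ij: "i < ?n" "j < ?n" by (auto simp: kernel_mat_def)
  have "(kernel_mat e k * kernel_mat e k') $$ (i, j) = (\<Sum>l<?n. k (e i) (e l) * k' (e l) (e j))"
    unfolding index_mult_mat_sum[OF kernel_mat_carrier kernel_mat_carrier ij] using ij by simp
  also have "\<dots> = (\<Sum>z\<in>G. k (e i) z * k' z (e j))"
    by (rule sum.reindex_bij_betw[OF e, of "\<lambda>z. k (e i) z * k' z (e j)"])
  finally show "(kernel_mat e k * kernel_mat e k') $$ (i, j) = kernel_mat e (\<lambda>x y. \<Sum>z\<in>G. k x z * k' z y) $$ (i, j)"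
    using ij by simp
qed (auto simp: kernel_mat_def)

lemma kernel_mat_trace:
  assumes e: "bij_betw e {..<card G} G"
  shows "mat_trace (kernel_mat e k) = (\<Sum>x\<in>G. k x x)"
  using sum.reindex_bij_betw[OF e, of "\<lambda>x. k x x"] by (simp add: mat_trace_def kernel_mat_def)

text \<open>The induced module is cut out of the regular representation by right multiplication with the
  idempotent of the linear character.\<close>

lemma induced_character:
  assumes H: "perm_group H" "H \<subseteq> G"
    and \<sigma>: "\<And>h. h \<in> H \<Longrightarrow> \<sigma> h \<in> {1, -1}" "\<And>h k. h \<in> H \<Longrightarrow> k \<in> H \<Longrightarrow> \<sigma> (h \<circ> k) = \<sigma> h * \<sigma> k"
  shows "\<exists>r \<tau>. representation G r \<tau> \<and> (\<forall>g\<in>G. mat_trace (\<tau> g) = induce G H \<sigma> g)"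
proof -
  interpret H: perm_group H by (rule H)
  obtain e0 where "bij_betw e0 {0..<card G} G" using finite_carrier ex_bij_betw_nat_finite by blast
  then obtain e where e: "bij_betw e {..<card G} G" by (auto simp: atLeast0LessThan)
  \<comment> \<open>The left regular representation. Multiplying a kernel by it translates the first
    argument (\<open>Lk\<close>) or the second (\<open>kL\<close>).\<close>
  define L where "L g = kernel_mat e (\<lambda>x y. if x = g \<circ> y then 1 else 0)" for g
  have Lk: "L g * kernel_mat e k = kernel_mat e (\<lambda>x y. k (pinv g \<circ> x) y)" if g: "g \<in> G" for g k
    unfolding L_def kernel_mat_mult[OF e]
  proof (rule kernel_mat_cong[OF e])
    fix x y assume xy: "x \<in> G" "y \<in> G"
    have "(\<Sum>z\<in>G. (if x = g \<circ> z then 1 else 0) * k z y) = (\<Sum>z\<in>G. if z = pinv g \<circ> x then k z y else 0)"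
      using cancel[OF g] by (intro sum.cong) auto
    also have "\<dots> = k (pinv g \<circ> x) y"
      using finite_carrier comp_mem[OF inv_mem[OF g] xy(1)] by simp
    finally show "(\<Sum>z\<in>G. (if x = g \<circ> z then 1 else 0) * k z y) = k (pinv g \<circ> x) y" .
  qed
  have kL: "kernel_mat e k * L g = kernel_mat e (\<lambda>x y. k x (g \<circ> y))" if g: "g \<in> G" for g k
    unfolding L_def kernel_mat_mult[OF e]
  proof (rule kernel_mat_cong[OF e])
    fix x y assume xy: "x \<in> G" "y \<in> G"
    have "(\<Sum>z\<in>G. k x z * (if z = g \<circ> y then 1 else 0)) = (\<Sum>z\<in>G. if z = g \<circ> y then k x z else 0)"
      by (intro sum.cong) auto
    also have "\<dots> = k x (g \<circ> y)"
      using finite_carrier comp_mem[OF g xy(2)] by simp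
    finally show "(\<Sum>z\<in>G. k x z * (if z = g \<circ> y then 1 else 0)) = k x (g \<circ> y)" .
  qed
  have inj: "inj_on e {..<card G}" using e by (simp add: bij_betw_def)
  have rep: "representation G (card G) L" unfolding representation_def
  proof (intro conjI ballI)
    show "L g \<in> carrier_mat (card G) (card G)" for g by (simp add: L_def)
    show "L id = 1\<^sub>m (card G)"
      using inj by (intro eq_matI) (auto simp: L_def kernel_mat_def inj_on_eq_iff)
    fix g h assume g: "g \<in> G" and h: "h \<in> G"
    have "L g * L h = kernel_mat e (\<lambda>x y. if x = g \<circ> (h \<circ> y) then 1 else 0)"
      using kL[OF h, of "\<lambda>x y. if x = g \<circ> y then 1 else 0"] by (simp add: L_def)
    thus "L (g \<circ> h) = L g * L h" by (simp add: L_def o_assoc)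
  qed
  define c :: complex where "c = inverse (of_nat (card H))"
  have cH: "c * of_nat (card H) = 1" using H.card_pos by (simp add: c_def)
  \<comment> \<open>The idempotent of the group algebra attached to \<sigma>. E is right convolution
    with it and therefore commutes with left translations.\<close>
  define \<phi> where "\<phi> h = (if h \<in> H then c * \<sigma> h else 0)" for h
  have \<sigma>id: "\<sigma> id = 1"
    using \<sigma>(2)[OF H.id_mem H.id_mem] \<sigma>(1)[OF H.id_mem] by auto
  have \<sigma>inv: "\<sigma> (pinv h) = \<sigma> h" if h: "h \<in> H" for h
  proof -
    have "\<sigma> (pinv h) * \<sigma> h = 1" using \<sigma>(2)[OF H.inv_mem[OF h] h] H.inv_comp[OF h] \<sigma>id by simp
    thus ?thesis using \<sigma>(1)[OF h] by (auto simp: minus_equation_iff)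
  qed
  define E where "E = kernel_mat e (\<lambda>x y. \<phi> (pinv y \<circ> x))"
  have E: "E \<in> carrier_mat (card G) (card G)" by (simp add: E_def)
  have conv: "(\<Sum>z\<in>G. \<phi> (pinv z \<circ> x) * \<phi> (pinv y \<circ> z)) = \<phi> (pinv y \<circ> x)" if x: "x \<in> G" and y: "y \<in> G" for x y
  proof -
    have "(\<Sum>z\<in>G. \<phi> (pinv z \<circ> x) * \<phi> (pinv y \<circ> z)) = (\<Sum>z\<in>G. \<phi> (pinv (y \<circ> z) \<circ> x) * \<phi> (pinv y \<circ> (y \<circ> z)))"
      by (rule sum_left_translate[OF y, symmetric])
    also have "\<dots> = (\<Sum>z\<in>G. \<phi> (pinv z \<circ> (pinv y \<circ> x)) * \<phi> z)"
    proof (intro sum.cong refl)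
      fix z assume z: "z \<in> G"
      show "\<phi> (pinv (y \<circ> z) \<circ> x) * \<phi> (pinv y \<circ> (y \<circ> z)) = \<phi> (pinv z \<circ> (pinv y \<circ> x)) * \<phi> z"
        by (simp only: cancel(2)[OF y] inv_of_comp[OF y z] o_assoc[symmetric])
    qed
    also have "\<dots> = (\<Sum>z\<in>H. \<phi> (pinv z \<circ> (pinv y \<circ> x)) * \<phi> z)"
      using H(2) finite_carrier by (intro sum.mono_neutral_right) (auto simp: \<phi>_def)
    also have "\<dots> = (\<Sum>z\<in>H. c * \<phi> (pinv y \<circ> x))"
    proof (intro sum.cong refl)
      fix z assume z: "z \<in> H"
      define w where "w = pinv y \<circ> x"
      have iff: "pinv z \<circ> w \<in> H \<longleftrightarrow> w \<in> H"
      proof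
        assume "pinv z \<circ> w \<in> H"
        from H.comp_mem[OF z this] show "w \<in> H" by (simp only: H.cancel(1)[OF z])
      qed (rule H.comp_mem[OF H.inv_mem[OF z]])
      show "\<phi> (pinv z \<circ> (pinv y \<circ> x)) * \<phi> z = c * \<phi> (pinv y \<circ> x)"
        unfolding w_def[symmetric] \<phi>_def iff
        using z \<sigma>(2)[OF H.inv_mem[OF z], of w] \<sigma>inv[OF z] \<sigma>(1)[OF z] by auto
    qed
    also have "\<dots> = \<phi> (pinv y \<circ> x)" using cH by (simp add: algebra_simps)
    finally show ?thesis .
  qed
  have EE: "E * E = E" unfolding E_def kernel_mat_mult[OF e] by (rule kernel_mat_cong[OF e conv])
  have comm: "L g * E = E * L g" if g: "g \<in> G" for g
    unfolding E_def Lk[OF g] kL[OF g]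
  proof (rule kernel_mat_cong[OF e])
    fix x y assume y: "y \<in> G"
    show "\<phi> (pinv y \<circ> (pinv g \<circ> x)) = \<phi> (pinv (g \<circ> y) \<circ> x)"
      unfolding inv_of_comp[OF g y] o_assoc ..
  qed
  obtain r \<tau> where 1: "representation G r \<tau>" "\<And>g. g \<in> G \<Longrightarrow> mat_trace (\<tau> g) = mat_trace (L g * E)"
    using idempotent_subrepresentation[OF rep E EE comm] by blast
  have "mat_trace (L g * E) = induce G H \<sigma> g" if g: "g \<in> G" for g
  proof -
    have "mat_trace (L g * E) = (\<Sum>x\<in>G. \<phi> (pinv x \<circ> (pinv g \<circ> x)))"
      unfolding E_def Lk[OF g] by (rule kernel_mat_trace[OF e])
    \<comment> \<open>Replacing x by its inverse matches the convention x g x^-1 of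
      \<open>induce\<close>. As \<sigma> takes only the values 1 and -1, \<phi> is unchanged when
      its argument is inverted.\<close>
    also have "\<dots> = (\<Sum>x\<in>G. \<phi> (pinv (pinv x) \<circ> (pinv g \<circ> pinv x)))" by (rule sum_inv[symmetric])
    also have "\<dots> = (\<Sum>x\<in>G. \<phi> (x \<circ> g \<circ> pinv x))"
    proof (intro sum.cong refl)
      fix x assume x: "x \<in> G"
      define w where "w = x \<circ> g \<circ> pinv x"
      have xg: "x \<circ> g \<in> G" using x g comp_mem by blast
      have w: "w \<in> G" unfolding w_def using xg x comp_mem inv_mem by blast
      have "pinv w = pinv (pinv x) \<circ> (pinv g \<circ> pinv x)"
        unfolding w_def inv_of_comp[OF xg inv_mem[OF x]] inv_of_comp[OF x g] ..
      moreover have "pinv w \<in> H \<longleftrightarrow> w \<in> H" using H.inv_mem inv_inv[OF w] by metis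
      ultimately show "\<phi> (pinv (pinv x) \<circ> (pinv g \<circ> pinv x)) = \<phi> (x \<circ> g \<circ> pinv x)"
        unfolding w_def[symmetric] using \<sigma>inv[of w] by (metis \<phi>_def)
    qed
    also have "\<dots> = induce G H \<sigma> g"
      unfolding induce_def sum_divide_distrib by (intro sum.cong) (auto simp: \<phi>_def c_def field_simps)
    finally show ?thesis .
  qed
  thus ?thesis using 1 by (intro exI[of _ r] exI[of _ \<tau>]) simp
qed

lemma class_function:
  assumes "representation G d \<rho>" "g \<in> G" "h \<in> G"
  shows "mat_trace (\<rho> (h \<circ> g \<circ> pinv h)) = mat_trace (\<rho> g)"
proof -
  note R = representationD[OF assms(1)]
  have hg: "h \<circ> g \<in> G" using assms comp_mem by blast
  have "\<rho> (h \<circ> g \<circ> pinv h) = \<rho> (h \<circ> g) * \<rho> (pinv h)" by (rule R(3)[OF hg inv_mem[OF assms(3)]])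
  hence "mat_trace (\<rho> (h \<circ> g \<circ> pinv h)) = mat_trace (\<rho> (pinv h) * \<rho> (h \<circ> g))"
    using mat_trace_mult_comm[OF R(1)[OF hg] R(1)[OF inv_mem[OF assms(3)]]] by simp
  also have "\<rho> (pinv h) * \<rho> (h \<circ> g) = \<rho> (pinv h \<circ> (h \<circ> g))" by (rule R(3)[OF inv_mem[OF assms(3)] hg, symmetric])
  also have "pinv h \<circ> (h \<circ> g) = g" by (rule cancel(2)[OF assms(3)])
  finally show ?thesis .
qed

text \<open>Members of \<open>Irr\<close> vanish outside G, so two different ones are separated by
  an element of G, as \<open>orthogonality_distinct\<close> requires.\<close>

lemma Irr_orthonormal:
  assumes "\<psi> \<in> Irr G" "\<chi> \<in> Irr G"
  shows "(\<Sum>g\<in>G. \<psi> g * \<chi> (pinv g)) = (if \<psi> = \<chi> then of_nat (card G) else 0)"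
proof -
  obtain d \<rho> where \<rho>: "irreducible_rep G d \<rho>" "\<And>g. g \<in> G \<Longrightarrow> \<psi> g = mat_trace (\<rho> g)" "\<And>g. g \<notin> G \<Longrightarrow> \<psi> g = 0"
    using assms(1) by (auto simp: Irr_def)
  obtain e \<tau> where \<tau>: "irreducible_rep G e \<tau>" "\<And>g. g \<in> G \<Longrightarrow> \<chi> g = mat_trace (\<tau> g)" "\<And>g. g \<notin> G \<Longrightarrow> \<chi> g = 0"
    using assms(2) by (auto simp: Irr_def)
  show ?thesis
  proof (cases "\<psi> = \<chi>")
    case True
    have "(\<Sum>g\<in>G. \<psi> g * \<chi> (pinv g)) = (\<Sum>g\<in>G. mat_trace (\<rho> g) * mat_trace (\<rho> (pinv g)))"
    proof (intro sum.cong refl)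
      fix g assume g: "g \<in> G"
      show "\<psi> g * \<chi> (pinv g) = mat_trace (\<rho> g) * mat_trace (\<rho> (pinv g))"
        unfolding True[symmetric] \<rho>(2)[OF g] \<rho>(2)[OF inv_mem[OF g]] ..
    qed
    thus ?thesis using orthogonality_same[OF \<rho>(1)] True by simp
  next
    case False
    then obtain g0 where ne: "\<psi> g0 \<noteq> \<chi> g0" by blast
    have g0: "g0 \<in> G"
    proof (rule ccontr)
      assume "g0 \<notin> G"
      thus False using ne \<rho>(3)[of g0] \<tau>(3)[of g0] by simp
    qed
    have ne: "mat_trace (\<rho> g0) \<noteq> mat_trace (\<tau> g0)" using ne \<rho>(2)[OF g0] \<tau>(2)[OF g0] by simp
    have "(\<Sum>g\<in>G. \<psi> g * \<chi> (pinv g)) = (\<Sum>g\<in>G. mat_trace (\<rho> g) * mat_trace (\<tau> (pinv g)))"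
    proof (intro sum.cong refl)
      fix g assume g: "g \<in> G"
      show "\<psi> g * \<chi> (pinv g) = mat_trace (\<rho> g) * mat_trace (\<tau> (pinv g))"
        unfolding \<rho>(2)[OF g] \<tau>(2)[OF inv_mem[OF g]] ..
    qed
    thus ?thesis using orthogonality_distinct[OF \<rho>(1) \<tau>(1), OF g0 ne] False by simp
  qed
qed

text \<open>A sum of induced characters that counts square roots has scalar product with each irreducible
  character equal to its Frobenius-Schur indicator. The indicator is \<open>\<plusminus>1\<close> because all characters are
  real, and it cannot be negative because it is a multiplicity.\<close>

theorem square_root_count_is_model:
  assumes K: "finite K"
    and H: "\<And>k. k \<in> K \<Longrightarrow> perm_group (H k)" "\<And>k. k \<in> K \<Longrightarrow> H k \<subseteq> G"
    and \<sigma>: "\<And>k h. k \<in> K \<Longrightarrow> h \<in> H k \<Longrightarrow> \<sigma> k h \<in> {1, -1}"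
      "\<And>k h h'. k \<in> K \<Longrightarrow> h \<in> H k \<Longrightarrow> h' \<in> H k \<Longrightarrow> \<sigma> k (h \<circ> h') = \<sigma> k h * \<sigma> k h'"
    and real: "\<And>g. g \<in> G \<Longrightarrow> \<exists>h\<in>G. h \<circ> g \<circ> Hilbert_Choice.inv h = Hilbert_Choice.inv g"
    and roots: "\<And>g. g \<in> G \<Longrightarrow> (\<Sum>k\<in>K. induce G (H k) (\<sigma> k) g) = of_nat (card {x \<in> G. x \<circ> x = g})"
    and g: "g \<in> G"
  shows "(\<Sum>k\<in>K. induce G (H k) (\<sigma> k) g) = (\<Sum>\<chi>\<in>Irr G. \<chi> g)"
proof -
  define F where "F g = (\<Sum>k\<in>K. induce G (H k) (\<sigma> k) g)" for g
  \<comment> \<open>All induced characters together are written as one list of irreducible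
    characters, in which every irreducible will turn out to occur exactly once.\<close>
  have "\<exists>xs. set xs \<subseteq> Irr G \<and> (\<forall>g\<in>G. (\<Sum>k\<in>K'. induce G (H k) (\<sigma> k) g) = (\<Sum>\<chi>\<leftarrow>xs. \<chi> g))"
    if "finite K'" "K' \<subseteq> K" for K' using that
  proof (induction K' rule: finite_induct)
    case empty
    show ?case by (intro exI[of _ "[]"]) simp
  next
    case (insert k K')
    then obtain xs where xs: "set xs \<subseteq> Irr G" "\<forall>g\<in>G. (\<Sum>k\<in>K'. induce G (H k) (\<sigma> k) g) = (\<Sum>\<chi>\<leftarrow>xs. \<chi> g)" by auto
    have k: "k \<in> K" using insert by auto
    obtain r \<tau> where \<tau>: "representation G r \<tau>" "\<forall>g\<in>G. mat_trace (\<tau> g) = induce G (H k) (\<sigma> k) g"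
      using induced_character[OF H(1)[OF k] H(2)[OF k] \<sigma>(1)[OF k] \<sigma>(2)[OF k]] by blast
    obtain ys where ys: "set ys \<subseteq> Irr G" "\<forall>g\<in>G. mat_trace (\<tau> g) = (\<Sum>\<chi>\<leftarrow>ys. \<chi> g)"
      using character_sum_irreducibles[OF \<tau>(1)] by blast
    show ?case using insert.hyps xs ys \<tau>(2) by (intro exI[of _ "ys @ xs"]) auto
  qed
  from this[OF K subset_refl] obtain xs where xs: "set xs \<subseteq> Irr G" "\<And>g. g \<in> G \<Longrightarrow> F g = (\<Sum>\<chi>\<leftarrow>xs. \<chi> g)"
    unfolding F_def by blast
  have cnt: "count_list xs \<chi> = 1" if \<chi>: "\<chi> \<in> Irr G" for \<chi>
  proof -
    obtain d \<rho> where \<rho>: "irreducible_rep G d \<rho>" "\<And>g. g \<in> G \<Longrightarrow> \<chi> g = mat_trace (\<rho> g)"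
      using \<chi> by (auto simp: Irr_def)
    have r: "representation G d \<rho>" using \<rho>(1) by (simp add: irreducible_rep_def)
    have rl: "mat_trace (\<rho> (pinv g)) = mat_trace (\<rho> g)" if g: "g \<in> G" for g
    proof -
      obtain h where h: "h \<in> G" "h \<circ> g \<circ> pinv h = pinv g" using real[OF g] by blast
      show ?thesis using class_function[OF r g h(1)] unfolding h(2) .
    qed
    have "(\<Sum>g\<in>G. F g * \<chi> (pinv g)) = (\<Sum>g\<in>G. \<Sum>\<psi>\<leftarrow>xs. \<psi> g * \<chi> (pinv g))"
      using xs(2) by (intro sum.cong) (auto simp: sum_list_mult_const)
    also have "\<dots> = (\<Sum>\<psi>\<leftarrow>xs. \<Sum>g\<in>G. \<psi> g * \<chi> (pinv g))"
      by (induction xs) (auto simp: sum.distrib)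
    also have "\<dots> = (\<Sum>\<psi>\<leftarrow>xs. if \<psi> = \<chi> then of_nat (card G) else 0)"
      using xs(1) \<chi> by (intro arg_cong[of _ _ sum_list] map_cong refl Irr_orthonormal) auto
    also have "\<dots> = of_nat (count_list xs \<chi>) * of_nat (card G)" by (rule sum_list_indicator)
    finally have 1: "(\<Sum>g\<in>G. F g * \<chi> (pinv g)) = of_nat (count_list xs \<chi>) * of_nat (card G)" .
    \<comment> \<open>Second evaluation of the same scalar product: counting g by its square roots x
      yields the sum of \<chi>(x x), the Frobenius-Schur sum.\<close>
    have "(\<Sum>g\<in>G. F g * \<chi> (pinv g)) = (\<Sum>g\<in>G. \<Sum>x\<in>G. if x \<circ> x = g then \<chi> (pinv g) else 0)"
    proof (intro sum.cong refl)
      fix g assume g: "g \<in> G"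
      show "F g * \<chi> (pinv g) = (\<Sum>x\<in>G. if x \<circ> x = g then \<chi> (pinv g) else 0)"
        unfolding F_def roots[OF g] using finite_carrier
        by (simp add: sum.If_cases Int_def)
    qed
    also have "\<dots> = (\<Sum>x\<in>G. \<Sum>g\<in>G. if x \<circ> x = g then \<chi> (pinv g) else 0)" by (rule sum.swap)
    also have "\<dots> = (\<Sum>x\<in>G. mat_trace (\<rho> (x \<circ> x)))"
    proof (intro sum.cong refl)
      fix x assume x: "x \<in> G"
      have xx: "x \<circ> x \<in> G" using comp_mem[OF x x] .
      have "(\<Sum>g\<in>G. if x \<circ> x = g then \<chi> (pinv g) else 0) = \<chi> (pinv (x \<circ> x))"
        using finite_carrier xx by simp
      also have "\<dots> = mat_trace (\<rho> (x \<circ> x))" using \<rho>(2)[OF inv_mem[OF xx]] rl[OF xx] by simp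
      finally show "(\<Sum>g\<in>G. if x \<circ> x = g then \<chi> (pinv g) else 0) = mat_trace (\<rho> (x \<circ> x))" .
    qed
    finally have "(\<Sum>g\<in>G. F g * \<chi> (pinv g)) \<in> {of_nat (card G), - of_nat (card G)}"
      using frobenius_schur_real[OF \<rho>(1) rl] by (simp only:)
    \<comment> \<open>Transfer to the integers, where a nonnegative multiple of card G cannot be -
      card G.\<close>
    hence "of_int (int (count_list xs \<chi> * card G)) = (of_int (int (card G)) :: complex)
        \<or> of_int (int (count_list xs \<chi> * card G)) = (of_int (- int (card G)) :: complex)"
      unfolding 1 by simp
    hence "int (count_list xs \<chi> * card G) = int (card G) \<or> int (count_list xs \<chi> * card G) = - int (card G)"
      by (simp only: of_int_eq_iff)
    hence "count_list xs \<chi> * card G = card G" using card_pos by linarith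
    thus ?thesis using card_pos by simp
  qed
  have "distinct xs" using cnt xs(1) by (intro distinct_if_count_list_1) auto
  \<comment> \<open>This also shows that \<open>Irr G\<close> is finite; over an infinite set the
    sum would be 0 by convention.\<close>
  moreover have "Irr G = set xs"
  proof
    show "Irr G \<subseteq> set xs"
    proof
      fix \<chi> assume "\<chi> \<in> Irr G"
      hence "count_list xs \<chi> = 1" by (rule cnt)
      thus "\<chi> \<in> set xs" by (metis count_notin zero_neq_one)
    qed
  qed (rule xs(1))
  ultimately show ?thesis using xs(2)[OF g] unfolding F_def by (simp add: sum_list_distinct_conv_sum_set)
qed

end

section \<open>Signed permutations and their cycles\<close>

lemma W_BC_D:
  assumes "w \<in> W_BC n"
  shows "bij w" "w (- i) = - w i" "\<bar>i\<bar> > int n \<Longrightarrow> w i = i" "w 0 = 0" "w i = 0 \<longleftrightarrow> i = 0"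
    "\<bar>w i\<bar> \<le> int n \<longleftrightarrow> \<bar>i\<bar> \<le> int n"
proof -
  show b: "bij w" using assms by (simp add: W_BC_def)
  show f: "\<bar>i\<bar> > int n \<Longrightarrow> w i = i" for i using assms by (simp add: W_BC_def)
  show od: "w (- i) = - w i" for i using assms by (simp add: W_BC_def)
  show z: "w 0 = 0" using od[of 0] by simp
  have inj: "w i = w j \<longleftrightarrow> i = j" for i j using b by (auto simp: bij_def inj_eq)
  show "w i = 0 \<longleftrightarrow> i = 0" for i using inj[of i 0] z by simp
  show "\<bar>w i\<bar> \<le> int n \<longleftrightarrow> \<bar>i\<bar> \<le> int n" for i
    using f[of i] f[of "w i"] inj[of "w i" i] by linarith
qed

lemma W_BC_inj: "w \<in> W_BC n \<Longrightarrow> w i = w j \<longleftrightarrow> i = j"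
  using W_BC_D(1) by (auto simp: bij_def inj_eq)

lemma W_BC_perm_group: "perm_group (W_BC n)"
proof
  have "W_BC n \<subseteq> {w. w permutes {- int n..int n}}"
  proof
    fix w assume w: "w \<in> W_BC n"
    have "w x = x" if "x \<notin> {- int n..int n}" for x using that W_BC_D(3)[OF w, of x] by auto
    moreover have "\<exists>!x. w x = y" for y using W_BC_D(1)[OF w] by (metis bij_pointE)
    ultimately show "w \<in> {w. w permutes {- int n..int n}}" unfolding permutes_def by blast
  qed
  thus "finite (W_BC n)" by (rule finite_subset) (simp add: finite_permutations)
  show "id \<in> W_BC n" by (simp add: W_BC_def)
  fix v assume v: "v \<in> W_BC n"
  show "bij v" by (rule W_BC_D[OF v])
  show "v \<circ> w \<in> W_BC n" if "w \<in> W_BC n" for w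
    using v that by (auto simp: W_BC_def intro: bij_comp)
  have b: "bij v" by (rule W_BC_D[OF v])
  have "pinv v (- i) = - pinv v i" for i
  proof -
    have "v (- pinv v i) = - i" using W_BC_D(2)[OF v] bij_inv_eq_iff[OF b] by (metis bij_inv_eq_iff[OF b])
    thus ?thesis using bij_inv_eq_iff[OF b] by metis
  qed
  moreover have "pinv v i = i" if "\<bar>i\<bar> > int n" for i
    using W_BC_D(3)[OF v that] bij_inv_eq_iff[OF b] by metis
  ultimately show "pinv v \<in> W_BC n" using bij_imp_bij_inv[OF b] by (simp add: W_BC_def)
qed

text \<open>The flag b treats two groups at once: with b, a copy of the symmetric group acting in
  parallel on i and - i; without it, the whole hyperoctahedral group.\<close>

definition signed_perms :: "bool \<Rightarrow> nat \<Rightarrow> perm set" where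
  "signed_perms b n = {w \<in> W_BC n. b \<longrightarrow> (\<forall>i>0. w i > 0)}"

lemma signed_perms_False [simp]: "signed_perms False n = W_BC n"
  by (simp add: signed_perms_def)

lemma signed_perms_W_BC: "w \<in> signed_perms b n \<Longrightarrow> w \<in> W_BC n"
  by (simp add: signed_perms_def)

lemma signed_perms_perm_group: "perm_group (signed_perms b n)"
proof -
  interpret W: perm_group "W_BC n" by (rule W_BC_perm_group)
  have "pinv v i > 0" if v: "v \<in> W_BC n" "\<forall>i>0. v i > 0" and i: "i > 0" for v i
  proof (rule ccontr)
    assume "\<not> pinv v i > 0"
    hence "- pinv v i > 0 \<or> pinv v i = 0" by linarith
    hence "v (- pinv v i) \<ge> 0" using v(2) W_BC_D(4)[OF v(1)] by (metis order.strict_implies_order order_refl neg_0_equal_iff_equal)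
    moreover have "v (- pinv v i) = - i"
      using W_BC_D(2)[OF v(1)] W.comp_inv[OF v(1)] by (metis comp_apply id_apply)
    ultimately show False using i by simp
  qed
  thus ?thesis
    by unfold_locales (auto simp: signed_perms_def W.finite_carrier W.id_mem W.bij_mem W.comp_mem W.inv_mem)
qed

locale signed_perm =
  fixes b :: bool and n :: nat and g :: perm
  assumes g_mem: "g \<in> signed_perms b n"
begin

lemma g_W: "g \<in> W_BC n" using g_mem by (rule signed_perms_W_BC)

lemma g_pos: "b \<Longrightarrow> i > 0 \<Longrightarrow> g i > 0" using g_mem by (simp add: signed_perms_def)

lemmas g_odd = W_BC_D(2)[OF g_W]
lemmas g_zero = W_BC_D(5)[OF g_W]
lemmas g_inj = W_BC_inj[OF g_W]

lemma pow_mem: "g ^^ k \<in> signed_perms b n"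
proof (induction k)
  case 0
  show ?case using perm_group.id_mem[OF signed_perms_perm_group] by (simp only: funpow.simps)
next
  case (Suc k)
  thus ?case using perm_group.comp_mem[OF signed_perms_perm_group g_mem] by (simp only: funpow.simps)
qed

lemmas pow_W = signed_perms_W_BC[OF pow_mem]
lemmas pow_odd = W_BC_D(2)[OF pow_W]
lemmas pow_zero = W_BC_D(5)[OF pow_W]
lemmas pow_zero' [simp] = W_BC_D(4)[OF pow_W]
lemmas pow_inj = W_BC_inj[OF pow_W]
lemmas pow_fix = W_BC_D(3)[OF pow_W]

lemma pow_pos: "b \<Longrightarrow> i > 0 \<Longrightarrow> (g ^^ k) i > 0"
  using pow_mem[of k] by (simp add: signed_perms_def)

lemma pow_add: "(g ^^ (k + l)) a = (g ^^ k) ((g ^^ l) a)"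
  by (simp add: funpow_add)

lemma pow_comm: "(g ^^ k) ((g ^^ l) a) = (g ^^ l) ((g ^^ k) a)"
  by (metis pow_add add.commute)

lemma pow_g: "(g ^^ k) (g a) = g ((g ^^ k) a)"
  using pow_comm[of k 1 a] by simp

lemma ex_order: "\<exists>e>0. g ^^ e = id"
proof -
  have "finite (range (\<lambda>k. g ^^ k))"
    using pow_W perm_group.finite_carrier[OF W_BC_perm_group] by (metis finite_subset image_subsetI)
  hence "\<not> inj (\<lambda>k::nat. g ^^ k)" using finite_imageD infinite_UNIV_nat by blast
  then obtain i j :: nat where "i \<noteq> j" "g ^^ i = g ^^ j" by (auto simp: inj_on_def)
  hence "\<exists>i j::nat. i < j \<and> g ^^ i = g ^^ j" by (metis linorder_neqE_nat)
  then obtain i j :: nat where ij: "i < j" "g ^^ i = g ^^ j" by blast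
  have "(g ^^ (j - i)) a = a" for a
  proof -
    have "(g ^^ i) ((g ^^ (j - i)) a) = (g ^^ i) a" using ij pow_add[of i "j - i" a] by simp
    thus ?thesis by (simp only: pow_inj)
  qed
  hence "g ^^ (j - i) = id" by (simp add: fun_eq_iff)
  thus ?thesis using ij(1) by (intro exI[of _ "j - i"]) simp
qed

text \<open>Any exponent of g serves. It allows inverses to be written as powers with natural
  exponents.\<close>

definition e :: nat where "e = (SOME e. e > 0 \<and> g ^^ e = id)"

lemma e_pos: "e > 0" and pow_e: "(g ^^ e) a = a"
  using someI_ex[OF ex_order] unfolding e_def[symmetric] by auto

text \<open>Cycle lengths are counted on signed points: a nonzero cycle containing both a and - a
  has twice as many points as absolute values.\<close>

definition p :: "int \<Rightarrow> nat" where "p a = (LEAST k. k > 0 \<and> (g ^^ k) a = a)"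

lemma p_pos: "p a > 0" and pow_p: "(g ^^ p a) a = a"
  using LeastI[of "\<lambda>k. k > 0 \<and> (g ^^ k) a = a" e] e_pos pow_e unfolding p_def by auto

lemma pow_mult_p: "(g ^^ (k * p a)) a = a"
  by (induction k) (simp_all add: pow_add pow_p del: funpow.simps)

lemma pow_fix_iff: "(g ^^ k) a = a \<longleftrightarrow> p a dvd k"
proof
  assume k: "(g ^^ k) a = a"
  have "(g ^^ k) a = (g ^^ (k mod p a)) ((g ^^ (k div p a * p a)) a)"
    unfolding pow_add[symmetric] by (simp only: mod_div_mult_eq)
  hence "(g ^^ (k mod p a)) a = a" using k pow_mult_p by simp
  moreover have "k mod p a < p a" using p_pos by simp
  ultimately have "k mod p a = 0"
    using not_less_Least[of "k mod p a" "\<lambda>k. k > 0 \<and> (g ^^ k) a = a"] unfolding p_def[symmetric] by auto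
  thus "p a dvd k" by auto
next
  assume "p a dvd k"
  then obtain m where "k = m * p a" by (metis dvd_def mult.commute)
  thus "(g ^^ k) a = a" using pow_mult_p by simp
qed

lemma pow_eq_iff: "(g ^^ k) a = (g ^^ l) a \<longleftrightarrow> int (p a) dvd int k - int l"
proof -
  have *: "(g ^^ k) a = (g ^^ l) a \<longleftrightarrow> int (p a) dvd int k - int l" if "l \<le> k" for k l
  proof -
    have "(g ^^ k) a = (g ^^ l) ((g ^^ (k - l)) a)" using that unfolding pow_add[symmetric] by simp
    hence "(g ^^ k) a = (g ^^ l) a \<longleftrightarrow> (g ^^ (k - l)) a = a" by (simp only: pow_inj)
    also have "\<dots> \<longleftrightarrow> int (p a) dvd int (k - l)" by (simp add: pow_fix_iff)
    finally show ?thesis using that by (simp add: of_nat_diff)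
  qed
  show ?thesis
  proof (cases "l \<le> k")
    case False
    have "(g ^^ k) a = (g ^^ l) a \<longleftrightarrow> (g ^^ l) a = (g ^^ k) a" by auto
    also have "\<dots> \<longleftrightarrow> int (p a) dvd - (int k - int l)" using *[of k l] False by simp
    finally show ?thesis by (simp only: dvd_minus_iff)
  qed (rule *)
qed

lemma p_pow: "p ((g ^^ k) a) = p a"
proof -
  have "(g ^^ l) ((g ^^ k) a) = (g ^^ k) a \<longleftrightarrow> (g ^^ l) a = a" for l
    unfolding pow_comm[of l] by (simp only: pow_inj)
  thus ?thesis by (simp add: p_def)
qed

lemma p_minus: "p (- a) = p a"
  by (simp add: p_def pow_odd)

lemma pow_inverse: "\<exists>l. \<forall>a. (g ^^ l) ((g ^^ k) a) = a"
proof -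
  have "(g ^^ (k * e)) a = a" for a by (induction k) (simp_all add: pow_add pow_e del: funpow.simps)
  moreover have "k \<le> k * e" using e_pos by simp
  hence "k * e - k + k = k * e" by simp
  ultimately have "(g ^^ (k * e - k)) ((g ^^ k) a) = a" for a unfolding pow_add[symmetric] by simp
  thus ?thesis by blast
qed

text \<open>A canonical label of the cycle of a taken together with the cycle of - a. Being a
  number, it also orders these classes, which decides which of two swapped cycles a root traverses
  first.\<close>

definition mu :: "int \<Rightarrow> nat" where "mu a = (LEAST m. \<exists>k. nat \<bar>(g ^^ k) a\<bar> = m)"

lemma mu_attained: "\<exists>k. \<bar>(g ^^ k) a\<bar> = int (mu a)"
proof -
  have "\<exists>k. nat \<bar>(g ^^ k) a\<bar> = mu a" unfolding mu_def by (rule LeastI_ex) blast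
  then obtain k where "nat \<bar>(g ^^ k) a\<bar> = mu a" by blast
  thus ?thesis by (intro exI[of _ k]) simp
qed

lemma mu_minus [simp]: "mu (- a) = mu a"
  by (simp add: mu_def pow_odd)

lemma mu_pow [simp]: "mu ((g ^^ k) a) = mu a"
proof -
  obtain l where l: "\<And>a. (g ^^ l) ((g ^^ k) a) = a" using pow_inverse by blast
  have "(\<exists>i. nat \<bar>(g ^^ i) ((g ^^ k) a)\<bar> = m) \<longleftrightarrow> (\<exists>i. nat \<bar>(g ^^ i) a\<bar> = m)" for m
  proof
    assume "\<exists>i. nat \<bar>(g ^^ i) ((g ^^ k) a)\<bar> = m"
    thus "\<exists>i. nat \<bar>(g ^^ i) a\<bar> = m" unfolding pow_add[symmetric] by blast
  next
    assume "\<exists>i. nat \<bar>(g ^^ i) a\<bar> = m"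
    then obtain i where "nat \<bar>(g ^^ i) a\<bar> = m" by blast
    hence "nat \<bar>(g ^^ (i + l)) ((g ^^ k) a)\<bar> = m" by (simp only: pow_add l)
    thus "\<exists>i. nat \<bar>(g ^^ i) ((g ^^ k) a)\<bar> = m" by blast
  qed
  thus ?thesis by (simp add: mu_def)
qed

lemma mu_g [simp]: "mu (g a) = mu a" using mu_pow[of 1 a] by simp

lemma mu_eq_iff: "mu a = mu c \<longleftrightarrow> (\<exists>k. c = (g ^^ k) a \<or> c = - (g ^^ k) a)"
proof
  assume eq: "mu a = mu c"
  obtain k where k: "\<bar>(g ^^ k) a\<bar> = int (mu a)" using mu_attained by blast
  obtain l where l: "\<bar>(g ^^ l) c\<bar> = int (mu c)" using mu_attained by blast
  obtain l' where l': "\<And>a. (g ^^ l') ((g ^^ l) a) = a" using pow_inverse by blast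
  have "(g ^^ l) c = (g ^^ k) a \<or> (g ^^ l) c = - (g ^^ k) a" using k l eq by linarith
  hence "(g ^^ l') ((g ^^ l) c) = (g ^^ l') ((g ^^ k) a) \<or> (g ^^ l') ((g ^^ l) c) = (g ^^ l') (- (g ^^ k) a)" by auto
  hence "c = (g ^^ (l' + k)) a \<or> c = - (g ^^ (l' + k)) a" by (simp add: l' pow_add pow_odd)
  thus "\<exists>k. c = (g ^^ k) a \<or> c = - (g ^^ k) a" by blast
qed auto

lemma mu_zero_iff [simp]: "mu a = 0 \<longleftrightarrow> a = 0"
proof
  assume "mu a = 0"
  thus "a = 0" using mu_attained[of a] pow_zero by auto
next
  assume "a = 0"
  thus "mu a = 0" using mu_attained[of a] by auto
qed

end

section \<open>Commuting involutions and square roots\<close>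

text \<open>An element encodes a signed involution \<open>z\<close> without points \<open>i \<mapsto> - i\<close> together with a choice of one
  point from each pair of fixed points \<open>i, - i\<close>: chosen fixed points are kept, the others are sent to 0.\<close>

definition half_involutions :: "bool \<Rightarrow> nat \<Rightarrow> (int \<Rightarrow> int) set" where
  "half_involutions b n = {y. y 0 = 0 \<and> (\<forall>i. \<bar>i\<bar> > int n \<longrightarrow> y i = (if i > 0 then i else 0))
     \<and> (\<forall>i. i \<noteq> 0 \<longrightarrow> (y i = i \<and> y (- i) = 0) \<or> (y i = 0 \<and> y (- i) = - i)
           \<or> (y i \<noteq> 0 \<and> y i \<noteq> i \<and> y i \<noteq> - i \<and> y (y i) = i \<and> y (- i) = - y i))
     \<and> (b \<longrightarrow> (\<forall>i>0. y i > 0))}"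

lemma half_involutions_D:
  assumes "y \<in> half_involutions b n"
  shows "y 0 = 0" "\<bar>i\<bar> > int n \<Longrightarrow> y i = (if i > 0 then i else 0)" "b \<Longrightarrow> i > 0 \<Longrightarrow> y i > 0"
    "i \<noteq> 0 \<Longrightarrow> y i = i \<Longrightarrow> y (- i) = 0" "i \<noteq> 0 \<Longrightarrow> y i = 0 \<Longrightarrow> y (- i) = - i"
    "y i \<noteq> 0 \<Longrightarrow> y i \<noteq> i \<Longrightarrow> y i \<noteq> - i \<and> y (y i) = i \<and> y (- i) = - y i"
  using assms unfolding half_involutions_def by (auto, (metis+)?)

lemma half_involutions_I:
  assumes "y 0 = 0" "\<And>i. \<bar>i\<bar> > int n \<Longrightarrow> y i = (if i > 0 then i else 0)" "\<And>i. b \<Longrightarrow> i > 0 \<Longrightarrow> y i > 0"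
    "\<And>i. i \<noteq> 0 \<Longrightarrow> (y i = i \<and> y (- i) = 0) \<or> (y i = 0 \<and> y (- i) = - i)
           \<or> (y i \<noteq> 0 \<and> y i \<noteq> i \<and> y i \<noteq> - i \<and> y (y i) = i \<and> y (- i) = - y i)"
  shows "y \<in> half_involutions b n"
  unfolding half_involutions_def using assms by blast

context signed_perm begin

text \<open>The odd part of \<open>e\<close> is a common multiple of all odd cycle lengths. Hence
  one and the same power of g, with exponent (q + 1) / 2, is a square root of g on all odd cycles at
  once; this is \<open>u\<close>.\<close>

definition q :: nat where "q = (SOME q. odd q \<and> (\<exists>t. e = 2 ^ t * q))"

lemma q_odd: "odd q" and e_q: "\<exists>t. e = 2 ^ t * q"
proof -
  have "\<exists>q t. odd q \<and> m = 2 ^ t * q" if "m > 0" for m :: nat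
    using that
  proof (induction m rule: less_induct)
    case (less m)
    show ?case
    proof (cases "odd m")
      case True
      thus ?thesis by (intro exI[of _ m] exI[of _ 0]) simp
    next
      case False
      then obtain m' where m': "m = 2 * m'" by blast
      then obtain q t where "odd q" "m' = 2 ^ t * q" using less.IH[of m'] less.prems by auto
      thus ?thesis using m' by (intro exI[of _ q] exI[of _ "Suc t"]) simp
    qed
  qed
  hence "\<exists>q. odd q \<and> (\<exists>t. e = 2 ^ t * q)" using e_pos by blast
  from someI_ex[OF this] show "odd q" "\<exists>t. e = 2 ^ t * q" unfolding q_def by auto
qed

lemma odd_p_iff: "odd (p a) \<longleftrightarrow> p a dvd q"
proof
  assume o: "odd (p a)"
  obtain t where t: "e = 2 ^ t * q" using e_q by blast
  have "p a dvd e" using pow_e pow_fix_iff by blast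
  moreover have "coprime (p a) (2 ^ t)" using o by simp
  ultimately show "p a dvd q" unfolding t by (simp add: coprime_dvd_mult_right_iff)
next
  assume "p a dvd q"
  thus "odd (p a)" using q_odd dvd_trans by blast
qed

definition u :: "int \<Rightarrow> int" where "u = g ^^ ((q + 1) div 2)"

lemma u_odd: "u (- a) = - u a" and u_zero: "u a = 0 \<longleftrightarrow> a = 0" and mu_u [simp]: "mu (u a) = mu a"
  and u_g: "u (g a) = g (u a)"
  and u_pos: "b \<Longrightarrow> a > 0 \<Longrightarrow> u a > 0"
  unfolding u_def using pow_odd pow_zero mu_pow pow_g pow_pos by auto

lemma u_u: "odd (p a) \<Longrightarrow> u (u a) = g a"
proof -
  assume "odd (p a)"
  hence d: "p a dvd q" by (simp add: odd_p_iff)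
  have "u (u a) = (g ^^ (1 + q)) a" unfolding u_def pow_add[symmetric] using q_odd by (simp add: mult_2[symmetric] del: funpow.simps)
  also have "\<dots> = g ((g ^^ q) a)" by simp
  also have "(g ^^ q) a = a" using d pow_fix_iff by simp
  finally show ?thesis .
qed

text \<open>If g^k squares to g on the cycle of a, then 2k is 1 modulo its length. So the length is
  odd, and k is determined modulo it.\<close>

lemma pow_half_unique:
  assumes "(g ^^ (2 * k)) a = g a"
  shows "odd (p a)" "(g ^^ k) a = u a"
proof -
  have "(g ^^ (2 * k)) a = (g ^^ 1) a" using assms by simp
  hence d: "int (p a) dvd 2 * int k - 1" unfolding pow_eq_iff by simp
  show o: "odd (p a)"
  proof
    assume "even (p a)"
    hence "(2::int) dvd 2 * int k - 1" using d dvd_trans by (metis even_of_nat)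
    thus False by simp
  qed
  define j where "j = (q + 1) div 2"
  have j: "2 * j = q + 1" using q_odd by (auto simp: j_def)
  have dq: "int (p a) dvd int q" using o odd_p_iff by simp
  have "int q = 2 * int j - 1" using arg_cong[OF j, of int] by simp
  hence "(2 * int k - 1) - int q = 2 * (int k - int j)" by simp
  hence "int (p a) dvd 2 * (int k - int j)" using dvd_diff[OF d dq] by metis
  moreover have "coprime (int (p a)) 2" using o by simp
  ultimately have "int (p a) dvd int k - int j" using coprime_dvd_mult_right_iff by blast
  thus "(g ^^ k) a = u a" unfolding u_def j_def[symmetric] pow_eq_iff .
qed

text \<open>From g^k a = - a follows g^(2k) a = a; an odd length then divides k, so that a = - a.
  Odd cycles other than {0} are thus disjoint from their negatives.\<close>

lemma odd_not_neg:
  assumes "odd (p a)" "a \<noteq> 0"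
  shows "(g ^^ k) a \<noteq> - a"
proof
  assume k: "(g ^^ k) a = - a"
  have "(g ^^ (k + k)) a = a" unfolding pow_add k by (simp add: pow_odd k)
  hence "p a dvd 2 * k" unfolding pow_fix_iff by (simp add: mult_2)
  hence "p a dvd k" using assms(1) by (simp add: coprime_dvd_mult_right_iff)
  hence "(g ^^ k) a = a" by (simp add: pow_fix_iff)
  with k assms(2) show False by simp
qed

text \<open>Distinguishes the cycles through a and - a by marking the one that contains +
  \<open>mu\<close>. It is informative only where the two cycles differ.\<close>

definition sg :: "int \<Rightarrow> int" where "sg a = (if \<exists>k. (g ^^ k) a = int (mu a) then 1 else -1)"

lemma sg_cases: "sg a = 1 \<or> sg a = -1" by (simp add: sg_def)

lemma sg_pow: "sg ((g ^^ k) a) = sg a"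
proof -
  obtain l where l: "\<And>a. (g ^^ l) ((g ^^ k) a) = a" using pow_inverse by blast
  have "(\<exists>i. (g ^^ i) ((g ^^ k) a) = int (mu a)) \<longleftrightarrow> (\<exists>i. (g ^^ i) a = int (mu a))"
  proof
    assume "\<exists>i. (g ^^ i) ((g ^^ k) a) = int (mu a)"
    thus "\<exists>i. (g ^^ i) a = int (mu a)" unfolding pow_add[symmetric] by blast
  next
    assume "\<exists>i. (g ^^ i) a = int (mu a)"
    then obtain i where "(g ^^ i) a = int (mu a)" by blast
    hence "(g ^^ (i + l)) ((g ^^ k) a) = int (mu a)" by (simp only: pow_add l)
    thus "\<exists>i. (g ^^ i) ((g ^^ k) a) = int (mu a)" by blast
  qed
  thus ?thesis by (simp add: sg_def)
qed

lemma sg_g: "sg (g a) = sg a" using sg_pow[of 1] by simp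
lemma sg_u: "sg (u a) = sg a" unfolding u_def by (rule sg_pow)

lemma sg_minus:
  assumes "odd (p a)" "a \<noteq> 0"
  shows "sg (- a) = - sg a"
proof -
  obtain k where k: "\<bar>(g ^^ k) a\<bar> = int (mu a)" using mu_attained by blast
  have "\<not> ((\<exists>i. (g ^^ i) a = int (mu a)) \<and> (\<exists>i. (g ^^ i) a = - int (mu a)))"
  proof
    assume "(\<exists>i. (g ^^ i) a = int (mu a)) \<and> (\<exists>i. (g ^^ i) a = - int (mu a))"
    then obtain i j where "(g ^^ j) a = int (mu a)" "(g ^^ i) a = - int (mu a)" by blast
    hence ij: "(g ^^ i) a = - (g ^^ j) a" by simp
    obtain l where l: "\<And>a. (g ^^ l) ((g ^^ j) a) = a" using pow_inverse by blast
    have "(g ^^ (l + i)) a = - a" unfolding pow_add ij by (simp add: pow_odd l)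
    thus False using odd_not_neg[OF assms] by blast
  qed
  moreover have "(\<exists>i. (g ^^ i) a = int (mu a)) \<or> (\<exists>i. (g ^^ i) a = - int (mu a))" using k by (metis abs_if minus_minus)
  moreover have "(\<exists>i. (g ^^ i) (- a) = int (mu (- a))) \<longleftrightarrow> (\<exists>i. (g ^^ i) a = - int (mu a))"
  proof -
    have "- x = m \<longleftrightarrow> x = - m" for x m :: int by auto
    thus ?thesis by (simp only: pow_odd mu_minus)
  qed
  ultimately show ?thesis unfolding sg_def by auto
qed

lemma sg_pos: "b \<Longrightarrow> a > 0 \<Longrightarrow> sg a = 1"
proof -
  assume a: "b" "a > 0"
  obtain k where "\<bar>(g ^^ k) a\<bar> = int (mu a)" using mu_attained by blast
  hence "(g ^^ k) a = int (mu a)" using pow_pos[OF a, of k] by simp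
  thus ?thesis unfolding sg_def by auto
qed

text \<open>Beyond n, \<open>half_involutions\<close> prescribes the positive points as the chosen
  ones. As \<open>sg\<close> is 1 on them, this is the choice for which the root fixes these
  points.\<close>

lemma outside:
  assumes "\<bar>a\<bar> > int n"
  shows "u a = a" "mu a = nat \<bar>a\<bar>" "odd (p a)" "a > 0 \<Longrightarrow> sg a = 1"
proof -
  have k: "(g ^^ k) a = a" for k using pow_fix[OF assms] by simp
  show "u a = a" by (simp add: u_def k)
  show m: "mu a = nat \<bar>a\<bar>" using mu_attained[of a] by (simp add: k)
  have "p a dvd 1" using k[of 1] unfolding pow_fix_iff .
  thus "odd (p a)" by simp
  show "sg a = 1" if "a > 0" using that by (simp add: sg_def m k)
qed

definition commuting :: "(int \<Rightarrow> int) set" where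
  "commuting = {y \<in> half_involutions b n. \<forall>a. y (g a) = g (y a)}"

lemma commuting_pow: "y \<in> commuting \<Longrightarrow> y ((g ^^ k) a) = (g ^^ k) (y a)"
  by (induction k) (auto simp: commuting_def)

text \<open>The premise says that y preserves the class of a; the value 0 has to be listed
  separately because it stands for a fixed point that was not chosen. Regularity asks that y be the
  identity there and the cycle odd, the situation in which g has a root on the cycle itself.\<close>

definition regular :: "(int \<Rightarrow> int) \<Rightarrow> int \<Rightarrow> bool" where
  "regular y a \<longleftrightarrow> (y a = 0 \<or> mu (y a) = mu a \<longrightarrow> odd (p a) \<and> (y a = a \<or> y a = 0))"

definition regulars :: "(int \<Rightarrow> int) set" where
  "regulars = {y \<in> commuting. \<forall>a. a \<noteq> 0 \<longrightarrow> regular y a}"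

definition roots :: "perm set" where
  "roots = {x \<in> signed_perms b n. x \<circ> x = g}"

text \<open>A cycle of odd length is rooted by \<open>u\<close>, up to a sign that records the choice made by \<open>y\<close>. Of two cycles
  swapped by \<open>y\<close>, the one with the smaller \<open>mu\<close> is traversed first.\<close>

definition to_root :: "(int \<Rightarrow> int) \<Rightarrow> int \<Rightarrow> int" where
  "to_root y a = (if a = 0 then 0 else if y a = a then sg a * u a else if y a = 0 then - (sg a * u a)
     else if mu a < mu (y a) then y a else g (y a))"

definition of_root :: "perm \<Rightarrow> int \<Rightarrow> int" where
  "of_root x a = (if a = 0 then 0 else if mu (x a) = mu a then (if x a = sg a * u a then a else 0)
     else if mu a < mu (x a) then x a else pinv x a)"

lemma regularsD:
  assumes "y \<in> regulars" "a \<noteq> 0"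
  shows "y a = a \<Longrightarrow> odd (p a)" "y a = 0 \<Longrightarrow> odd (p a)" "y a \<noteq> a \<Longrightarrow> y a \<noteq> 0 \<Longrightarrow> mu (y a) \<noteq> mu a"
  using assms unfolding regulars_def regular_def by auto

lemma to_root_odd:
  assumes y: "y \<in> regulars"
  shows "to_root y (- a) = - to_root y a"
proof (cases "a = 0")
  case True
  thus ?thesis by (simp add: to_root_def)
next
  case False
  have yh: "y \<in> half_involutions b n" using y by (simp add: regulars_def commuting_def)
  note Y = half_involutions_D[OF yh] and Rg = regularsD[OF y False]
  consider "y a = a" | "y a = 0" | "y a \<noteq> a" "y a \<noteq> 0" by blast
  thus ?thesis
  proof cases
    case 1
    have "y (- a) = 0" using Y(4)[OF False 1] .
    thus ?thesis using False 1 sg_minus[OF Rg(1)[OF 1] False] by (simp add: to_root_def u_odd)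
  next
    case 2
    have "y (- a) = - a" using Y(5)[OF False 2] .
    thus ?thesis using False 2 sg_minus[OF Rg(2)[OF 2] False] by (simp add: to_root_def u_odd)
  next
    case 3
    have "y (- a) = - y a" using Y(6)[OF 3(2,1)] by simp
    thus ?thesis using False 3 by (simp add: to_root_def g_odd)
  qed
qed

text \<open>On a chosen odd cycle the sign \<open>sg\<close> is squared away and \<open>u\<close>
  squares to g. On two swapped cycles one of two consecutive steps is y and the other is g after y,
  where y is an involution commuting with g. Points that were not chosen are reduced to chosen ones
  by oddness.\<close>

lemma to_root_square:
  assumes y: "y \<in> regulars"
  shows "to_root y (to_root y a) = g a"
proof -
  have yh: "y \<in> half_involutions b n" and yc: "y \<in> commuting" and yg: "\<And>a. y (g a) = g (y a)"
    using y by (auto simp: regulars_def commuting_def)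
  note Y = half_involutions_D[OF yh]
  have fixed: "to_root y (to_root y a) = g a" if a: "a \<noteq> 0" "y a = a" for a
  proof -
    have o: "odd (p a)" using regularsD[OF y a(1)] a by blast
    have x: "to_root y a = sg a * u a" using a by (simp add: to_root_def)
    have yu: "y (u a) = u a" using commuting_pow[OF yc] a(2) by (simp add: u_def)
    have "to_root y (u a) = sg a * g a"
      using yu a(1) by (simp add: to_root_def u_zero sg_u u_u[OF o])
    thus ?thesis unfolding x using sg_cases[of a] to_root_odd[OF y, of "u a"] by auto
  qed
  consider "a = 0" | "a \<noteq> 0" "y a = a" | "a \<noteq> 0" "y a = 0" | "a \<noteq> 0" "y a \<noteq> a" "y a \<noteq> 0" by blast
  thus ?thesis
  proof cases
    case 1
    thus ?thesis using g_zero[of 0] by (simp add: to_root_def)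
  next
    case 2
    thus ?thesis by (rule fixed)
  next
    case 3
    have "to_root y (to_root y (- a)) = g (- a)" using Y(5)[OF 3] 3 by (intro fixed) auto
    thus ?thesis by (simp add: to_root_odd[OF y] g_odd)
  next
    case 4
    define c where "c = y a"
    have c: "c \<noteq> 0" "c \<noteq> a" "y c = a" using Y(6)[OF 4(3,2)] 4 by (auto simp: c_def)
    have m: "mu c \<noteq> mu a" using regularsD(3)[OF y 4(1,2,3)] by (simp add: c_def)
    show ?thesis
    proof (cases "mu a < mu c")
      case True
      hence "to_root y a = c" using 4 by (simp add: to_root_def c_def)
      thus ?thesis using c 4(1) True by (simp add: to_root_def)
    next
      case False
      hence lt: "mu c < mu a" using m by simp
      hence x: "to_root y a = g c" using 4 by (simp add: to_root_def c_def)
      have "y (g c) = g a" using yg c by simp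
      thus ?thesis unfolding x using c 4(1) lt by (simp add: to_root_def g_zero g_inj)
    qed
  qed
qed

lemma to_root_mem:
  assumes y: "y \<in> regulars"
  shows "to_root y \<in> roots"
proof -
  have yh: "y \<in> half_involutions b n" using y by (simp add: regulars_def commuting_def)
  note Y = half_involutions_D[OF yh]
  have sq: "to_root y \<circ> to_root y = g" using to_root_square[OF y] by (simp add: fun_eq_iff)
  \<comment> \<open>A map whose square is bijective is itself bijective.\<close>
  have bg: "bij g" using W_BC_D(1)[OF g_W] .
  have "inj (to_root y)" using bg sq by (metis bij_is_inj inj_on_imageI2 inj_on_subset subset_UNIV)
  moreover have "surj (to_root y)" using bg sq by (metis bij_is_surj comp_apply surj_def)
  ultimately have "bij (to_root y)" by (simp add: bij_def)
  moreover have "to_root y a = a" if a: "\<bar>a\<bar> > int n" for a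
  proof -
    have pos: "to_root y a = a" if "a > 0" "\<bar>a\<bar> > int n" for a
      using outside[OF that(2)] Y(2)[OF that(2)] that(1) by (simp add: to_root_def)
    show ?thesis
    proof (cases "a > 0")
      case False
      hence "to_root y (- a) = - a" using a by (intro pos) auto
      thus ?thesis by (simp add: to_root_odd[OF y])
    qed (use pos a in simp)
  qed
  moreover have "to_root y a > 0" if "b" "a > 0" for a
    using that Y(3)[OF that] sg_pos[OF that] u_pos[OF that] g_pos by (auto simp: to_root_def)
  ultimately show ?thesis unfolding roots_def signed_perms_def W_BC_def
    using to_root_odd[OF y] sq by simp
qed

text \<open>A root commutes with its square g and hence permutes the classes of \<open>mu\<close>.
  It acts on them as its inverse does, because x and x^-1 differ by the factor g.\<close>

lemma root_facts:
  assumes "x \<in> roots"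
  shows "x \<in> W_BC n" "x (x a) = g a" "x (g a) = g (x a)" "x ((g ^^ k) a) = (g ^^ k) (x a)"
    "mu (x a) = mu (x c) \<longleftrightarrow> mu a = mu c" "mu (pinv x a) = mu (x a)" "x (pinv x a) = a" "pinv x (x a) = a"
    "pinv x (- a) = - pinv x a" "pinv x (g a) = g (pinv x a)" "b \<Longrightarrow> a > 0 \<Longrightarrow> x a > 0" "b \<Longrightarrow> a > 0 \<Longrightarrow> pinv x a > 0"
proof -
  show W: "x \<in> W_BC n" and pos: "b \<Longrightarrow> a > 0 \<Longrightarrow> x a > 0" for a
    using assms unfolding roots_def signed_perms_def by blast+
  interpret S: perm_group "signed_perms b n" by (rule signed_perms_perm_group)
  have xS: "x \<in> signed_perms b n" using assms by (simp add: roots_def)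
  have iS: "pinv x \<in> signed_perms b n" using S.inv_mem[OF xS] .
  note I = W_BC_D[OF signed_perms_W_BC[OF iS]]
  show "b \<Longrightarrow> a > 0 \<Longrightarrow> pinv x a > 0" using iS by (simp add: signed_perms_def)
  show xx: "x (x a) = g a" for a using assms by (auto simp: roots_def)
  show xg: "x (g a) = g (x a)" for a using xx[of "x a"] xx[of a] by simp
  show xp: "x ((g ^^ k) a) = (g ^^ k) (x a)" for k a by (induction k) (auto simp: xg)
  show xi: "x (pinv x a) = a" for a using fun_cong[OF S.comp_inv[OF xS], of a] by simp
  show ix: "pinv x (x a) = a" for a using fun_cong[OF S.inv_comp[OF xS], of a] by simp
  show "pinv x (- a) = - pinv x a" by (rule I(2))
  show ig: "pinv x (g a) = g (pinv x a)" for a using ix[of "g (pinv x a)"] by (simp only: xg xi)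
  have mono: "mu (v a) = mu (v c)" if "mu a = mu c" "v \<in> W_BC n" "\<And>a k. v ((g ^^ k) a) = (g ^^ k) (v a)" for v a c
  proof -
    obtain k where "c = (g ^^ k) a \<or> c = - (g ^^ k) a" using \<open>mu a = mu c\<close> mu_eq_iff by blast
    thus ?thesis using that(3) W_BC_D(2)[OF that(2)] by auto
  qed
  have ip: "pinv x ((g ^^ k) a) = (g ^^ k) (pinv x a)" for k a by (induction k) (auto simp: ig)
  show "mu (x a) = mu (x c) \<longleftrightarrow> mu a = mu c"
    using mono[OF _ W xp, of a c] mono[OF _ signed_perms_W_BC[OF iS] ip, of "x a" "x c"] ix by auto
  have "x a = g (pinv x a)" using xx[of "pinv x a"] xi[of a] by simp
  thus "mu (pinv x a) = mu (x a)" by simp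
qed

text \<open>If x preserves the class of a, then x a is g^k a up to sign. The sign is squared away,
  so \<open>pow_half_unique\<close> applies.\<close>

lemma root_on_orbit:
  assumes x: "x \<in> roots" and a: "mu (x a) = mu a"
  shows "odd (p a)" "x a = u a \<or> x a = - u a"
proof -
  note X = root_facts[OF x]
  obtain k where k: "x a = (g ^^ k) a \<or> x a = - (g ^^ k) a" using mu_eq_iff[of a "x a"] a by auto
  have xo: "x (- c) = - x c" for c using W_BC_D(2)[OF X(1)] .
  have "g a = (g ^^ (k + k)) a" using k
  proof
    assume 1: "x a = (g ^^ k) a"
    have "g a = x ((g ^^ k) a)" using X(2)[of a] 1 by simp
    thus ?thesis using X(4)[of k a] 1 by (simp add: pow_add)
  next
    assume 1: "x a = - (g ^^ k) a"
    have "g a = - x ((g ^^ k) a)" using X(2)[of a] 1 xo by simp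
    thus ?thesis using X(4)[of k a] 1 by (simp add: pow_add pow_odd)
  qed
  hence "(g ^^ (2 * k)) a = g a" by (simp add: mult_2)
  from pow_half_unique[OF this] k show "odd (p a)" "x a = u a \<or> x a = - u a" by auto
qed

text \<open>Since x squared preserves every class, x swaps the classes it moves in pairs. Using x on
  the class with the smaller \<open>mu\<close> and x^-1 on the other makes the resulting map an
  involution.\<close>

lemma of_root_mem:
  assumes x: "x \<in> roots"
  shows "of_root x \<in> regulars"
proof -
  note X = root_facts[OF x]
  note XW = W_BC_D[OF X(1)]
  define y where "y = of_root x"
  have off: "mu (y a) = mu (x a)" "y a \<noteq> 0" "y a \<noteq> a" "y a \<noteq> - a" "y (y a) = a" "y (- a) = - y a"
    if a: "a \<noteq> 0" "mu (x a) \<noteq> mu a" for a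
  proof -
    show m: "mu (y a) = mu (x a)" using a by (simp add: y_def of_root_def X(6))
    have "mu (x a) \<noteq> 0" using a XW(5) by simp
    thus "y a \<noteq> 0" using m mu_zero_iff by metis
    show "y a \<noteq> a" "y a \<noteq> - a" using m a by auto
    show "y (- a) = - y a" using a by (simp add: y_def of_root_def XW(2) X(9))
    show "y (y a) = a"
    proof (cases "mu a < mu (x a)")
      case True
      hence "y a = x a" using a by (simp add: y_def of_root_def)
      thus ?thesis using a True XW(5) by (simp add: y_def of_root_def X(2) X(8))
    next
      case False
      hence "y a = pinv x a" using a by (simp add: y_def of_root_def)
      moreover have "pinv x a \<noteq> 0" using a X(7)[of a] XW(4) by auto
      ultimately show ?thesis using a False by (simp add: y_def of_root_def X(6) X(7))
    qed
  qed
  have on: "odd (p a)" "(y a = a \<and> y (- a) = 0) \<or> (y a = 0 \<and> y (- a) = - a)"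
    if a: "a \<noteq> 0" "mu (x a) = mu a" for a
  proof -
    show o: "odd (p a)" using root_on_orbit[OF x a(2)] by simp
    have "u a \<noteq> 0" using a by (simp add: u_zero)
    thus "(y a = a \<and> y (- a) = 0) \<or> (y a = 0 \<and> y (- a) = - a)"
      using root_on_orbit(2)[OF x a(2)] sg_minus[OF o a(1)] sg_cases[of a] a
      by (auto simp: y_def of_root_def XW(2) u_odd)
  qed
  have com: "y (g a) = g (y a)" for a
  proof (cases "a = 0")
    case True
    thus ?thesis using g_zero[of 0] by (simp add: y_def of_root_def)
  next
    case False
    have gm: "g (sg a * u a) = sg a * g (u a)" using sg_cases[of a] g_odd by auto
    have "x (g a) = sg (g a) * u (g a) \<longleftrightarrow> x a = sg a * u a"
      unfolding X(3) sg_g u_g gm[symmetric] by (rule g_inj)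
    thus ?thesis using False g_zero[of 0] by (simp add: y_def of_root_def g_zero X(3) X(10))
  qed
  have "y \<in> half_involutions b n"
  proof (rule half_involutions_I)
    show "y 0 = 0" by (simp add: y_def of_root_def)
    show "y i = (if i > 0 then i else 0)" if i: "\<bar>i\<bar> > int n" for i
    proof -
      have xi: "x i = i" using XW(3)[OF i] .
      have i0: "i \<noteq> 0" using i by auto
      note O = outside[OF i]
      show ?thesis
      proof (cases "i > 0")
        case True
        thus ?thesis using O xi by (simp add: y_def of_root_def)
      next
        case False
        hence "sg (- i) = 1" using outside(4)[of "- i"] i i0 by simp
        hence "sg i = -1" using sg_minus[OF O(3) i0] by simp
        thus ?thesis using False O xi i0 by (simp add: y_def of_root_def)
      qed
    qed
    show "y i > 0" if "b" "i > 0" for i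
    proof (cases "mu (x i) = mu i")
      case True
      have "x i = u i" using root_on_orbit(2)[OF x True] X(11)[OF that] u_pos[OF that] by auto
      thus ?thesis using that sg_pos[OF that] True by (simp add: y_def of_root_def)
    next
      case False
      thus ?thesis using that X(11,12)[OF that] by (simp add: y_def of_root_def)
    qed
    show "(y i = i \<and> y (- i) = 0) \<or> (y i = 0 \<and> y (- i) = - i)
           \<or> (y i \<noteq> 0 \<and> y i \<noteq> i \<and> y i \<noteq> - i \<and> y (y i) = i \<and> y (- i) = - y i)" if "i \<noteq> 0" for i
      using on(2)[OF that] off(2-)[OF that] by blast
  qed
  moreover have "regular y a" if "a \<noteq> 0" for a
    unfolding regular_def using on[OF that] off(1,2)[OF that] by (cases "mu (x a) = mu a") auto
  ultimately show ?thesis using com unfolding regulars_def commuting_def y_def by blast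
qed

lemma to_root_of_root:
  assumes x: "x \<in> roots"
  shows "to_root (of_root x) = x"
proof
  fix a
  note X = root_facts[OF x]
  note XW = W_BC_D[OF X(1)]
  show "to_root (of_root x) a = x a"
  proof (cases "a = 0 \<or> mu (x a) = mu a")
    case True
    show ?thesis
    proof (cases "a = 0")
      case False
      hence m: "mu (x a) = mu a" using True by simp
      show ?thesis using root_on_orbit(2)[OF x m] sg_cases[of a] False m
        by (auto simp: to_root_def of_root_def)
    qed (simp add: to_root_def XW(4))
  next
    case False
    define y where "y = of_root x a"
    have y: "y = (if mu a < mu (x a) then x a else pinv x a)" using False by (simp add: y_def of_root_def)
    have m: "mu y = mu (x a)" by (simp add: y X(6))
    have "y \<noteq> a" using m False by auto
    moreover have "mu (x a) \<noteq> 0" using False XW(5) by simp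
    hence "y \<noteq> 0" using m mu_zero_iff by metis
    \<comment> \<open>On the class with the larger \<open>mu\<close> the stored value is x^-1 a, and
      the factor g in \<open>to_root\<close> restores x a.\<close>
    moreover have "g (pinv x a) = x a" using X(2)[of "pinv x a"] X(7) by simp
    ultimately show ?thesis using False unfolding to_root_def y_def[symmetric] m by (simp add: y)
  qed
qed

lemma of_root_to_root:
  assumes y: "y \<in> regulars"
  shows "of_root (to_root y) = y"
proof
  fix a
  have yh: "y \<in> half_involutions b n" using y by (simp add: regulars_def commuting_def)
  note Y = half_involutions_D[OF yh]
  define x where "x = to_root y"
  have x: "x \<in> roots" unfolding x_def by (rule to_root_mem[OF y])
  note X = root_facts[OF x]
  have ms: "mu (sg a * u a) = mu a" using sg_cases[of a] by auto
  hence ms': "mu (- (sg a * u a)) = mu a" by simp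
  consider "a = 0" | "a \<noteq> 0" "y a = a" | "a \<noteq> 0" "y a = 0" | "a \<noteq> 0" "y a \<noteq> a" "y a \<noteq> 0" by blast
  thus "of_root (to_root y) a = y a" unfolding x_def[symmetric]
  proof cases
    case 1
    thus "of_root x a = y a" using Y(1) by (simp add: of_root_def)
  next
    case 2
    hence "x a = sg a * u a" by (simp add: x_def to_root_def)
    thus "of_root x a = y a" using 2 ms by (simp add: of_root_def)
  next
    case 3
    hence "x a = - (sg a * u a)" by (simp add: x_def to_root_def)
    moreover have "sg a * u a \<noteq> 0" using 3(1) sg_cases[of a] u_zero[of a] by (simp add: mult_eq_0_iff) linarith
    ultimately have "mu (x a) = mu a" "x a \<noteq> sg a * u a" using ms' by (metis, linarith)
    thus "of_root x a = y a" using 3 by (simp add: of_root_def)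
  next
    case 4
    have m: "mu (y a) \<noteq> mu a" using regularsD(3)[OF y 4(1,2,3)] .
    have xa: "x a = (if mu a < mu (y a) then y a else g (y a))" using 4 by (simp add: x_def to_root_def)
    have mx: "mu (x a) = mu (y a)" by (simp add: xa)
    show "of_root x a = y a"
    proof (cases "mu a < mu (y a)")
      case True
      thus ?thesis using 4 mx xa by (simp add: of_root_def)
    next
      case False
      have "y (y a) = a" using Y(6)[OF 4(3,2)] by simp
      hence "x (y a) = a" using 4 False m by (simp add: x_def to_root_def)
      hence "pinv x a = y a" using X(8)[of "y a"] by simp
      thus ?thesis using 4 False m mx by (simp add: of_root_def)
    qed
  qed
qed

lemma card_regulars: "card regulars = card roots"
  by (rule bij_betw_same_card[of to_root], rule bij_betw_byWitness[of _ of_root])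
    (auto simp: to_root_of_root of_root_to_root to_root_mem of_root_mem)

end

section \<open>The sign of a permutation on an invariant set\<close>

definition restr :: "int set \<Rightarrow> perm \<Rightarrow> perm" where
  "restr A g = (\<lambda>i. if i \<in> A then g i else i)"

lemma permutation_restr:
  assumes g: "permutation g" and A: "\<And>i. g i \<in> A \<longleftrightarrow> i \<in> A"
  shows "permutation (restr A g)"
proof -
  have b: "bij g" and f: "finite {x. g x \<noteq> x}" using g by (auto simp: permutation)
  have "inj (restr A g)"
    using b A unfolding restr_def inj_def bij_def by metis
  moreover have "surj (restr A g)" unfolding surj_def
  proof
    fix y
    show "\<exists>x. y = restr A g x"
    proof (cases "y \<in> A")
      case True
      obtain x where "y = g x" using b by (metis bij_pointE)
      thus ?thesis using A[of x] True by (intro exI[of _ x]) (simp add: restr_def)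
    qed (auto simp: restr_def intro!: exI[of _ y])
  qed
  moreover have "finite {x. restr A g x \<noteq> x}" by (rule finite_subset[OF _ f]) (auto simp: restr_def)
  ultimately show ?thesis by (simp add: permutation bij_def)
qed

lemma sign_restr_Un:
  assumes g: "permutation g" and A: "\<And>i. g i \<in> A \<longleftrightarrow> i \<in> A" and B: "\<And>i. g i \<in> B \<longleftrightarrow> i \<in> B"
    and AB: "A \<inter> B = {}"
  shows "sign (restr (A \<union> B) g) = sign (restr A g) * sign (restr B g)"
proof -
  have "restr (A \<union> B) g = restr A g \<circ> restr B g"
    using AB B by (auto simp: restr_def fun_eq_iff)
  thus ?thesis using sign_compose permutation_restr[OF g A] permutation_restr[OF g B] by simp
qed

lemma sign_pow:
  assumes "permutation r"
  shows "permutation (r ^^ k)" "sign (r ^^ k) = sign r ^ k"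
proof -
  have "permutation (r ^^ k) \<and> sign (r ^^ k) = sign r ^ k"
  proof (induction k)
    case 0
    show ?case by (simp add: permutation del: id_apply) (simp add: id_def)
  next
    case (Suc k)
    thus ?case using assms permutation_compose[OF assms] sign_compose[OF assms] by (simp only: funpow.simps power_Suc)
  qed
  thus "permutation (r ^^ k)" "sign (r ^^ k) = sign r ^ k" by auto
qed

lemma W_BC_permutation: "w \<in> W_BC n \<Longrightarrow> permutation w"
proof -
  assume w: "w \<in> W_BC n"
  have "x \<in> {- int n..int n}" if "w x \<noteq> x" for x
  proof (rule ccontr)
    assume "x \<notin> {- int n..int n}"
    hence "\<bar>x\<bar> > int n" by auto
    from W_BC_D(3)[OF w this] that show False by simp
  qed
  hence "{x. w x \<noteq> x} \<subseteq> {- int n..int n}" by blast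
  hence "finite {x. w x \<noteq> x}" by (rule finite_subset) simp
  thus ?thesis using W_BC_D(1)[OF w] by (simp add: permutation)
qed

context signed_perm begin

text \<open>The first k + 1 points of the orbit are closed into a cycle; taking in the next point
  multiplies by one transposition with a. Staying below the cycle length keeps these points
  distinct.\<close>

lemma sign_partial_cycle:
  assumes "k < p a"
  shows "permutation (\<lambda>i. if \<exists>j<k. i = (g ^^ j) a then g i else if i = (g ^^ k) a then a else i)
    \<and> sign (\<lambda>i. if \<exists>j<k. i = (g ^^ j) a then g i else if i = (g ^^ k) a then a else i) = (-1) ^ k"
  (is "permutation (?c k) \<and> _")
  using assms
proof (induction k)
  case 0
  have "?c 0 = id" by auto
  thus ?case by (simp add: permutation)
next
  case (Suc k)
  have neq: "(g ^^ i) a \<noteq> (g ^^ j) a" if "i < j" "j < p a" for i j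
  proof
    assume "(g ^^ i) a = (g ^^ j) a"
    hence "int (p a) dvd int j - int i" unfolding pow_eq_iff using dvd_diff_commute by blast
    hence "int (p a) \<le> int j - int i" using that by (intro zdvd_imp_le) auto
    thus False using that by linarith
  qed
  have t: "?c (Suc k) = transpose a ((g ^^ Suc k) a) \<circ> ?c k"
  proof
    fix i
    consider j where "j < k" "i = (g ^^ j) a" | "i = (g ^^ k) a" | "i = (g ^^ Suc k) a"
      | "\<forall>j\<le>Suc k. i \<noteq> (g ^^ j) a" by (metis le_SucE le_neq_implies_less)
    thus "?c (Suc k) i = (transpose a ((g ^^ Suc k) a) \<circ> ?c k) i"
    proof cases
      case 1
      have "g i = (g ^^ Suc j) a" using 1 by simp
      moreover have "(g ^^ Suc j) a \<noteq> a" using neq[of 0 "Suc j"] 1 Suc.prems by simp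
      moreover have "(g ^^ Suc j) a \<noteq> (g ^^ Suc k) a" using neq[of "Suc j" "Suc k"] 1 Suc.prems by simp
      moreover have "\<exists>j<k. i = (g ^^ j) a" "\<exists>j<Suc k. i = (g ^^ j) a" using 1 less_SucI by blast+
      ultimately show ?thesis by (simp del: funpow.simps)
    next
      case 2
      have "i \<noteq> (g ^^ j) a" if "j < k" for j
        using neq[OF that Suc_lessD[OF Suc.prems]] unfolding 2 by (rule not_sym)
      hence "\<not> (\<exists>j<k. i = (g ^^ j) a)" by blast
      moreover have "\<exists>j<Suc k. i = (g ^^ j) a" using 2 by blast
      moreover have "transpose a ((g ^^ Suc k) a) a = g i" using 2 by simp
      ultimately show ?thesis unfolding comp_apply using 2 by (simp only: if_False if_True simp_thms)
    next
      case 3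
      have ne: "i \<noteq> (g ^^ j) a" if "j < Suc k" for j
        using neq[OF that Suc.prems] unfolding 3 by (rule not_sym)
      have "\<not> (\<exists>j<k. i = (g ^^ j) a)" using ne less_SucI by blast
      moreover have "i \<noteq> (g ^^ k) a" by (rule ne) simp
      moreover have "\<not> (\<exists>j<Suc k. i = (g ^^ j) a)" using ne by blast
      moreover have "transpose a ((g ^^ Suc k) a) i = a" using 3 by (simp del: funpow.simps)
      ultimately show ?thesis unfolding comp_apply using 3 by (simp only: if_False if_True simp_thms)
    next
      case 4
      hence "i \<noteq> a" by (metis funpow_0 zero_le)
      moreover have "\<not> (\<exists>j<k. i = (g ^^ j) a)" "\<not> (\<exists>j<Suc k. i = (g ^^ j) a)" "i \<noteq> (g ^^ k) a" "i \<noteq> (g ^^ Suc k) a"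
        using 4 by (auto simp del: funpow.simps)
      moreover from \<open>i \<noteq> a\<close> \<open>i \<noteq> (g ^^ Suc k) a\<close> have "transpose a ((g ^^ Suc k) a) i = i"
        by (simp del: funpow.simps)
      ultimately show ?thesis by (simp only: comp_apply if_False simp_thms)
    qed
  qed
  have ih: "permutation (?c k)" "sign (?c k) = (-1) ^ k" using Suc.IH Suc.prems by auto
  have "a \<noteq> (g ^^ Suc k) a" using neq[of 0 "Suc k"] Suc.prems by simp
  thus ?case unfolding t using ih permutation_compose[OF permutation_swap_id ih(1)] sign_compose[OF permutation_swap_id ih(1)]
    by (simp only: sign_swap_id power_Suc if_False)
qed

lemma sign_orbit: "sign (restr {i. \<exists>k. i = (g ^^ k) a} g) = (-1) ^ (p a - 1)"
proof -
  have orb: "(\<exists>k. i = (g ^^ k) a) \<longleftrightarrow> (\<exists>j<p a. i = (g ^^ j) a)" for i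
  proof
    assume "\<exists>k. i = (g ^^ k) a"
    then obtain k where k: "i = (g ^^ k) a" by blast
    have "(g ^^ k) a = (g ^^ (k mod p a)) a" unfolding pow_eq_iff by (simp add: zmod_int mod_eq_dvd_iff)
    thus "\<exists>j<p a. i = (g ^^ j) a" using k p_pos by (intro exI[of _ "k mod p a"]) simp
  qed auto
  obtain l where l: "p a = Suc l" using p_pos[of a] by (metis Suc_pred)
  have gl: "g ((g ^^ l) a) = a" using pow_p[of a] by (simp add: l)
  have "restr {i. \<exists>k. i = (g ^^ k) a} g = (\<lambda>i. if \<exists>j<l. i = (g ^^ j) a then g i else if i = (g ^^ l) a then a else i)"
    unfolding restr_def orb l less_Suc_eq using gl by (auto simp: fun_eq_iff)
  thus ?thesis using sign_partial_cycle[of l a] l by simp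
qed

text \<open>The set consists of the chosen fixed points together with 0 and the integers above n. As
  g fixes the latter, this is the sign of g on the choice.\<close>

definition wt :: "(int \<Rightarrow> int) \<Rightarrow> int" where "wt y = sign (restr {i. y i = i} g)"

lemma g_permutation: "permutation g" by (rule W_BC_permutation[OF g_W])

text \<open>All chosen points lie in odd cycles, so the q-th power of the restriction is the
  identity; a sign with an odd power equal to 1 is 1.\<close>

lemma wt_regular:
  assumes y: "y \<in> regulars"
  shows "wt y = 1"
proof -
  have yc: "y (g a) = g (y a)" for a using y by (simp add: regulars_def commuting_def)
  define r where "r = restr {i. y i = i} g"
  have P: "permutation r" unfolding r_def using yc g_inj by (intro permutation_restr[OF g_permutation]) auto
  have "(r ^^ k) i = (if y i = i then (g ^^ k) i else i)" for k i
  proof (induction k)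
    case (Suc k)
    have "y ((g ^^ k) i) = (g ^^ k) i" if "y i = i"
      using commuting_pow[of y k i] y that by (simp add: regulars_def)
    thus ?case using Suc by (simp add: r_def restr_def)
  qed simp
  moreover have "(g ^^ q) i = i" if "y i = i" for i
  proof (cases "i = 0")
    case False
    thus ?thesis using regularsD(1)[OF y False that] by (simp add: pow_fix_iff odd_p_iff)
  qed simp
  ultimately have "r ^^ q = id" by (auto simp: fun_eq_iff)
  hence "sign r ^ q = 1" using sign_pow(2)[OF P, of q] by (metis sign_id)
  moreover have "sign r = 1 \<or> sign r = -1" by (simp add: sign_def)
  ultimately show ?thesis using q_odd unfolding wt_def r_def[symmetric] by auto
qed

text \<open>If y a is a or 0, a relation g^k a = - a would carry the choice at a over to - a, where
  the opposite choice is required. Otherwise y a is g^k a up to sign, and since y is an involution,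
  g^k is the half rotation, the only nontrivial power whose square fixes a. If - a were on the
  cycle, it would be the half rotation of a too, and y a would be a or - a, both excluded.\<close>

lemma irregular_cases:
  assumes y: "y \<in> commuting" and a: "a \<noteq> 0" "\<not> regular y a"
  shows "even (p a)" "(g ^^ k) a \<noteq> - a"
    "y a = a \<or> y a = 0 \<or> y a = (g ^^ (p a div 2)) a \<or> y a = - (g ^^ (p a div 2)) a"
proof -
  have yh: "y \<in> half_involutions b n" using y by (simp add: commuting_def)
  note Y = half_involutions_D[OF yh]
  have yp: "y ((g ^^ k) a) = (g ^^ k) (y a)" for k by (rule commuting_pow[OF y])
  consider "y a = a" | "y a = 0" | "y a \<noteq> a" "y a \<noteq> 0" by blast
  hence "even (p a) \<and> (\<forall>k. (g ^^ k) a \<noteq> - a) \<and>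
    (y a = a \<or> y a = 0 \<or> y a = (g ^^ (p a div 2)) a \<or> y a = - (g ^^ (p a div 2)) a)"
  proof cases
    case 1
    have "(g ^^ k) a \<noteq> - a" for k
    proof
      assume k: "(g ^^ k) a = - a"
      have "y (- a) = - a" using yp[of k] 1 k by simp
      thus False using Y(4)[OF a(1) 1] a(1) by simp
    qed
    thus ?thesis using 1 a by (auto simp: regular_def)
  next
    case 2
    have "(g ^^ k) a \<noteq> - a" for k
    proof
      assume k: "(g ^^ k) a = - a"
      have "y (- a) = 0" using yp[of k] 2 k by simp
      thus False using Y(5)[OF a(1) 2] a(1) by simp
    qed
    thus ?thesis using 2 a by (auto simp: regular_def)
  next
    case 3
    have yy: "y a \<noteq> - a" "y (y a) = a" "y (- a) = - y a" using Y(6)[OF 3(2,1)] by auto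
    have "mu a = mu (y a)" using a(2) 3 by (auto simp: regular_def)
    then obtain k where k: "y a = (g ^^ k) a \<or> y a = - (g ^^ k) a" using mu_eq_iff by blast
    have half: "even (p a) \<and> (g ^^ l) a = (g ^^ (p a div 2)) a"
      if l: "(g ^^ (l + l)) a = a" "(g ^^ l) a \<noteq> a" for l
    proof -
      have d: "p a dvd 2 * l" "\<not> p a dvd l" using l unfolding pow_fix_iff by (simp_all add: mult_2)
      have ev: "even (p a)"
      proof (rule ccontr)
        assume "odd (p a)"
        thus False using d by (simp add: coprime_dvd_mult_right_iff)
      qed
      then obtain h where h: "p a = 2 * h" by blast
      then obtain m where m: "l = h * m" using d(1) by auto
      have "odd m"
      proof
        assume "even m"
        then obtain m' where "m = 2 * m'" by blast
        thus False using d(2) m h by simp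
      qed
      then obtain m' where "m = 2 * m' + 1" by (metis oddE)
      hence "int l - int h = int (p a) * int m'" by (simp add: m h algebra_simps)
      hence "(g ^^ l) a = (g ^^ h) a" unfolding pow_eq_iff by simp
      thus ?thesis using ev h by simp
    qed
    have kk: "(g ^^ (k + k)) a = a"
    proof -
      have "y (y a) = (g ^^ k) ((g ^^ k) a)" using k
      proof
        assume 1: "y a = (g ^^ k) a"
        show ?thesis using yp[of k] 1 by simp
      next
        assume 1: "y a = - (g ^^ k) a"
        have "y (- (g ^^ k) a) = (g ^^ k) (- y a)" using commuting_pow[OF y, of k "- a"] yy(3) by (simp add: pow_odd)
        thus ?thesis using 1 by simp
      qed
      thus ?thesis using yy by (simp add: pow_add)
    qed
    have nk: "(g ^^ k) a \<noteq> a" using k 3 yy by auto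
    note hk = half[OF kk nk]
    have "(g ^^ j) a \<noteq> - a" for j
    proof
      assume j: "(g ^^ j) a = - a"
      have "(g ^^ (j + j)) a = a" unfolding pow_add j by (simp add: pow_odd j)
      moreover have "(g ^^ j) a \<noteq> a" using j a(1) by simp
      ultimately have "(g ^^ j) a = (g ^^ k) a" using half[of j] hk by simp
      thus False using j k 3 yy by auto
    qed
    thus ?thesis using hk k by auto
  qed
  thus "even (p a)" "(g ^^ k) a \<noteq> - a"
    "y a = a \<or> y a = 0 \<or> y a = (g ^^ (p a div 2)) a \<or> y a = - (g ^^ (p a div 2)) a" by auto
qed

section \<open>The sign-reversing involution\<close>

definition irregulars :: "(int \<Rightarrow> int) set" where
  "irregulars = {y \<in> commuting. \<exists>a. a \<noteq> 0 \<and> \<not> regular y a}"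

text \<open>The class at which \<open>toggle\<close> acts must be selected by a rule that the change
  does not disturb. The least positive irregular point qualifies, since toggling preserves
  regularity at every nonzero point.\<close>

definition pivot :: "(int \<Rightarrow> int) \<Rightarrow> int" where
  "pivot y = int (LEAST m. m \<noteq> 0 \<and> \<not> regular y (int m))"

definition orb :: "int \<Rightarrow> int \<Rightarrow> bool" where "orb a c \<longleftrightarrow> (\<exists>k. c = (g ^^ k) a)"

definition half :: "int \<Rightarrow> int \<Rightarrow> int" where "half a = g ^^ (p a div 2)"

text \<open>Together with \<open>rot_state\<close> this lists the four forms y can take on the two
  even cycles through a and - a: the identity with the cycle of a (\<epsilon>) or of - a (not
  \<epsilon>) chosen, and plus or minus the half rotation. Toggling keeps \<epsilon> and so matches
  the four forms in two pairs.\<close>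

definition fixed_state :: "int \<Rightarrow> bool \<Rightarrow> (int \<Rightarrow> int) \<Rightarrow> bool" where
  "fixed_state a \<epsilon> y \<longleftrightarrow> (\<forall>c. mu c = mu a \<longrightarrow> y c = (if orb a c = \<epsilon> then c else 0))"

definition rot_state :: "int \<Rightarrow> bool \<Rightarrow> (int \<Rightarrow> int) \<Rightarrow> bool" where
  "rot_state a \<epsilon> y \<longleftrightarrow> (\<forall>c. mu c = mu a \<longrightarrow> y c = (if \<epsilon> then half a c else - half a c))"

definition toggle :: "(int \<Rightarrow> int) \<Rightarrow> int \<Rightarrow> int" where
  "toggle y c = (let a = pivot y in
     if mu c \<noteq> mu a then y c
     else if y a = a then half a c else if y a = 0 then - half a c
     else if orb a c = (y a = half a a) then c else 0)"

text \<open>Irregular points come in pairs a, - a, so that a positive one is available for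
  \<open>pivot\<close>.\<close>

lemma regular_minus:
  assumes y: "y \<in> commuting"
  shows "regular y (- a) \<longleftrightarrow> regular y a"
proof (cases "a = 0")
  case False
  have yh: "y \<in> half_involutions b n" using y by (simp add: commuting_def)
  note Y = half_involutions_D[OF yh]
  consider "y a = a" | "y a = 0" | "y a \<noteq> a" "y a \<noteq> 0" by blast
  thus ?thesis
  proof cases
    case 1
    thus ?thesis using Y(4)[OF False 1] by (simp add: regular_def p_minus)
  next
    case 2
    thus ?thesis using Y(5)[OF False 2] by (simp add: regular_def p_minus)
  next
    case 3
    thus ?thesis using Y(6)[OF 3(2,1)] by (simp add: regular_def p_minus)
  qed
qed simp

lemma pivot:
  assumes y: "y \<in> irregulars"
  shows "pivot y > 0" "\<not> regular y (pivot y)"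
proof -
  have yc: "y \<in> commuting" using y by (simp add: irregulars_def)
  obtain a where a: "a \<noteq> 0" "\<not> regular y a" using y by (auto simp: irregulars_def)
  have "nat \<bar>a\<bar> \<noteq> 0 \<and> \<not> regular y (int (nat \<bar>a\<bar>))"
    using a regular_minus[OF yc, of a] by (cases "a \<ge> 0") auto
  from LeastI[of "\<lambda>m. m \<noteq> 0 \<and> \<not> regular y (int m)", OF this]
  show "pivot y > 0" "\<not> regular y (pivot y)" unfolding pivot_def by auto
qed

lemma orb_g: "orb a (g c) \<longleftrightarrow> orb a c"
proof
  assume "orb a c"
  then obtain k where "c = (g ^^ k) a" by (auto simp: orb_def)
  hence "g c = (g ^^ Suc k) a" by simp
  thus "orb a (g c)" unfolding orb_def by blast
next
  assume "orb a (g c)"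
  then obtain k where k: "g c = (g ^^ k) a" by (auto simp: orb_def)
  obtain l where l: "\<And>a. (g ^^ l) ((g ^^ 1) a) = a" using pow_inverse by blast
  have "c = (g ^^ l) (g c)" using l[of c] by simp
  hence "c = (g ^^ (l + k)) a" unfolding k pow_add .
  thus "orb a c" unfolding orb_def by blast
qed

lemma half_basic: "half a (- c) = - half a c" "mu (half a c) = mu c" "half a c = 0 \<longleftrightarrow> c = 0"
    "half a (g c) = g (half a c)"
  unfolding half_def by (simp_all only: pow_odd mu_pow pow_zero pow_g)

lemma even_orbit:
  assumes a: "a \<noteq> 0" "even (p a)" "\<And>k. (g ^^ k) a \<noteq> - a" and c: "mu c = mu a"
  shows "p c = p a" "c \<noteq> 0" "half a (half a c) = c" "half a c \<noteq> c" "half a c \<noteq> - c"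
    "orb a (- c) \<longleftrightarrow> \<not> orb a c" "\<bar>c\<bar> \<le> int n"
proof -
  obtain k where k: "c = (g ^^ k) a \<or> c = - (g ^^ k) a" using mu_eq_iff[of a c] c by auto
  show pc: "p c = p a" using k by (auto simp: p_minus p_pow)
  show c0: "c \<noteq> 0" using k a(1) pow_zero by auto
  have "p a div 2 + p a div 2 = p a" using a(2) by auto
  hence "half a (half a c) = (g ^^ p c) c" unfolding half_def pow_add[symmetric] pc by simp
  thus "half a (half a c) = c" by (simp only: pow_p)
  have "\<not> p a dvd p a div 2"
  proof
    assume "p a dvd p a div 2"
    moreover have "p a div 2 > 0" "p a div 2 < p a" using a(2) p_pos[of a] by auto
    ultimately show False using dvd_imp_le[of "p a" "p a div 2"] by linarith
  qed
  hence ne: "(g ^^ (p a div 2)) c \<noteq> c" unfolding pow_fix_iff pc .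
  thus "half a c \<noteq> c" unfolding half_def .
  show "half a c \<noteq> - c"
  proof
    assume "half a c = - c"
    hence "half a ((g ^^ k) a) = - (g ^^ k) a" using k half_basic(1)[of a "(g ^^ k) a"] by auto
    hence "(g ^^ k) ((g ^^ (p a div 2)) a) = (g ^^ k) (- a)"
      unfolding half_def pow_odd using pow_comm[of k "p a div 2" a] by simp
    hence "(g ^^ (p a div 2)) a = - a" by (simp only: pow_inj)
    thus False using a(3) by blast
  qed
  have excl: "\<not> (orb a d \<and> orb a (- d))" for d
  proof
    assume "orb a d \<and> orb a (- d)"
    then obtain i j where ij: "d = (g ^^ i) a" "- d = (g ^^ j) a" by (auto simp: orb_def)
    obtain l where l: "\<And>a. (g ^^ l) ((g ^^ i) a) = a" using pow_inverse by blast
    have "(g ^^ (l + j)) a = (g ^^ l) (- d)" unfolding pow_add ij(2) ..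
    also have "\<dots> = - a" using l ij(1) by (simp add: pow_odd)
    finally show False using a(3) by blast
  qed
  have "orb a c \<or> orb a (- c)" using k by (auto simp: orb_def)
  thus "orb a (- c) \<longleftrightarrow> \<not> orb a c" using excl by blast
  show "\<bar>c\<bar> \<le> int n"
  proof (rule ccontr)
    assume "\<not> \<bar>c\<bar> \<le> int n"
    hence "odd (p c)" using outside(3)[of c] by simp
    thus False using pc a(2) by simp
  qed
qed

lemma swap_state_commuting:
  assumes y: "y \<in> commuting" and a: "a > 0" "even (p a)" "\<And>k. (g ^^ k) a \<noteq> - a"
    and off: "\<And>c. mu c \<noteq> mu a \<Longrightarrow> y' c = y c"
    and st: "fixed_state a \<epsilon> y \<and> rot_state a \<epsilon> y' \<or> rot_state a \<epsilon> y \<and> fixed_state a \<epsilon> y'"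
  shows "y' \<in> commuting" "c \<noteq> 0 \<Longrightarrow> regular y' c \<longleftrightarrow> regular y c"
proof -
  have a0: "a \<noteq> 0" using a by simp
  note O = even_orbit[OF a0 a(2,3)]
  have yh: "y \<in> half_involutions b n" and yg: "\<And>c. y (g c) = g (y c)" using y by (auto simp: commuting_def)
  note Y = half_involutions_D[OF yh]
  have on: "mu (z c) = mu a \<or> z c = 0" if "fixed_state a \<epsilon> z \<or> rot_state a \<epsilon> z" "mu c = mu a" for z c
    using that half_basic by (auto simp: fixed_state_def rot_state_def)
  have st': "fixed_state a \<epsilon> y' \<or> rot_state a \<epsilon> y'" "fixed_state a \<epsilon> y \<or> rot_state a \<epsilon> y" using st by auto
  \<comment> \<open>From outside, y cannot lead into the modified class: it would have to map the
    image back, yet on the class y never leaves it except to 0. Hence outside the class the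
    conditions on y' are those on y.\<close>
  have ynotin: "mu (y c) \<noteq> mu a" if "mu c \<noteq> mu a" for c
  proof
    assume m: "mu (y c) = mu a"
    have y0: "y c \<noteq> 0" using m a0 mu_zero_iff by metis
    have "y c \<noteq> c" using m that by auto
    hence "y (y c) = c" using Y(6)[OF y0] by blast
    hence "mu c = mu a \<or> c = 0" using on[OF st'(2) m] by simp
    hence "c = 0" using that by simp
    thus False using y0 Y(1) by simp
  qed
  have com: "y' (g c) = g (y' c)" for c
  proof (cases "mu c = mu a")
    case True
    thus ?thesis using st' g_zero[of 0]
      by (auto simp: fixed_state_def rot_state_def orb_g half_basic g_odd)
  next
    case False
    thus ?thesis using off[of c] off[of "g c"] yg by simp
  qed
  have "y' \<in> half_involutions b n"
  proof (rule half_involutions_I)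
    show "y' 0 = 0" using off[of 0] Y(1) a0 mu_zero_iff by metis
    show "y' i = (if i > 0 then i else 0)" if i: "\<bar>i\<bar> > int n" for i
    proof -
      have "mu i \<noteq> mu a" using O(7)[of i] i by auto
      thus ?thesis using off[of i] Y(2)[OF i] by simp
    qed
    show "y' i > 0" if bi: "b" "i > 0" for i
    proof (cases "mu i = mu a")
      case True
      have ha: "half a c > 0" if "c > 0" for c unfolding half_def by (rule pow_pos[OF bi(1) that])
      \<comment> \<open>If positive points must have positive values, the states with \<epsilon>
        false are impossible: they send a > 0 to 0 or to a negative point.\<close>
      have "orb a a" unfolding orb_def by (rule exI[of _ 0]) simp
      hence "\<epsilon>" using st'(2) Y(3)[OF bi(1) a(1)] ha[OF a(1)]
        by (auto simp: fixed_state_def rot_state_def split: if_splits)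
      moreover have "orb a i"
      proof -
        obtain k where "i = (g ^^ k) a \<or> i = - (g ^^ k) a" using mu_eq_iff[of a i] True by auto
        thus ?thesis using pow_pos[OF bi(1) a(1), of k] bi by (auto simp: orb_def)
      qed
      ultimately show ?thesis using st'(1) True ha[OF bi(2)] bi by (auto simp: fixed_state_def rot_state_def)
    next
      case False
      thus ?thesis using off Y(3)[OF bi] by simp
    qed
    fix i :: int assume i: "i \<noteq> 0"
    show "(y' i = i \<and> y' (- i) = 0) \<or> (y' i = 0 \<and> y' (- i) = - i)
           \<or> (y' i \<noteq> 0 \<and> y' i \<noteq> i \<and> y' i \<noteq> - i \<and> y' (y' i) = i \<and> y' (- i) = - y' i)"
    proof (cases "mu i = mu a")
      case True
      note Oi = O[OF True]
      have m: "mu (- i) = mu a" "mu (half a i) = mu a" "mu (- half a i) = mu a" using True half_basic by simp_all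
      from st'(1) show ?thesis
      proof
        assume "fixed_state a \<epsilon> y'"
        hence "y' i = (if orb a i = \<epsilon> then i else 0)" "y' (- i) = (if orb a (- i) = \<epsilon> then - i else 0)"
          using True m unfolding fixed_state_def by blast+
        thus ?thesis using Oi(6) by auto
      next
        assume r: "rot_state a \<epsilon> y'"
        hence 1: "y' i = (if \<epsilon> then half a i else - half a i)" "y' (- i) = (if \<epsilon> then half a (- i) else - half a (- i))"
          "y' (half a i) = (if \<epsilon> then half a (half a i) else - half a (half a i))"
          "y' (- half a i) = (if \<epsilon> then half a (- half a i) else - half a (- half a i))"
          using True m unfolding rot_state_def by blast+
        thus ?thesis using Oi(3-5) half_basic(1,3) i by (cases \<epsilon>) auto
      qed
    next
      case False
      have "y' i = y i" "y' (- i) = y (- i)" "y' (y i) = y (y i)" using off[of i] off[of "- i"] off[of "y i"] False ynotin[OF False] by auto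
      thus ?thesis using Y(4,5,6)[of i] i by metis
    qed
  qed
  thus "y' \<in> commuting" using com by (simp add: commuting_def)
  show "regular y' c \<longleftrightarrow> regular y c" if "c \<noteq> 0"
  proof (cases "mu c = mu a")
    case True
    have "\<not> regular z c" if "fixed_state a \<epsilon> z \<or> rot_state a \<epsilon> z" for z
      using on[OF that True] True O(1)[OF True] a(2) by (auto simp: regular_def)
    thus ?thesis using st' by blast
  next
    case False
    thus ?thesis using off[OF False] by (simp add: regular_def)
  qed
qed

text \<open>The fixed points of y are those of y' and in addition one cycle of even length, on which
  g has sign -1.\<close>

lemma wt_swap_state:
  assumes y: "y \<in> commuting" "y' \<in> commuting" and a: "a \<noteq> 0" "even (p a)" "\<And>k. (g ^^ k) a \<noteq> - a"
    and off: "\<And>c. mu c \<noteq> mu a \<Longrightarrow> y' c = y c"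
    and st: "fixed_state a \<epsilon> y" "rot_state a \<epsilon> y'"
  shows "wt y = - wt y'"
proof -
  note O = even_orbit[OF a]
  \<comment> \<open>A representative of the chosen cycle, which is that of a or of - a according to
    \<epsilon>.\<close>
  define a' where "a' = (if \<epsilon> then a else - a)"
  have ev: "even (p a')" by (simp add: a'_def p_minus a(2))
  have mem: "mu c = mu a \<and> orb a c = \<epsilon> \<longleftrightarrow> orb a' c" for c
  proof (cases \<epsilon>)
    case True
    thus ?thesis unfolding a'_def orb_def by auto
  next
    case False
    have "c = - d \<longleftrightarrow> - c = d" for d by auto
    hence "orb a' c \<longleftrightarrow> orb a (- c)" using False by (simp add: orb_def a'_def pow_odd)
    moreover have "mu c = mu a" if o: "orb a (- c)"
    proof -
      obtain k where "- c = (g ^^ k) a" using o unfolding orb_def by blast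
      hence "mu (- c) = mu a" by simp
      thus ?thesis by simp
    qed
    ultimately show ?thesis using False O(6)[of c] by auto
  qed
  have nfix: "y' i \<noteq> i" if "mu i = mu a" for i
  proof -
    have "y' i = (if \<epsilon> then half a i else - half a i)" using st(2) that unfolding rot_state_def by blast
    thus ?thesis using O(4,5)[OF that] by auto
  qed
  have Fix: "{i. y i = i} = {i. y' i = i} \<union> {i. orb a' i}"
  proof (rule Set.set_eqI)
    fix i
    show "i \<in> {i. y i = i} \<longleftrightarrow> i \<in> {i. y' i = i} \<union> {i. orb a' i}"
    proof (cases "mu i = mu a")
      case True
      have "y i = (if orb a i = \<epsilon> then i else 0)" using st(1) True unfolding fixed_state_def by blast
      hence "y i = i \<longleftrightarrow> orb a i = \<epsilon>" using O(2)[OF True] by auto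
      thus ?thesis using mem[of i] True nfix[OF True] by blast
    next
      case False
      thus ?thesis using off[OF False] mem[of i] by auto
    qed
  qed
  have disj: "{i. y' i = i} \<inter> {i. orb a' i} = {}"
    using nfix mem by blast
  have "sign (restr {i. orb a' i} g) = (-1) ^ (p a' - 1)" unfolding orb_def by (rule sign_orbit)
  also have "\<dots> = -1" using ev p_pos[of a'] by simp
  finally have s: "sign (restr {i. orb a' i} g) = -1" .
  have "wt y = sign (restr {i. y' i = i} g) * sign (restr {i. orb a' i} g)"
    unfolding wt_def Fix
  proof (rule sign_restr_Un[OF g_permutation _ _ disj])
    show "g i \<in> {i. y' i = i} \<longleftrightarrow> i \<in> {i. y' i = i}" for i using y(2) g_inj by (simp add: commuting_def)
    show "g i \<in> {i. orb a' i} \<longleftrightarrow> i \<in> {i. orb a' i}" for i using orb_g by simp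
  qed
  thus ?thesis unfolding s wt_def by simp
qed

text \<open>The value at a determines everything: commutation with g propagates it along the cycle
  of a, and the conditions relating y i and y (- i) carry it over to the cycle of - a.\<close>

lemma irregular_states:
  assumes y: "y \<in> irregulars" and a: "a = pivot y"
  shows "a > 0" "even (p a)" "(g ^^ k) a \<noteq> - a" "\<exists>\<epsilon>. fixed_state a \<epsilon> y \<or> rot_state a \<epsilon> y"
proof -
  have yc: "y \<in> commuting" using y by (simp add: irregulars_def)
  hence yh: "y \<in> half_involutions b n" by (simp add: commuting_def)
  note Y = half_involutions_D[OF yh]
  show ap: "a > 0" using pivot(1)[OF y] a by simp
  hence a0: "a \<noteq> 0" by simp
  have ir: "\<not> regular y a" using pivot(2)[OF y] a by simp
  note I = irregular_cases[OF yc a0 ir]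
  show ev: "even (p a)" by (rule I(1))
  show nn: "(g ^^ k) a \<noteq> - a" for k by (rule I(2))
  note O = even_orbit[OF a0 ev nn]
  have yp: "y ((g ^^ k) a) = (g ^^ k) (y a)" for k by (rule commuting_pow[OF yc])
  have C: "\<exists>k. c = (g ^^ k) a \<or> c = - (g ^^ k) a" if "mu c = mu a" for c using mu_eq_iff[of a c] that by auto
  have orbp: "orb a ((g ^^ k) a)" for k unfolding orb_def by blast
  have orbm: "\<not> orb a (- (g ^^ k) a)" for k using O(6)[of "(g ^^ k) a"] orbp[of k] by simp
  have pz: "(g ^^ k) a \<noteq> 0" for k using a0 pow_zero by simp
  consider "y a = a" | "y a = 0" | "y a = half a a" | "y a = - half a a" using I(3) unfolding half_def by blast
  thus "\<exists>\<epsilon>. fixed_state a \<epsilon> y \<or> rot_state a \<epsilon> y"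
  proof cases
    case 1
    have "fixed_state a True y" unfolding fixed_state_def
    proof (intro allI impI)
      fix c assume "mu c = mu a"
      then obtain k where "c = (g ^^ k) a \<or> c = - (g ^^ k) a" using C by blast
      thus "y c = (if orb a c = True then c else 0)"
        using yp[of k] 1 orbp[of k] orbm[of k] Y(4)[OF pz[of k]] by auto
    qed
    thus ?thesis by blast
  next
    case 2
    have "fixed_state a False y" unfolding fixed_state_def
    proof (intro allI impI)
      fix c assume "mu c = mu a"
      then obtain k where "c = (g ^^ k) a \<or> c = - (g ^^ k) a" using C by blast
      thus "y c = (if orb a c = False then c else 0)"
        using yp[of k] 2 orbp[of k] orbm[of k] Y(5)[OF pz[of k]] by auto
    qed
    thus ?thesis by blast
  next
    case 3
    have yk: "y ((g ^^ k) a) = half a ((g ^^ k) a)" for k using yp[of k] 3 by (simp add: half_def pow_comm)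
    have "rot_state a True y" unfolding rot_state_def
    proof (intro allI impI)
      fix c assume "mu c = mu a"
      then obtain k where k: "c = (g ^^ k) a \<or> c = - (g ^^ k) a" using C by blast
      have "y (- (g ^^ k) a) = - y ((g ^^ k) a)"
        using Y(6)[of "(g ^^ k) a"] yk[of k] O(4)[of "(g ^^ k) a"] half_basic(3) pz[of k] by simp
      thus "y c = (if True then half a c else - half a c)" using k yk[of k] half_basic(1) by auto
    qed
    thus ?thesis by blast
  next
    case 4
    have yk: "y ((g ^^ k) a) = - half a ((g ^^ k) a)" for k
      using yp[of k] 4 by (simp add: half_def pow_comm[of k] pow_odd)
    have "rot_state a False y" unfolding rot_state_def
    proof (intro allI impI)
      fix c assume "mu c = mu a"
      then obtain k where k: "c = (g ^^ k) a \<or> c = - (g ^^ k) a" using C by blast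
      have "- half a ((g ^^ k) a) \<noteq> (g ^^ k) a" using O(5)[of "(g ^^ k) a"] by (metis mu_pow minus_minus)
      hence "y (- (g ^^ k) a) = - y ((g ^^ k) a)"
        using Y(6)[of "(g ^^ k) a"] yk[of k] half_basic(3) pz[of k] by simp
      thus "y c = (if False then half a c else - half a c)" using k yk[of k] half_basic(1) by auto
    qed
    thus ?thesis by blast
  qed
qed

lemma toggle_states:
  assumes a: "a = pivot y" "a \<noteq> 0" "even (p a)" "\<And>k. (g ^^ k) a \<noteq> - a"
  shows "mu c \<noteq> mu a \<Longrightarrow> toggle y c = y c"
    "fixed_state a \<epsilon> y \<Longrightarrow> rot_state a \<epsilon> (toggle y)"
    "rot_state a \<epsilon> y \<Longrightarrow> fixed_state a \<epsilon> (toggle y)"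
proof -
  note O = even_orbit[OF a(2-4)]
  have oa: "orb a a" unfolding orb_def by (rule exI[of _ 0]) simp
  show "mu c \<noteq> mu a \<Longrightarrow> toggle y c = y c" by (simp add: toggle_def a(1)[symmetric] Let_def)
  {
    assume "fixed_state a \<epsilon> y"
    hence "y a = (if \<epsilon> then a else 0)" using oa by (auto simp: fixed_state_def)
    thus "rot_state a \<epsilon> (toggle y)" using a(2) by (auto simp: rot_state_def toggle_def a(1)[symmetric] Let_def)
  next
    assume "rot_state a \<epsilon> y"
    hence ya: "y a = (if \<epsilon> then half a a else - half a a)" by (simp add: rot_state_def)
    have ne: "half a a \<noteq> 0" "half a a \<noteq> a" "- half a a \<noteq> a" using a(2) half_basic(3) O(4,5)[of a] by auto
    have "y a \<noteq> a" "y a \<noteq> 0" "(y a = half a a) = \<epsilon>" using ya ne by auto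
    thus "fixed_state a \<epsilon> (toggle y)" by (auto simp: fixed_state_def toggle_def a(1)[symmetric] Let_def)
  }
qed

lemma toggle:
  assumes y: "y \<in> irregulars"
  shows "toggle y \<in> irregulars" "toggle (toggle y) = y" "wt (toggle y) = - wt y"
proof -
  define a where "a = pivot y"
  have yc: "y \<in> commuting" using y by (simp add: irregulars_def)
  note I = irregular_states[OF y a_def]
  have a0: "a \<noteq> 0" using I(1) by simp
  obtain \<epsilon> where \<epsilon>: "fixed_state a \<epsilon> y \<or> rot_state a \<epsilon> y" using I(4) by blast
  note T = toggle_states[OF a_def a0 I(2,3)]
  have st: "fixed_state a \<epsilon> y \<and> rot_state a \<epsilon> (toggle y) \<or> rot_state a \<epsilon> y \<and> fixed_state a \<epsilon> (toggle y)"
    using \<epsilon> T(2,3) by blast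
  note S = swap_state_commuting[OF yc I(1,2,3) T(1) st]
  have tc: "toggle y \<in> commuting" by (rule S(1))
  have rg: "regular (toggle y) c \<longleftrightarrow> regular y c" if "c \<noteq> 0" for c using S(2)[OF _ that] by simp
  show ty: "toggle y \<in> irregulars" using y tc rg unfolding irregulars_def by auto
  \<comment> \<open>Regularity is the same before and after, so the second toggle acts at the same
    pivot.\<close>
  have "(m \<noteq> 0 \<and> \<not> regular (toggle y) (int m)) \<longleftrightarrow> (m \<noteq> 0 \<and> \<not> regular y (int m))" for m
    using rg[of "int m"] by auto
  hence piv: "a = pivot (toggle y)" by (simp add: a_def pivot_def)
  note T' = toggle_states[OF piv a0 I(2,3)]
  show "toggle (toggle y) = y"
  proof
    fix c
    show "toggle (toggle y) c = y c"
    proof (cases "mu c = mu a")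
      case True
      have "fixed_state a \<epsilon> y \<and> fixed_state a \<epsilon> (toggle (toggle y)) \<or> rot_state a \<epsilon> y \<and> rot_state a \<epsilon> (toggle (toggle y))"
        using st T'(2,3) by blast
      thus ?thesis using True unfolding fixed_state_def rot_state_def by metis
    qed (use T(1) T'(1) in simp)
  qed
  show "wt (toggle y) = - wt y" using st
  proof
    assume "fixed_state a \<epsilon> y \<and> rot_state a \<epsilon> (toggle y)"
    hence "wt y = - wt (toggle y)" using wt_swap_state[OF yc tc a0 I(2,3) T(1)] by blast
    thus ?thesis by simp
  next
    assume "rot_state a \<epsilon> y \<and> fixed_state a \<epsilon> (toggle y)"
    thus ?thesis using wt_swap_state[OF tc yc a0 I(2,3) T(1)[symmetric]] by blast
  qed
qed

theorem sum_wt_eq_card_roots: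
  assumes "finite commuting"
  shows "(\<Sum>y\<in>commuting. wt y) = int (card roots)"
proof -
  have split: "commuting = regulars \<union> irregulars" "regulars \<inter> irregulars = {}"
    by (auto simp: regulars_def irregulars_def)
  have fin: "finite regulars" "finite irregulars" using assms split by auto
  have "(\<Sum>y\<in>irregulars. wt y) = (\<Sum>y\<in>irregulars. wt (toggle y))"
    by (rule sum.reindex_bij_witness[of _ toggle toggle]) (auto simp: toggle)
  also have "\<dots> = - (\<Sum>y\<in>irregulars. wt y)" by (simp add: toggle(3) sum_negf)
  finally have "(\<Sum>y\<in>irregulars. wt y) = 0" by simp
  moreover have "(\<Sum>y\<in>regulars. wt y) = int (card regulars)" by (simp add: wt_regular)
  ultimately show ?thesis using sum.union_disjoint[OF fin split(2), of wt] split(1) card_regulars by simp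
qed

section \<open>Conjugacy of every element to its inverse\<close>

lemma pow_undo: "(g ^^ (k * (e - 1))) ((g ^^ k) a) = a"
proof -
  have "(g ^^ (k * e)) a = a" by (induction k) (simp_all add: pow_add pow_e del: funpow.simps)
  moreover have "k * (e - 1) + k = k * e" using e_pos by (simp add: algebra_simps)
  ultimately show ?thesis unfolding pow_add[symmetric] by simp
qed

text \<open>The reversal sends \<open>\<plusminus> g\<^sup>k m\<close> to \<open>\<plusminus> g\<^sup>-\<^sup>k m\<close>, where \<open>m\<close> is the least absolute value in the orbit; the
  exponent \<open>-k\<close> appears as \<open>k (e - 1)\<close> because \<open>g\<^sup>e = 1\<close>.\<close>

definition reversal_rel :: "int \<Rightarrow> int \<Rightarrow> bool" where
  "reversal_rel a c \<longleftrightarrow> (\<exists>k. (a = (g ^^ k) (int (mu a)) \<and> c = (g ^^ (k * (e - 1))) (int (mu a)))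
     \<or> (a = - (g ^^ k) (int (mu a)) \<and> c = - (g ^^ (k * (e - 1))) (int (mu a))))"

lemma mu_mu: "mu (int (mu a)) = mu a"
proof -
  obtain k where k: "\<bar>(g ^^ k) a\<bar> = int (mu a)" using mu_attained by blast
  hence "int (mu a) = (g ^^ k) a \<or> int (mu a) = - (g ^^ k) a" by linarith
  thus ?thesis by (metis mu_minus mu_pow)
qed

lemma reversal_ex: "\<exists>c. reversal_rel a c"
proof -
  obtain k where "a = (g ^^ k) (int (mu a)) \<or> a = - (g ^^ k) (int (mu a))"
    using mu_eq_iff[of "int (mu a)" a] mu_mu by auto
  thus ?thesis unfolding reversal_rel_def by blast
qed

text \<open>A point is g^k m for many k, and on a cycle meeting its negative it is also - g^l m. All
  these descriptions must lead to the same image.\<close>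

lemma reversal_unique:
  assumes "reversal_rel a c" "reversal_rel a d"
  shows "c = d"
proof -
  define m where "m = int (mu a)"
  \<comment> \<open>Inverting both powers preserves an equality up to sign; s records the
    sign.\<close>
  have key: "(g ^^ (k * (e - 1))) m = (if s then (g ^^ (l * (e - 1))) m else - (g ^^ (l * (e - 1))) m)"
    if "(g ^^ k) m = (if s then (g ^^ l) m else - (g ^^ l) m)" for k l s
  proof -
    have "(g ^^ (l * (e - 1))) ((g ^^ (k * (e - 1))) ((g ^^ k) m)) = (g ^^ (l * (e - 1))) m"
      by (simp only: pow_undo)
    moreover have "(g ^^ (l * (e - 1))) ((g ^^ (k * (e - 1))) ((g ^^ l) m)) = (g ^^ (k * (e - 1))) m"
      unfolding pow_comm[of "l * (e - 1)" "k * (e - 1)"] by (simp only: pow_undo)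
    ultimately show ?thesis using that by (cases s) (auto simp: pow_odd)
  qed
  obtain k where k: "(a = (g ^^ k) m \<and> c = (g ^^ (k * (e - 1))) m) \<or> (a = - (g ^^ k) m \<and> c = - (g ^^ (k * (e - 1))) m)"
    using assms(1) unfolding reversal_rel_def m_def by blast
  obtain l where l: "(a = (g ^^ l) m \<and> d = (g ^^ (l * (e - 1))) m) \<or> (a = - (g ^^ l) m \<and> d = - (g ^^ (l * (e - 1))) m)"
    using assms(2) unfolding reversal_rel_def m_def by blast
  have key1: "(g ^^ k) m = (g ^^ l) m \<Longrightarrow> (g ^^ (k * (e - 1))) m = (g ^^ (l * (e - 1))) m" using key[of k True l] by simp
  have key2: "(g ^^ k) m = - (g ^^ l) m \<Longrightarrow> (g ^^ (k * (e - 1))) m = - (g ^^ (l * (e - 1))) m" using key[of k False l] by simp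
  from k l show ?thesis
  proof (elim disjE conjE)
    assume "a = (g ^^ k) m" "c = (g ^^ (k * (e - 1))) m" "a = (g ^^ l) m" "d = (g ^^ (l * (e - 1))) m"
    thus ?thesis using key1 by simp
  next
    assume "a = (g ^^ k) m" "c = (g ^^ (k * (e - 1))) m" "a = - (g ^^ l) m" "d = - (g ^^ (l * (e - 1))) m"
    thus ?thesis using key2 by simp
  next
    assume "a = - (g ^^ k) m" "c = - (g ^^ (k * (e - 1))) m" "a = (g ^^ l) m" "d = (g ^^ (l * (e - 1))) m"
    moreover from this have "(g ^^ k) m = - (g ^^ l) m" by linarith
    ultimately show ?thesis using key2 by linarith
  next
    assume "a = - (g ^^ k) m" "c = - (g ^^ (k * (e - 1))) m" "a = - (g ^^ l) m" "d = - (g ^^ (l * (e - 1))) m"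
    moreover from this have "(g ^^ k) m = (g ^^ l) m" by linarith
    ultimately show ?thesis using key1 by linarith
  qed
qed

definition reversal :: "int \<Rightarrow> int" where "reversal a = (SOME c. reversal_rel a c)"

lemma reversal_eqI: "reversal_rel a c \<Longrightarrow> reversal a = c"
  using reversal_unique someI[of "reversal_rel a" c] unfolding reversal_def by blast

lemma reversal_rel: "reversal_rel a (reversal a)"
  unfolding reversal_def using someI_ex[OF reversal_ex] .

lemma reversal_odd: "reversal (- a) = - reversal a"
proof (rule reversal_eqI)
  obtain k where "(a = (g ^^ k) (int (mu a)) \<and> reversal a = (g ^^ (k * (e - 1))) (int (mu a)))
     \<or> (a = - (g ^^ k) (int (mu a)) \<and> reversal a = - (g ^^ (k * (e - 1))) (int (mu a)))"
    using reversal_rel[of a] unfolding reversal_rel_def by blast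
  hence "(- a = (g ^^ k) (int (mu a)) \<and> - reversal a = (g ^^ (k * (e - 1))) (int (mu a)))
     \<or> (- a = - (g ^^ k) (int (mu a)) \<and> - reversal a = - (g ^^ (k * (e - 1))) (int (mu a)))"
    by linarith
  thus "reversal_rel (- a) (- reversal a)" unfolding reversal_rel_def mu_minus by blast
qed

lemma reversal_pow: "reversal ((g ^^ k) (int (mu a))) = (g ^^ (k * (e - 1))) (int (mu a))"
  by (rule reversal_eqI) (auto simp: reversal_rel_def mu_mu)

lemma reversal_cases:
  obtains k where "a = (g ^^ k) (int (mu a))" | k where "a = - (g ^^ k) (int (mu a))"
  using reversal_rel[of a] unfolding reversal_rel_def by blast

lemma reversal_involution: "reversal (reversal a) = a"
proof -
  have *: "reversal (reversal ((g ^^ k) (int (mu a)))) = (g ^^ k) (int (mu a))" for k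
  proof -
    have "(g ^^ (k * (e - 1) * (e - 1))) (int (mu a)) = (g ^^ (k * (e - 1) * (e - 1))) ((g ^^ (k * (e - 1))) ((g ^^ k) (int (mu a))))"
      by (simp only: pow_undo)
    also have "\<dots> = (g ^^ k) (int (mu a))" by (rule pow_undo)
    finally show ?thesis by (simp only: reversal_pow)
  qed
  show ?thesis
  proof (cases a rule: reversal_cases)
    case (1 k)
    thus ?thesis using *[of k] by simp
  next
    case (2 k)
    hence "- a = (g ^^ k) (int (mu a))" by simp
    hence "reversal (reversal (- a)) = - a" using *[of k] by simp
    thus ?thesis by (simp add: reversal_odd)
  qed
qed

lemma reversal_g: "reversal (g a) = (g ^^ (e - 1)) (reversal a)"
proof -
  have *: "reversal (g ((g ^^ k) (int (mu a)))) = (g ^^ (e - 1)) (reversal ((g ^^ k) (int (mu a))))" for k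
    using reversal_pow[of "Suc k" a] reversal_pow[of k a] by (simp add: pow_add)
  show ?thesis
  proof (cases a rule: reversal_cases)
    case (1 k)
    thus ?thesis using *[of k] by simp
  next
    case (2 k)
    hence "- a = (g ^^ k) (int (mu a))" by simp
    hence "reversal (g (- a)) = (g ^^ (e - 1)) (reversal (- a))" using *[of k] by simp
    thus ?thesis by (simp add: reversal_odd g_odd pow_odd)
  qed
qed

lemma reversal_mem: "reversal \<in> signed_perms b n"
proof -
  have "bij reversal" by (rule o_bij[of reversal]) (auto simp: fun_eq_iff reversal_involution)
  moreover have "reversal a = a" if a: "\<bar>a\<bar> > int n" for a
  proof -
    have m: "int (mu a) = \<bar>a\<bar>" using outside(2)[OF a] by simp
    hence "\<bar>int (mu a)\<bar> > int n" using a by simp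
    hence "(g ^^ k) (int (mu a)) = int (mu a)" for k using pow_fix by blast
    hence "reversal a = int (mu a) \<and> a = int (mu a) \<or> reversal a = - int (mu a) \<and> a = - int (mu a)"
      using reversal_rel[of a] unfolding reversal_rel_def by auto
    thus ?thesis by auto
  qed
  moreover have "reversal a > 0" if a: "b" "a > 0" for a
  proof -
    have "int (mu a) > 0" using a by (metis mu_zero_iff of_nat_0_less_iff gr0I less_irrefl)
    hence pos: "(g ^^ k) (int (mu a)) > 0" for k using pow_pos[OF a(1)] by blast
    obtain k where "(a = (g ^^ k) (int (mu a)) \<and> reversal a = (g ^^ (k * (e - 1))) (int (mu a)))
       \<or> (a = - (g ^^ k) (int (mu a)) \<and> reversal a = - (g ^^ (k * (e - 1))) (int (mu a)))"
      using reversal_rel[of a] unfolding reversal_rel_def by blast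
    thus ?thesis using pos[of k] pos[of "k * (e - 1)"] a(2) by linarith
  qed
  ultimately show ?thesis using reversal_odd by (auto simp: signed_perms_def W_BC_def)
qed

lemma conjugate_to_inverse: "\<exists>h\<in>signed_perms b n. h \<circ> g \<circ> pinv h = pinv g"
proof -
  have "pinv reversal = reversal" by (rule inv_unique_comp) (auto simp: fun_eq_iff reversal_involution)
  moreover have "pinv g = g ^^ (e - 1)"
  proof (rule inv_unique_comp)
    have *: "g ((g ^^ (e - 1)) a) = a" for a
    proof -
      have "g ((g ^^ (e - 1)) a) = (g ^^ (1 + (e - 1))) a" by simp
      thus ?thesis using e_pos pow_e by simp
    qed
    thus "g \<circ> g ^^ (e - 1) = id" by (simp add: fun_eq_iff)
    show "g ^^ (e - 1) \<circ> g = id" using * by (simp add: fun_eq_iff pow_g)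
  qed
  ultimately have "reversal \<circ> g \<circ> pinv reversal = pinv g"
    by (simp add: fun_eq_iff reversal_g reversal_involution)
  thus ?thesis using reversal_mem by blast
qed

end

section \<open>Induced characters as signed fixed point counts\<close>

context perm_group begin

text \<open>The summand of \<open>induce\<close> at x depends only on the conjugate x^-1 y0 x: the
  element x g x^-1 commutes with y0 exactly when g commutes with that conjugate, and signs are
  invariant under conjugation. Each point of the orbit of y0 arises from one coset of H, which
  cancels the division by card H.\<close>

lemma induce_stabilizer:
  fixes y0 :: "int \<Rightarrow> int"
  assumes H: "H = {h \<in> G. h \<circ> y0 = y0 \<circ> h}"
    and perm: "\<And>g. g \<in> G \<Longrightarrow> permutation g"
    and \<sigma>: "\<And>h. h \<in> H \<Longrightarrow> \<sigma> h = of_int (sign (restr {i. y0 i = i} h))"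
    and g: "g \<in> G"
  shows "induce G H \<sigma> g = of_int (\<Sum>y\<in>{y \<in> (\<lambda>x. pinv x \<circ> y0 \<circ> x) ` G. \<forall>a. y (g a) = g (y a)}. sign (restr {i. y i = i} g))"
proof -
  define Q where "Q x = pinv x \<circ> y0 \<circ> x" for x
  define Orb where "Orb = Q ` G"
  define F :: "(int \<Rightarrow> int) \<Rightarrow> complex" where
    "F y = (if \<forall>a. y (g a) = g (y a) then of_int (sign (restr {i. y i = i} g)) else 0)" for y
  have xi: "x (pinv x a) = a" "pinv x (x a) = a" if "x \<in> G" for x a
    using fun_cong[OF comp_inv[OF that], of a] fun_cong[OF inv_comp[OF that], of a] unfolding comp_apply id_apply .
  have trm: "(if x \<circ> g \<circ> pinv x \<in> H then \<sigma> (x \<circ> g \<circ> pinv x) else 0) = F (Q x)" if x: "x \<in> G" for x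
  proof -
    define w where "w = x \<circ> g \<circ> pinv x"
    have wG: "w \<in> G" unfolding w_def by (rule comp_mem[OF comp_mem[OF x g] inv_mem[OF x]])
    have wx: "w (x a) = x (g a)" for a by (simp add: w_def xi[OF x])
    have com: "w \<in> H \<longleftrightarrow> (\<forall>a. Q x (g a) = g (Q x a))"
    proof
      assume "w \<in> H"
      hence "w \<circ> y0 = y0 \<circ> w" unfolding H by blast
      from fun_cong[OF this] have wy: "w (y0 c) = y0 (w c)" for c by simp
      show "\<forall>a. Q x (g a) = g (Q x a)"
      proof
        fix a
        have "Q x (g a) = pinv x (w (y0 (x a)))" by (simp add: Q_def wy wx)
        also have "\<dots> = g (Q x a)" by (simp add: w_def Q_def xi[OF x])
        finally show "Q x (g a) = g (Q x a)" .
      qed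
    next
      assume q: "\<forall>a. Q x (g a) = g (Q x a)"
      have "w (y0 c) = y0 (w c)" for c
      proof -
        have "y0 (w c) = x (Q x (g (pinv x c)))" by (simp add: w_def Q_def xi[OF x])
        also have "\<dots> = x (g (Q x (pinv x c)))" using q by simp
        also have "\<dots> = w (y0 c)" by (simp add: w_def Q_def xi[OF x])
        finally show ?thesis by simp
      qed
      thus "w \<in> H" using wG by (simp add: H fun_eq_iff)
    qed
    show ?thesis
    proof (cases "w \<in> H")
      case True
      have q: "\<forall>a. Q x (g a) = g (Q x a)" using com True by simp
      have ginj: "g a = g c \<longleftrightarrow> a = c" for a c using bij_mem[OF g] by (auto simp: bij_def inj_eq)
      define r where "r = restr {i. Q x i = i} g"
      have r: "permutation r" unfolding r_def using q ginj by (intro permutation_restr[OF perm[OF g]]) auto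
      have "restr {i. y0 i = i} w = x \<circ> r \<circ> pinv x"
      proof
        fix i
        have "Q x (pinv x i) = pinv x i \<longleftrightarrow> y0 i = i"
          unfolding Q_def comp_apply xi[OF x] using bij_mem[OF inv_mem[OF x]] by (auto simp: bij_def inj_eq)
        thus "restr {i. y0 i = i} w i = (x \<circ> r \<circ> pinv x) i"
          by (simp add: restr_def r_def w_def xi[OF x])
      qed
      hence "sign (restr {i. y0 i = i} w) = sign x * sign r * sign (pinv x)"
        using r perm[OF x] perm[OF inv_mem[OF x]] by (simp add: sign_compose permutation_compose)
      also have "\<dots> = sign r"
      proof -
        have "sign x * sign r * sign x = (sign x * sign x) * sign r" by (simp only: ac_simps)
        thus ?thesis using sign_inverse[OF perm[OF x]] by simp
      qed
      finally show ?thesis using True q \<sigma>[OF True] unfolding w_def[symmetric] by (simp add: F_def r_def)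
    next
      case False
      hence "F (Q x) = 0" unfolding com F_def by (rule if_not_P)
      thus ?thesis unfolding w_def[symmetric] using False by simp
    qed
  qed
  have finO: "finite Orb" unfolding Orb_def using finite_carrier by simp
  have fib: "card {x \<in> G. Q x = y} = card H" if "y \<in> Orb" for y
  proof -
    obtain x0 where x0: "x0 \<in> G" "y = Q x0" using \<open>y \<in> Orb\<close> by (auto simp: Orb_def)
    have "bij_betw (\<lambda>h. h \<circ> x0) H {x \<in> G. Q x = y}"
    proof (rule bij_betw_byWitness[of _ "\<lambda>x. x \<circ> pinv x0"])
      show "\<forall>h\<in>H. (h \<circ> x0) \<circ> pinv x0 = h" by (intro ballI cancel(3)[OF x0(1)])
      show "\<forall>x\<in>{x \<in> G. Q x = y}. (x \<circ> pinv x0) \<circ> x0 = x" by (intro ballI cancel(4)[OF x0(1)])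
      show "(\<lambda>h. h \<circ> x0) ` H \<subseteq> {x \<in> G. Q x = y}"
      proof safe
        fix h assume h: "h \<in> H"
        hence hG: "h \<in> G" and hy: "h \<circ> y0 = y0 \<circ> h" by (simp_all add: H)
        show "h \<circ> x0 \<in> G" using comp_mem[OF hG x0(1)] .
        have "Q (h \<circ> x0) = pinv x0 \<circ> (pinv h \<circ> (y0 \<circ> h)) \<circ> x0"
          unfolding Q_def inv_of_comp[OF hG x0(1)] by (simp only: o_assoc)
        also have "pinv h \<circ> (y0 \<circ> h) = y0" unfolding hy[symmetric] by (rule cancel(2)[OF hG])
        finally show "Q (h \<circ> x0) = y" unfolding x0(2) Q_def .
      qed
      show "(\<lambda>x. x \<circ> pinv x0) ` {x \<in> G. Q x = y} \<subseteq> H"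
      proof safe
        fix x assume x: "x \<in> G" "y = Q x"
        define h where "h = x \<circ> pinv x0"
        have hG: "h \<in> G" unfolding h_def using comp_mem[OF x(1) inv_mem[OF x0(1)]] .
        have eq: "Q x a = Q x0 a" for a unfolding x(2)[symmetric] x0(2)[symmetric] by (rule refl)
        have "h (y0 c) = y0 (h c)" for c
        proof -
          have "y0 (h c) = x (Q x (pinv x0 c))" by (simp add: h_def Q_def xi[OF x(1)])
          also have "\<dots> = x (Q x0 (pinv x0 c))" by (simp only: eq)
          also have "\<dots> = h (y0 c)" by (simp add: h_def Q_def xi[OF x0(1)])
          finally show ?thesis by simp
        qed
        thus "x \<circ> pinv x0 \<in> H" unfolding h_def[symmetric] using hG by (simp add: H fun_eq_iff)
      qed
    qed
    from bij_betw_same_card[OF this] show ?thesis by (rule sym)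
  qed
  have Hpos: "card H > 0"
  proof -
    have "id \<in> H" unfolding H using id_mem by simp
    moreover have "finite H" unfolding H using finite_carrier by simp
    ultimately show ?thesis by (auto simp: card_gt_0_iff)
  qed
  have "(\<Sum>x\<in>G. if x \<circ> g \<circ> pinv x \<in> H then \<sigma> (x \<circ> g \<circ> pinv x) else 0) = (\<Sum>x\<in>G. F (Q x))"
    by (rule sum.cong[OF refl trm])
  also have "\<dots> = (\<Sum>y\<in>Orb. \<Sum>x\<in>{x \<in> G. Q x = y}. F (Q x))"
    by (rule sum.group[symmetric]) (auto simp: finite_carrier Orb_def)
  also have "\<dots> = (\<Sum>y\<in>Orb. of_nat (card H) * F y)"
  proof (intro sum.cong refl)
    fix y assume y: "y \<in> Orb"
    have "(\<Sum>x\<in>{x \<in> G. Q x = y}. F (Q x)) = (\<Sum>x\<in>{x \<in> G. Q x = y}. F y)" by (rule sum.cong) auto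
    thus "(\<Sum>x\<in>{x \<in> G. Q x = y}. F (Q x)) = of_nat (card H) * F y" using fib[OF y] by simp
  qed
  also have "\<dots> = of_nat (card H) * (\<Sum>y\<in>Orb. F y)" by (simp add: sum_distrib_left)
  finally have "induce G H \<sigma> g = (\<Sum>y\<in>Orb. F y)" using Hpos by (simp add: induce_def)
  also have "\<dots> = (\<Sum>y\<in>{y \<in> Orb. \<forall>a. y (g a) = g (y a)}. of_int (sign (restr {i. y i = i} g)))"
    unfolding F_def using finO by (simp add: sum.inter_filter[symmetric])
  finally show ?thesis unfolding Orb_def Q_def by simp
qed

end

text \<open>The element of \<open>half_involutions\<close> that corresponds to \<open>z\<^sub>m\<^sub>i\<^sub>n = s\<^sub>1 s\<^sub>3 \<dots>\<close> and the fixed points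
  \<open>2k + 1, \<dots>, n\<close>.\<close>

definition base :: "nat \<Rightarrow> int \<Rightarrow> int" where
  "base k i = (if \<bar>i\<bar> \<le> 2 * int k
     then (if i = 0 then 0 else if i > 0 then (if odd i then i + 1 else i - 1) else (if odd i then i - 1 else i + 1))
     else if i > 0 then i else 0)"

lemma base_moved:
  assumes "i \<noteq> 0" "\<bar>i\<bar> \<le> 2 * int k"
  shows "base k i \<noteq> 0" "base k i \<noteq> i" "base k i \<noteq> - i" "base k (base k i) = i" "base k (- i) = - base k i"
    "\<bar>base k i\<bar> \<le> 2 * int k"
proof -
  consider "i > 0" "odd i" | "i > 0" "even i" | "i < 0" "odd i" | "i < 0" "even i" using assms(1) by linarith
  hence "base k i \<noteq> 0 \<and> base k i \<noteq> i \<and> base k i \<noteq> - i \<and> base k (base k i) = i \<and> base k (- i) = - base k i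
    \<and> \<bar>base k i\<bar> \<le> 2 * int k"
  proof cases
    case 1
    have "i + 1 \<le> 2 * int k" using 1 assms(2) by presburger
    thus ?thesis using 1 by (auto simp: base_def)
  next
    case 2
    have "i \<ge> 2" using 2 by presburger
    thus ?thesis using 2 assms(2) by (auto simp: base_def)
  next
    case 3
    have "i - 1 \<ge> - (2 * int k)" using 3 assms(2) by presburger
    thus ?thesis using 3 by (auto simp: base_def)
  next
    case 4
    have "i \<le> -2" using 4 by presburger
    thus ?thesis using 4 assms(2) by (auto simp: base_def)
  qed
  thus "base k i \<noteq> 0" "base k i \<noteq> i" "base k i \<noteq> - i" "base k (base k i) = i" "base k (- i) = - base k i"
    "\<bar>base k i\<bar> \<le> 2 * int k" by auto
qed

lemma base_fixed: "\<bar>i\<bar> > 2 * int k \<Longrightarrow> base k i = (if i > 0 then i else 0)"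
  by (simp add: base_def)

lemma base_fix_iff: "base k i = i \<longleftrightarrow> i = 0 \<or> i > 2 * int k"
proof (cases "i = 0 \<or> \<bar>i\<bar> > 2 * int k")
  case True
  thus ?thesis using base_fixed[of k i] by (auto simp: base_def)
next
  case False
  thus ?thesis using base_moved(2)[of i k] by auto
qed

lemma base_mem:
  assumes "2 * k \<le> n"
  shows "base k \<in> half_involutions b n"
proof (rule half_involutions_I)
  show "base k 0 = 0" by (simp add: base_def)
  show "base k i = (if i > 0 then i else 0)" if "\<bar>i\<bar> > int n" for i using that assms by (intro base_fixed) auto
  show "base k i > 0" if "i > 0" for i using that by (auto simp: base_def)
  fix i :: int assume i: "i \<noteq> 0"
  show "(base k i = i \<and> base k (- i) = 0) \<or> (base k i = 0 \<and> base k (- i) = - i)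
     \<or> (base k i \<noteq> 0 \<and> base k i \<noteq> i \<and> base k i \<noteq> - i \<and> base k (base k i) = i \<and> base k (- i) = - base k i)"
  proof (cases "\<bar>i\<bar> \<le> 2 * int k")
    case True
    thus ?thesis using base_moved[OF i True] by simp
  next
    case False
    thus ?thesis using base_fixed[of k i] base_fixed[of k "- i"] i by auto
  qed
qed

section \<open>Orbits of the group on the coded pairs\<close>

lemma half_involutions_conj:
  assumes y: "y \<in> half_involutions b n" and x: "x \<in> signed_perms b n"
  shows "pinv x \<circ> y \<circ> x \<in> half_involutions b n"
proof -
  interpret S: perm_group "signed_perms b n" by (rule signed_perms_perm_group)
  define v where "v = pinv x"
  have v: "v \<in> signed_perms b n" unfolding v_def by (rule S.inv_mem[OF x])
  note X = W_BC_D[OF signed_perms_W_BC[OF x]] and V = W_BC_D[OF signed_perms_W_BC[OF v]]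
  note Y = half_involutions_D[OF y]
  have xv: "x (v a) = a" and vx: "v (x a) = a" for a
    using fun_cong[OF S.comp_inv[OF x], of a] fun_cong[OF S.inv_comp[OF x], of a] unfolding v_def comp_apply id_apply .
  have vinj: "v a = v c \<longleftrightarrow> a = c" for a c using W_BC_inj[OF signed_perms_W_BC[OF v]] .
  have "v \<circ> y \<circ> x \<in> half_involutions b n"
  proof (rule half_involutions_I)
    show "(v \<circ> y \<circ> x) 0 = 0" by (simp add: X(4) Y(1) V(4))
    show "(v \<circ> y \<circ> x) i = (if i > 0 then i else 0)" if i: "\<bar>i\<bar> > int n" for i
      using X(3)[OF i] Y(2)[OF i] V(3)[OF i] V(4) by simp
    show "(v \<circ> y \<circ> x) i > 0" if bi: "b" "i > 0" for i
    proof -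
      have "x i > 0" using x bi by (simp add: signed_perms_def)
      hence "y (x i) > 0" using Y(3) bi by simp
      thus ?thesis using v bi by (simp add: signed_perms_def)
    qed
    fix i :: int assume i: "i \<noteq> 0"
    define j where "j = x i"
    have j: "j \<noteq> 0" using i X(5) by (simp add: j_def)
    have vj: "i = v j" by (simp add: j_def vx)
    have xm: "x (- i) = - j" by (simp add: j_def X(2))
    consider "y j = j" "y (- j) = 0" | "y j = 0" "y (- j) = - j"
      | "y j \<noteq> 0" "y j \<noteq> j" "y j \<noteq> - j" "y (y j) = j" "y (- j) = - y j"
      using Y(4,5)[OF j] Y(6)[of j] by blast
    thus "((v \<circ> y \<circ> x) i = i \<and> (v \<circ> y \<circ> x) (- i) = 0) \<or> ((v \<circ> y \<circ> x) i = 0 \<and> (v \<circ> y \<circ> x) (- i) = - i)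
       \<or> ((v \<circ> y \<circ> x) i \<noteq> 0 \<and> (v \<circ> y \<circ> x) i \<noteq> i \<and> (v \<circ> y \<circ> x) i \<noteq> - i
          \<and> (v \<circ> y \<circ> x) ((v \<circ> y \<circ> x) i) = i \<and> (v \<circ> y \<circ> x) (- i) = - (v \<circ> y \<circ> x) i)"
    proof cases
      case 1
      thus ?thesis unfolding comp_apply xm j_def[symmetric] using V(4) vj by simp
    next
      case 2
      thus ?thesis unfolding comp_apply xm j_def[symmetric] using V(2)[of j] V(4) vj by simp
    next
      case 3
      have "v (y j) \<noteq> 0" "v (y j) \<noteq> v j" "v (y j) \<noteq> - v j" "v (- y j) = - v (y j)" "v (- j) = - v j"
        using 3 V(2)[of j] V(2)[of "y j"] V(5)[of "y j"] vinj[of "y j" j] vinj[of "y j" "- j"] by auto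
      thus ?thesis unfolding comp_apply xm j_def[symmetric] xv 3(4,5) using vj by simp
    qed
  qed
  thus ?thesis unfolding v_def .
qed

text \<open>A signed permutation f with f (base k i) = y (f i) is assembled from two enumerations:
  of the pairs of absolute values that y swaps, and of the absolute values that it leaves in place.
  Its signs are dictated by y and come out positive when b holds.\<close>

lemma half_involutions_transitive:
  assumes y: "y \<in> half_involutions b n"
  shows "\<exists>k \<le> n div 2. \<exists>x \<in> signed_perms b n. y = pinv x \<circ> base k \<circ> x"
proof -
  note Y = half_involutions_D[OF y]
  have moved: "y i \<noteq> - i" "y (y i) = i" "y (- i) = - y i" "y (- y i) = - i" "\<bar>i\<bar> \<le> int n" "\<bar>y i\<bar> \<le> int n"
    if i: "y i \<noteq> 0" "y i \<noteq> i" for i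
  proof -
    show 1: "y i \<noteq> - i" "y (y i) = i" "y (- i) = - y i" using Y(6)[OF i] by auto
    have i0: "i \<noteq> 0" using i Y(1) by auto
    show "y (- y i) = - i" using Y(6)[of "y i"] 1 i i0 by auto
    show "\<bar>i\<bar> \<le> int n" using Y(2)[of i] i by (cases "\<bar>i\<bar> > int n") (auto split: if_splits)
    show "\<bar>y i\<bar> \<le> int n" using Y(2)[of "y i"] 1 i i0 by (cases "\<bar>y i\<bar> > int n") (auto split: if_splits)
  qed
  \<comment> \<open>The positive points that y moves. On them i -> |y i| is an involution without
    fixed points; R collects the smaller point of each pair.\<close>
  define A where "A = {i \<in> {1..int n}. y i \<noteq> 0 \<and> y i \<noteq> i}"
  define R where "R = {i \<in> A. i < \<bar>y i\<bar>}"
  define \<tau> where "\<tau> i = \<bar>y i\<bar>" for i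
  have finA: "finite A" by (rule finite_subset[of _ "{1..int n}"]) (auto simp: A_def)
  have \<tau>A: "\<tau> i \<in> A" "\<tau> (\<tau> i) = i" "\<tau> i \<noteq> i" if i: "i \<in> A" for i
  proof -
    have m: "y i \<noteq> 0" "y i \<noteq> i" "i > 0" using i by (auto simp: A_def)
    note M = moved[OF m(1,2)]
    have c: "y i > 0 \<and> \<tau> i = y i \<or> y i < 0 \<and> \<tau> i = - y i" using m(1) by (auto simp: \<tau>_def)
    hence yt: "y (\<tau> i) = i \<or> y (\<tau> i) = - i" using M(2,4) by auto
    show "\<tau> i \<noteq> i" using c m M(1) by auto
    have "\<tau> i > 0" using c by auto
    moreover have "y (\<tau> i) \<noteq> \<tau> i" using yt c m M(1) by auto
    moreover have "y (\<tau> i) \<noteq> 0" using yt m by auto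
    moreover have "\<tau> i \<le> int n" using M(6) by (simp add: \<tau>_def)
    ultimately show "\<tau> i \<in> A" by (simp add: A_def)
    show "\<tau> (\<tau> i) = i" using yt m unfolding \<tau>_def[of "\<tau> i"] by auto
  qed
  define k where "k = card R"
  have RA: "R \<subseteq> A" by (auto simp: R_def)
  have finR: "finite R" using RA finA finite_subset by blast
  have Rlt: "i < \<tau> i" if "i \<in> R" for i using that by (simp add: R_def \<tau>_def)
  have A_eq: "A = R \<union> \<tau> ` R"
  proof
    show "R \<union> \<tau> ` R \<subseteq> A" using RA \<tau>A(1) by auto
    show "A \<subseteq> R \<union> \<tau> ` R"
    proof
      fix i assume i: "i \<in> A"
      show "i \<in> R \<union> \<tau> ` R"
      proof (cases "i < \<tau> i")
        case True
        thus ?thesis using i by (simp add: R_def \<tau>_def)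
      next
        case False
        hence "\<tau> i < \<tau> (\<tau> i)" using \<tau>A(2,3)[OF i] by simp
        hence "\<tau> i \<in> R" using \<tau>A(1)[OF i] by (simp add: R_def \<tau>_def)
        moreover have "i = \<tau> (\<tau> i)" using \<tau>A(2)[OF i] by simp
        ultimately show ?thesis by blast
      qed
    qed
  qed
  have disj: "R \<inter> \<tau> ` R = {}"
  proof (rule ccontr)
    assume "R \<inter> \<tau> ` R \<noteq> {}"
    then obtain i where i: "i \<in> R" "\<tau> i \<in> R" by blast
    have "\<tau> (\<tau> i) = i" using \<tau>A(2) i(1) RA by blast
    thus False using Rlt[OF i(1)] Rlt[OF i(2)] by simp
  qed
  have injR: "inj_on \<tau> R"
  proof (rule inj_onI)
    fix i j assume "i \<in> R" "j \<in> R" "\<tau> i = \<tau> j"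
    thus "i = j" using \<tau>A(2)[of i] \<tau>A(2)[of j] RA by auto
  qed
  have cardA: "card A = 2 * k"
    unfolding A_eq using card_Un_disjoint[OF finR _ disj] finR card_image[OF injR] by (simp add: k_def)
  have sub: "A \<subseteq> {1..int n}" by (auto simp: A_def)
  have "card A \<le> card {1..int n}" using card_mono[OF _ sub] by simp
  hence kn: "2 * k \<le> n" using cardA by simp
  obtain r0 where r0: "bij_betw r0 {0..<k} R" using ex_bij_betw_nat_finite[OF finR] unfolding k_def by blast
  have "card ({1..int n} - A) = card {2 * int k + 1..int n}"
    using card_Diff_subset[OF finA sub] cardA kn by simp
  then obtain s where s: "bij_betw s {2 * int k + 1..int n} ({1..int n} - A)"
    using finite_same_card_bij[of "{2 * int k + 1..int n}" "{1..int n} - A"] by auto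
  \<comment> \<open>The points 2j + 1 and 2j + 2, which \<open>base\<close> swaps, share the
    representative with index j, counted from 0.\<close>
  define r where "r i = r0 (nat ((i - 1) div 2))" for i :: int
  have rR: "r i \<in> R" if "0 < i" "i \<le> 2 * int k" for i
  proof -
    have "nat ((i - 1) div 2) \<in> {0..<k}" using that by auto
    thus ?thesis unfolding r_def using r0 by (auto simp: bij_betw_def)
  qed
  have r_inj: "(i - 1) div 2 = (j - 1) div 2" if "0 < i" "i \<le> 2 * int k" "0 < j" "j \<le> 2 * int k" "r i = r j" for i j
  proof -
    have "nat ((i - 1) div 2) \<in> {0..<k}" "nat ((j - 1) div 2) \<in> {0..<k}" using that by auto
    hence "nat ((i - 1) div 2) = nat ((j - 1) div 2)"
      using that(5) r0 unfolding r_def bij_betw_def inj_on_def by blast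
    thus ?thesis using that(1,3) by (simp add: nat_eq_iff2 split: if_splits)
  qed
  \<comment> \<open>An odd point goes to the representative and its even neighbour to the image of
    the representative under y, whatever its sign. A point above 2k goes to whichever of s i and - s
    i has been chosen by y.\<close>
  define f0 where "f0 i = (if i \<le> 2 * int k then (if odd i then r i else y (r i))
     else if i \<le> int n then (if y (s i) = s i then s i else - s i) else i)" for i :: int
  define f where "f i = (if i > 0 then f0 i else if i = 0 then 0 else - f0 (- i))" for i :: int
  have f_odd: "f (- i) = - f i" for i by (simp add: f_def)
  have f_pos: "f i = f0 i" if "i > 0" for i using that by (simp add: f_def)
  have rA: "r i \<in> A" if "0 < i" "i \<le> 2 * int k" for i using rR[OF that] RA by blast
  \<comment> \<open>Since f is to be odd, injectivity is decided on absolute values.\<close>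
  have abs1: "\<bar>f0 i\<bar> = (if odd i then r i else \<tau> (r i))" if "0 < i" "i \<le> 2 * int k" for i
    using rA[OF that] that by (auto simp: f0_def \<tau>_def A_def)
  have sB: "s i \<in> {1..int n} - A" if "2 * int k < i" "i \<le> int n" for i
    using s that unfolding bij_betw_def by auto
  have abs2: "\<bar>f0 i\<bar> = s i" if "2 * int k < i" "i \<le> int n" for i
    using sB[OF that] that by (auto simp: f0_def)
  have inA: "\<bar>f0 i\<bar> \<in> A" if "0 < i" "i \<le> 2 * int k" for i
    using abs1[OF that] rA[OF that] \<tau>A(1)[OF rA[OF that]] by simp
  have range: "\<bar>f0 i\<bar> \<in> {1..int n}" if "0 < i" "i \<le> int n" for i
    using inA[of i] sub abs2[of i] sB[of i] that by (cases "i \<le> 2 * int k") auto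
  have inj0: "i = j" if ij: "0 < i" "i \<le> int n" "0 < j" "j \<le> int n" "\<bar>f0 i\<bar> = \<bar>f0 j\<bar>" for i j
  proof -
    have iff: "\<bar>f0 l\<bar> \<in> A \<longleftrightarrow> l \<le> 2 * int k" if "0 < l" "l \<le> int n" for l
    proof (cases "l \<le> 2 * int k")
      case True
      thus ?thesis using inA[OF that(1) True] by simp
    next
      case False
      thus ?thesis using abs2[of l] sB[of l] that by simp
    qed
    show ?thesis
    proof (cases "i \<le> 2 * int k")
      case True
      hence j: "j \<le> 2 * int k" using iff[OF ij(1,2)] iff[OF ij(3,4)] ij(5) by simp
      note Ri = rR[OF ij(1) True] and Rj = rR[OF ij(3) j]
      have e: "(if odd i then r i else \<tau> (r i)) = (if odd j then r j else \<tau> (r j))"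
        using abs1[OF ij(1) True] abs1[OF ij(3) j] ij(5) by simp
      have no: "r i \<noteq> \<tau> (r j)" "\<tau> (r i) \<noteq> r j"
        using disj Ri Rj imageI[OF Ri, of \<tau>] imageI[OF Rj, of \<tau>] by (metis IntI empty_iff)+
      have par: "odd i \<longleftrightarrow> odd j" using e no by (auto split: if_splits)
      have "r i = r j" using e par inj_onD[OF injR _ Ri Rj] by (auto split: if_splits)
      hence "(i - 1) div 2 = (j - 1) div 2" using r_inj ij(1,3) True j by blast
      thus ?thesis using par by presburger
    next
      case False
      hence j: "\<not> j \<le> 2 * int k" using iff[OF ij(1,2)] iff[OF ij(3,4)] ij(5) by simp
      have "s i = s j" using abs2[of i] abs2[of j] False j ij by simp
      thus ?thesis using s False j ij unfolding bij_betw_def inj_on_def by auto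
    qed
  qed
  have f_out: "f i = i" if "\<bar>i\<bar> > int n" for i using that kn by (auto simp: f_def f0_def)
  have f_abs: "\<bar>f i\<bar> = \<bar>f0 \<bar>i\<bar>\<bar>" if "i \<noteq> 0" for i using that by (auto simp: f_def)
  have f_in: "\<bar>f i\<bar> \<in> {1..int n}" if "i \<noteq> 0" "\<bar>i\<bar> \<le> int n" for i
    using range[of "\<bar>i\<bar>"] that f_abs[OF that(1)] by simp
  have f_zero: "f i = 0 \<longleftrightarrow> i = 0" for i
    using f_in[of i] f_out[of i] by (cases "i = 0"; cases "\<bar>i\<bar> \<le> int n") (auto simp: f_def)
  have inj: "inj f"
  proof (rule injI)
    fix i j assume e: "f i = f j"
    show "i = j"
    proof (cases "i = 0 \<or> j = 0")
      case True
      thus ?thesis using e f_zero by metis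
    next
      case False
      have "\<bar>f l\<bar> \<le> int n \<longleftrightarrow> \<bar>l\<bar> \<le> int n" if "l \<noteq> 0" for l
        using f_in[OF that] f_out[of l] by (cases "\<bar>l\<bar> \<le> int n") auto
      hence le: "\<bar>i\<bar> \<le> int n \<longleftrightarrow> \<bar>j\<bar> \<le> int n" using False e by metis
      show ?thesis
      proof (cases "\<bar>i\<bar> \<le> int n")
        case True
        have "\<bar>f0 \<bar>i\<bar>\<bar> = \<bar>f0 \<bar>j\<bar>\<bar>" using f_abs[of i] f_abs[of j] False e by simp
        hence "\<bar>i\<bar> = \<bar>j\<bar>" using inj0[of "\<bar>i\<bar>" "\<bar>j\<bar>"] True le False by simp
        hence "i = j \<or> i = - j" by linarith
        moreover have False if "i = - j"
        proof -
          have "f j = 0" using e f_odd[of j] that by simp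
          thus False using f_zero[of j] \<open>\<not> (i = 0 \<or> j = 0)\<close> by simp
        qed
        ultimately show ?thesis by blast
      next
        case False
        hence "\<bar>i\<bar> > int n" "\<bar>j\<bar> > int n" using le by linarith+
        from f_out[OF this(1)] f_out[OF this(2)] e show ?thesis by linarith
      qed
    qed
  qed
  have fsub: "f ` {- int n..int n} \<subseteq> {- int n..int n}"
  proof
    fix c assume "c \<in> f ` {- int n..int n}"
    then obtain i where i: "c = f i" "i \<in> {- int n..int n}" by blast
    hence le: "\<bar>i\<bar> \<le> int n" by auto
    have "\<bar>c\<bar> \<le> int n"
    proof (cases "i = 0")
      case True
      thus ?thesis using f_zero[of i] i(1) by simp
    next
      case False
      thus ?thesis using f_in[OF False le] i(1) by simp
    qed
    thus "c \<in> {- int n..int n}" by auto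
  qed
  have im: "f ` {- int n..int n} = {- int n..int n}"
    by (rule endo_inj_surj[OF _ fsub inj_on_subset[OF inj subset_UNIV]]) simp
  have "surj f" unfolding surj_def
  proof
    fix c
    show "\<exists>x. c = f x"
    proof (cases "\<bar>c\<bar> \<le> int n")
      case True
      hence "c \<in> {- int n..int n}" by auto
      hence "c \<in> f ` {- int n..int n}" unfolding im .
      thus ?thesis by blast
    next
      case False
      thus ?thesis using f_out[of c] by (intro exI[of _ c]) simp
    qed
  qed
  hence bij: "bij f" using inj by (simp add: bij_def)
  have fpos: "f i > 0" if bi: "b" "i > 0" for i
  proof -
    have "y (r i) > 0" "r i > 0" if "i \<le> 2 * int k"
    proof -
      show p: "r i > 0" using rA[OF bi(2) that] by (simp add: A_def)
      show "y (r i) > 0" by (rule Y(3)[OF bi(1) p])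
    qed
    moreover have "s i > 0" "y (s i) = s i" if "2 * int k < i" "i \<le> int n"
    proof -
      show p: "s i > 0" using sB[OF that] by simp
      show "y (s i) = s i" using sB[OF that] Y(3)[OF bi(1) p] by (auto simp: A_def)
    qed
    ultimately show ?thesis unfolding f_pos[OF bi(2)] f0_def using bi(2) by auto
  qed
  have fS: "f \<in> signed_perms b n" unfolding signed_perms_def W_BC_def by (simp add: bij f_odd f_out fpos)
  have key: "f (base k i) = y (f i) \<and> f (base k (- i)) = y (f (- i))" if i: "i > 0" for i
  proof (cases "i \<le> 2 * int k")
    case True
    have ra: "r i \<in> A" by (rule rA[OF i True])
    hence m: "y (r i) \<noteq> 0" "y (r i) \<noteq> r i" by (auto simp: A_def)
    note M = moved[OF m]
    have "f (base k i) = y (f i) \<and> y (f i) \<noteq> 0 \<and> y (f i) \<noteq> f i"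
    proof (cases "odd i")
      case o: True
      have le: "i + 1 \<le> 2 * int k" using o True by presburger
      have "(i + 1 - 1) div 2 = (i - 1) div 2" using o by presburger
      hence "r (i + 1) = r i" unfolding r_def by simp
      hence "f (i + 1) = y (r i)" using i le o by (simp add: f_pos f0_def)
      moreover have "f i = r i" using i True o by (simp add: f_pos f0_def)
      moreover have "base k i = i + 1" using i True o by (simp add: base_def)
      ultimately show ?thesis using m by simp
    next
      case ev: False
      have i2: "i - 1 > 0" using ev i by presburger
      have "(i - 1 - 1) div 2 = (i - 1) div 2" using ev by presburger
      hence "r (i - 1) = r i" unfolding r_def by simp
      hence "f (i - 1) = r i" using i2 True ev by (simp add: f_pos f0_def)
      moreover have "f i = y (r i)" using i True ev by (simp add: f_pos f0_def)
      moreover have "base k i = i - 1" using i True ev by (simp add: base_def)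
      ultimately show ?thesis using m M(2) rA[OF i True] by (auto simp: A_def)
    qed
    moreover from this have "y (- f i) = - y (f i)" using moved(3)[of "f i"] by simp
    moreover have "base k (- i) = - base k i" using base_moved(5)[of i k] i True by simp
    ultimately show ?thesis by (simp add: f_odd)
  next
    case False
    have bk: "base k i = i" "base k (- i) = 0" using False i base_fixed[of k i] base_fixed[of k "- i"] by auto
    have yf: "y (f i) = f i"
    proof (cases "i \<le> int n")
      case True
      have "s i \<in> {1..int n} - A" using sB[of i] False True by simp
      hence "s i > 0" "y (s i) = 0 \<or> y (s i) = s i" by (auto simp: A_def)
      thus ?thesis using Y(5)[of "s i"] False True i by (auto simp: f_pos f0_def)
    next
      case False
      thus ?thesis using f_out[of i] Y(2)[of i] i by simp
    qed
    have "f i \<noteq> 0" using f_zero[of i] i by simp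
    hence "y (- f i) = 0" using Y(4)[OF _ yf] by simp
    thus ?thesis using bk yf f_zero[of 0] by (simp add: f_odd)
  qed
  have comm: "f (base k i) = y (f i)" for i
  proof -
    consider "i > 0" | "i = 0" | "i < 0" by linarith
    thus ?thesis
    proof cases
      case 1
      thus ?thesis using key by blast
    next
      case 2
      thus ?thesis using f_zero[of 0] Y(1) by (simp add: base_def)
    next
      case 3
      thus ?thesis using key[of "- i"] by simp
    qed
  qed
  interpret S: perm_group "signed_perms b n" by (rule signed_perms_perm_group)
  \<comment> \<open>As f carries \<open>base k\<close> to y, the conjugating element in the required
    form is the inverse of f.\<close>
  have "y = pinv (pinv f) \<circ> base k \<circ> pinv f"
  proof
    fix i
    have "f (pinv f i) = i" using fun_cong[OF S.comp_inv[OF fS], of i] unfolding comp_apply id_apply .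
    thus "y i = (pinv (pinv f) \<circ> base k \<circ> pinv f) i" unfolding S.inv_inv[OF fS] comp_apply comm by simp
  qed
  moreover have "k \<le> n div 2" using kn by simp
  ultimately show ?thesis using S.inv_mem[OF fS] by blast
qed

lemma half_involutions_orbits:
  "half_involutions b n = (\<Union>k\<in>{0..n div 2}. (\<lambda>x. pinv x \<circ> base k \<circ> x) ` signed_perms b n)"
proof
  show "half_involutions b n \<subseteq> (\<Union>k\<in>{0..n div 2}. (\<lambda>x. pinv x \<circ> base k \<circ> x) ` signed_perms b n)"
  proof
    fix y assume "y \<in> half_involutions b n"
    from half_involutions_transitive[OF this] obtain k x where
      "k \<le> n div 2" "x \<in> signed_perms b n" "y = pinv x \<circ> base k \<circ> x" by blast
    thus "y \<in> (\<Union>k\<in>{0..n div 2}. (\<lambda>x. pinv x \<circ> base k \<circ> x) ` signed_perms b n)" by auto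
  qed
  show "(\<Union>k\<in>{0..n div 2}. (\<lambda>x. pinv x \<circ> base k \<circ> x) ` signed_perms b n) \<subseteq> half_involutions b n"
  proof (intro UN_least image_subsetI)
    fix k x assume k: "k \<in> {0..n div 2}" and x: "x \<in> signed_perms b n"
    have "2 * k \<le> n" using k by auto
    from half_involutions_conj[OF base_mem[OF this] x]
    show "pinv x \<circ> base k \<circ> x \<in> half_involutions b n" .
  qed
qed

text \<open>A conjugation invariant that tells the orbits for different k apart: 2k absolute values
  are moved, each with two signs.\<close>

lemma moved_card_conj:
  assumes x: "x \<in> signed_perms b n"
  shows "card {i. (pinv x \<circ> base k \<circ> x) i \<noteq> i \<and> (pinv x \<circ> base k \<circ> x) i \<noteq> 0} = 4 * k"
proof -
  interpret S: perm_group "signed_perms b n" by (rule signed_perms_perm_group)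
  have xv: "x (pinv x a) = a" and vx: "pinv x (x a) = a" for a
    using fun_cong[OF S.comp_inv[OF x], of a] fun_cong[OF S.inv_comp[OF x], of a] unfolding comp_apply id_apply .
  note V = W_BC_D[OF signed_perms_W_BC[OF S.inv_mem[OF x]]]
  have "{i. (pinv x \<circ> base k \<circ> x) i \<noteq> i \<and> (pinv x \<circ> base k \<circ> x) i \<noteq> 0} = pinv x ` {i. base k i \<noteq> i \<and> base k i \<noteq> 0}"
    (is "?L = ?R")
  proof
    have *: "pinv x (base k (x i)) = i \<longleftrightarrow> base k (x i) = x i" for i using vx[of i] xv[of "base k (x i)"] by metis
    show "?L \<subseteq> ?R"
    proof
      fix i assume "i \<in> ?L"
      hence "x i \<in> {i. base k i \<noteq> i \<and> base k i \<noteq> 0}" using *[of i] V(5)[of "base k (x i)"] by simp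
      moreover have "i = pinv x (x i)" by (simp add: vx)
      ultimately show "i \<in> ?R" by blast
    qed
    show "?R \<subseteq> ?L"
    proof
      fix i assume "i \<in> ?R"
      then obtain j where j: "i = pinv x j" "base k j \<noteq> j" "base k j \<noteq> 0" by blast
      hence "x i = j" by (simp add: xv)
      thus "i \<in> ?L" using j *[of i] V(5)[of "base k j"] by simp
    qed
  qed
  moreover have "inj (pinv x)" using V(1) by (simp add: bij_def)
  moreover have "{i. base k i \<noteq> i \<and> base k i \<noteq> 0} = {- (2 * int k)..2 * int k} - {0}"
  proof (rule Set.set_eqI)
    fix i
    show "i \<in> {i. base k i \<noteq> i \<and> base k i \<noteq> 0} \<longleftrightarrow> i \<in> {- (2 * int k)..2 * int k} - {0}"
    proof (cases "i \<noteq> 0 \<and> \<bar>i\<bar> \<le> 2 * int k")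
      case True
      thus ?thesis using base_moved(1,2)[of i k] by (auto simp: abs_le_iff)
    next
      case False
      thus ?thesis using base_fixed[of k i] by (cases "i = 0") (auto simp: base_def abs_le_iff)
    qed
  qed
  ultimately show ?thesis by (simp add: card_image inj_on_subset)
qed

text \<open>Each induced character is the signed count over one orbit. The orbits for the various k
  are disjoint and exhaust the coded pairs, so their sum is the full signed count.\<close>

theorem sum_induced_eq_square_roots:
  assumes \<sigma>: "\<And>k h. k \<in> {0..n div 2} \<Longrightarrow> h \<in> signed_perms b n \<Longrightarrow> h \<circ> base k = base k \<circ> h \<Longrightarrow>
      \<sigma> k h = of_int (sign (restr {i. base k i = i} h))"
    and g: "g \<in> signed_perms b n"
  shows "(\<Sum>k\<in>{0..n div 2}. induce (signed_perms b n) {h \<in> signed_perms b n. h \<circ> base k = base k \<circ> h} (\<sigma> k) g)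
    = of_nat (card {x \<in> signed_perms b n. x \<circ> x = g})"
proof -
  interpret S: perm_group "signed_perms b n" by (rule signed_perms_perm_group)
  interpret P: signed_perm b n g by unfold_locales (rule g)
  define Orb where "Orb k = (\<lambda>x. pinv x \<circ> base k \<circ> x) ` signed_perms b n" for k
  define T where "T k = {y \<in> Orb k. \<forall>a. y (g a) = g (y a)}" for k
  have finT: "finite (T k)" for k unfolding T_def Orb_def using S.finite_carrier by simp
  have 1: "induce (signed_perms b n) {h \<in> signed_perms b n. h \<circ> base k = base k \<circ> h} (\<sigma> k) g = of_int (\<Sum>y\<in>T k. P.wt y)"
    if k: "k \<in> {0..n div 2}" for k
    unfolding T_def Orb_def P.wt_def
  proof (rule S.induce_stabilizer[OF refl _ _ g])
    show "permutation h" if "h \<in> signed_perms b n" for h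
      using W_BC_permutation[OF signed_perms_W_BC[OF that]] .
    show "\<sigma> k h = of_int (sign (restr {i. base k i = i} h))"
      if "h \<in> {h \<in> signed_perms b n. h \<circ> base k = base k \<circ> h}" for h
    proof -
      have "h \<in> signed_perms b n" "h \<circ> base k = base k \<circ> h" using that by blast+
      thus ?thesis by (rule \<sigma>[OF k])
    qed
  qed
  have U: "P.commuting = (\<Union>k\<in>{0..n div 2}. T k)"
    unfolding P.commuting_def half_involutions_orbits T_def Orb_def by blast
  have disj: "T k \<inter> T l = {}" if "k \<noteq> l" for k l
  proof (rule ccontr)
    assume "T k \<inter> T l \<noteq> {}"
    then obtain y where "y \<in> Orb k" "y \<in> Orb l" unfolding T_def by blast
    then obtain x x' where x: "x \<in> signed_perms b n" "y = pinv x \<circ> base k \<circ> x"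
      and x': "x' \<in> signed_perms b n" "y = pinv x' \<circ> base l \<circ> x'" unfolding Orb_def by blast
    have "card {i. y i \<noteq> i \<and> y i \<noteq> 0} = 4 * k" unfolding x(2) by (rule moved_card_conj[OF x(1)])
    moreover have "card {i. y i \<noteq> i \<and> y i \<noteq> 0} = 4 * l" unfolding x'(2) by (rule moved_card_conj[OF x'(1)])
    ultimately show False using that by simp
  qed
  have fin: "finite P.commuting" unfolding U using finT by simp
  have "(\<Sum>k\<in>{0..n div 2}. \<Sum>y\<in>T k. P.wt y) = (\<Sum>y\<in>P.commuting. P.wt y)"
    unfolding U using finT disj by (intro sum.UNION_disjoint[symmetric]) auto
  also have "\<dots> = int (card P.roots)" by (rule P.sum_wt_eq_card_roots[OF fin])
  finally have "(\<Sum>k\<in>{0..n div 2}. of_int (\<Sum>y\<in>T k. P.wt y)) = (of_int (int (card P.roots)) :: complex)"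
    unfolding of_int_sum[symmetric] by (rule arg_cong)
  thus ?thesis using 1 by (simp add: P.roots_def)
qed

section \<open>Generators, length and sign\<close>

lemma wprod_simps: "wprod [] = id" "wprod (s # ws) = s \<circ> wprod ws"
  by (simp_all add: wprod_def)

lemma wprod_append: "wprod (xs @ ys) = wprod xs \<circ> wprod ys"
  by (induction xs) (simp_all only: append.simps wprod_simps id_comp o_assoc)

lemma id_in_gen: "id \<in> gen J"
  unfolding gen_def by (rule CollectI, rule exI[of _ "[]"]) (simp add: wprod_def)

lemma gen_incl: "s \<in> J \<Longrightarrow> s \<in> gen J"
  unfolding gen_def by (rule CollectI, rule exI[of _ "[s]"]) (simp add: wprod_def)

lemma gen_comp: "u \<in> gen J \<Longrightarrow> v \<in> gen J \<Longrightarrow> u \<circ> v \<in> gen J"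
proof -
  assume "u \<in> gen J" "v \<in> gen J"
  then obtain xs ys where "set xs \<subseteq> J" "u = wprod xs" "set ys \<subseteq> J" "v = wprod ys" unfolding gen_def by blast
  thus ?thesis unfolding gen_def by (intro CollectI exI[of _ "xs @ ys"]) (simp only: wprod_append set_append Un_subset_iff simp_thms)
qed

lemma gen_mono: "J \<subseteq> J' \<Longrightarrow> gen J \<subseteq> gen J'"
  unfolding gen_def by blast

lemma gen_subset:
  assumes "J \<subseteq> A" "id \<in> A" "\<And>u v. u \<in> A \<Longrightarrow> v \<in> A \<Longrightarrow> u \<circ> v \<in> A"
  shows "gen J \<subseteq> A"
proof
  fix w assume "w \<in> gen J"
  then obtain ws where ws: "set ws \<subseteq> J" "w = wprod ws" unfolding gen_def by blast
  have "set ws \<subseteq> J \<Longrightarrow> wprod ws \<in> A"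
  proof (induction ws)
    case Nil
    show ?case unfolding wprod_simps by (rule assms(2))
  next
    case (Cons s ws)
    have "s \<in> A" "wprod ws \<in> A" using Cons assms(1) by auto
    thus ?case unfolding wprod_simps by (rule assms(3))
  qed
  thus "w \<in> A" using ws by simp
qed

text \<open>For c = - a the last two cases are shadowed and this is the sign change at a. So the
  generators of all three types, and their conjugates by signed permutations, have one common
  form.\<close>

definition refl_at :: "int \<Rightarrow> int \<Rightarrow> perm" where
  "refl_at a c = (\<lambda>x. if x = a then c else if x = c then a else if x = - a then - c else if x = - c then - a else x)"

lemma sgen_refl: "sgen 0 = refl_at 1 (-1)" "sgen (-1) = refl_at 1 (-2)" "i \<ge> 1 \<Longrightarrow> sgen i = refl_at i (i + 1)"
  by (auto simp: sgen_def refl_at_def fun_eq_iff)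

lemma refl_at_involution:
  assumes "a \<noteq> 0" "c \<noteq> 0" "a \<noteq> c"
  shows "refl_at a c (refl_at a c x) = x"
  using assms unfolding refl_at_def by (auto split: if_splits)

lemma refl_at_odd:
  assumes "a \<noteq> 0" "c \<noteq> 0" "a \<noteq> c"
  shows "refl_at a c (- x) = - refl_at a c x"
  using assms unfolding refl_at_def by auto

lemma refl_at_W_BC:
  assumes "a \<noteq> 0" "c \<noteq> 0" "a \<noteq> c" "\<bar>a\<bar> \<le> int n" "\<bar>c\<bar> \<le> int n"
  shows "refl_at a c \<in> W_BC n"
proof -
  have "bij (refl_at a c)"
    by (rule o_bij[of "refl_at a c"]) (simp_all add: fun_eq_iff refl_at_involution[OF assms(1-3)])
  moreover have "refl_at a c i = i" if "\<bar>i\<bar> > int n" for i using that assms(4,5) by (auto simp: refl_at_def)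
  ultimately show ?thesis using refl_at_odd[OF assms(1-3)] by (simp add: W_BC_def)
qed

lemma refl_at_conj:
  assumes w: "w \<in> W_BC n"
  shows "w \<circ> refl_at a c \<circ> pinv w = refl_at (w a) (w c)"
proof
  fix x
  interpret W: perm_group "W_BC n" by (rule W_BC_perm_group)
  define y where "y = pinv w x"
  have x: "x = w y" unfolding y_def using fun_cong[OF W.comp_inv[OF w], of x] by simp
  have "w y = w a \<longleftrightarrow> y = a" "w y = w c \<longleftrightarrow> y = c" "w y = - w a \<longleftrightarrow> y = - a" "w y = - w c \<longleftrightarrow> y = - c"
    using W_BC_inj[OF w, of y] W_BC_inj[OF w, of y "- a"] W_BC_inj[OF w, of y "- c"] W_BC_D(2)[OF w] by simp_all
  moreover have "(w \<circ> refl_at a c \<circ> pinv w) x = w (refl_at a c y)" by (simp add: y_def)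
  ultimately show "(w \<circ> refl_at a c \<circ> pinv w) x = refl_at (w a) (w c) x"
    unfolding x refl_at_def using W_BC_D(2)[OF w] by simp
qed

lemma sgen_W_BC: "i \<in> {-1..int n - 1} \<Longrightarrow> n \<ge> 1 \<Longrightarrow> (i = -1 \<Longrightarrow> n \<ge> 2) \<Longrightarrow> sgen i \<in> W_BC n"
proof -
  assume i: "i \<in> {-1..int n - 1}" "n \<ge> 1" "i = -1 \<Longrightarrow> n \<ge> 2"
  consider "i = 0" | "i = -1" | "i \<ge> 1" using i by force
  thus ?thesis
  proof cases
    case 1
    thus ?thesis unfolding 1 sgen_refl using i by (intro refl_at_W_BC) auto
  next
    case 2
    hence "n \<ge> 2" using i(3) by blast
    thus ?thesis unfolding 2 sgen_refl by (intro refl_at_W_BC) auto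
  next
    case 3
    thus ?thesis unfolding sgen_refl(3)[OF 3] using i by (intro refl_at_W_BC) auto
  qed
qed

lemma sgen_pos: "i \<ge> 1 \<Longrightarrow> x > 0 \<Longrightarrow> sgen i x > 0"
  by (auto simp: sgen_def)

lemma sgen_involution: "i \<ge> -1 \<Longrightarrow> sgen i \<circ> sgen i = id"
proof -
  assume i: "i \<ge> -1"
  consider "i = 0" | "i = -1" | "i \<ge> 1" using i by force
  thus ?thesis
  proof cases
    case 1
    show ?thesis unfolding 1 sgen_refl fun_eq_iff using refl_at_involution[of 1 "-1"] by simp
  next
    case 2
    show ?thesis unfolding 2 sgen_refl fun_eq_iff using refl_at_involution[of 1 "-2"] by simp
  next
    case 3
    thus ?thesis unfolding sgen_refl(3)[OF 3] fun_eq_iff using refl_at_involution[of i "i + 1"] by simp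
  qed
qed

lemma gen_inverse:
  assumes I: "\<And>i. i \<in> I \<Longrightarrow> i \<ge> -1" and u: "u \<in> gen (sgen ` I)"
  shows "\<exists>v\<in>gen (sgen ` I). v \<circ> u = id \<and> u \<circ> v = id"
proof -
  obtain ws where ws: "set ws \<subseteq> sgen ` I" "u = wprod ws" using u unfolding gen_def by blast
  have "set ws \<subseteq> sgen ` I \<Longrightarrow> \<exists>v\<in>gen (sgen ` I). v \<circ> wprod ws = id \<and> wprod ws \<circ> v = id"
  proof (induction ws)
    case Nil
    show ?case using id_in_gen by (intro bexI[of _ id]) (simp_all add: wprod_simps)
  next
    case (Cons s ws)
    have "set ws \<subseteq> sgen ` I" using Cons.prems by simp
    from Cons.IH[OF this] obtain v where v: "v \<in> gen (sgen ` I)" "v \<circ> wprod ws = id" "wprod ws \<circ> v = id" by blast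
    have s: "s \<in> sgen ` I" using Cons.prems by simp
    then obtain i where i: "i \<in> I" "s = sgen i" by blast
    have ss: "s \<circ> s = id" unfolding i(2) by (rule sgen_involution[OF I[OF i(1)]])
    have "(v \<circ> s) \<circ> (s \<circ> wprod ws) = v \<circ> (s \<circ> s) \<circ> wprod ws" by (simp only: o_assoc)
    hence 1: "(v \<circ> s) \<circ> (s \<circ> wprod ws) = id" by (simp only: ss comp_id v(2))
    have "(s \<circ> wprod ws) \<circ> (v \<circ> s) = s \<circ> (wprod ws \<circ> v) \<circ> s" by (simp only: o_assoc)
    hence 2: "(s \<circ> wprod ws) \<circ> (v \<circ> s) = id" by (simp only: ss comp_id v(3))
    show ?case unfolding wprod_simps using gen_comp[OF v(1) gen_incl[OF s]] 1 2 by blast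
  qed
  thus ?thesis using ws by simp
qed

text \<open>The generators with indices c, ..., m - 1 move c step by step up to m. Their product
  fixes everything beyond m, which the descent in \<open>gen_sufficient\<close> relies on.\<close>

lemma transport_up:
  assumes "1 \<le> c" "c \<le> m" "{c..m - 1} \<subseteq> I"
  shows "\<exists>u\<in>gen (sgen ` I). u c = m \<and> u \<in> W_BC (nat m)"
  using assms(2,1,3)
proof (induction m rule: int_ge_induct)
  case base
  have "id \<in> W_BC (nat c)" using perm_group.id_mem[OF W_BC_perm_group] .
  thus ?case by (intro bexI[OF _ id_in_gen] conjI id_apply)
next
  case (step m)
  have "{c..m - 1} \<subseteq> I" using step.prems(2) by auto
  then obtain u where u: "u \<in> gen (sgen ` I)" "u c = m" "u \<in> W_BC (nat m)" using step.IH step.prems(1) by blast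
  have "m \<in> I" using step.prems step.hyps by auto
  hence sg: "sgen m \<in> gen (sgen ` I)" by (intro gen_incl imageI)
  have m1: "m \<ge> 1" using step by simp
  have "u \<in> W_BC (nat (m + 1))" using u(3) m1 unfolding W_BC_def by auto
  moreover have "sgen m \<in> W_BC (nat (m + 1))" using m1 by (intro sgen_W_BC) auto
  ultimately have "sgen m \<circ> u \<in> W_BC (nat (m + 1))" using perm_group.comp_mem[OF W_BC_perm_group] by blast
  moreover have "(sgen m \<circ> u) c = m + 1" using u(2) m1 by (simp add: sgen_def)
  ultimately show ?case using gen_comp[OF sg u(1)] by blast
qed

lemma W_BC_mono: "m \<le> n \<Longrightarrow> W_BC m \<subseteq> W_BC n"
  unfolding W_BC_def by auto

text \<open>Descent on the support: once the image of m has been moved back to m by generators that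
  fix all larger points, the remaining element fixes m as well. Generation is thus reduced to one
  transport problem for each m.\<close>

lemma gen_sufficient:
  assumes I: "\<And>i. i \<in> I \<Longrightarrow> i \<ge> -1" and sub: "gen (sgen ` I) \<subseteq> C"
    and C: "\<And>u v. u \<in> C \<Longrightarrow> v \<in> C \<Longrightarrow> u \<circ> v \<in> C"
    and tr: "\<And>m w. 1 \<le> m \<Longrightarrow> m \<le> n \<Longrightarrow> w \<in> C \<Longrightarrow> w \<in> W_BC m \<Longrightarrow>
        \<exists>u\<in>gen (sgen ` I). u \<in> W_BC m \<and> u (w (int m)) = int m"
    and w: "w \<in> C" "w \<in> W_BC n"
  shows "w \<in> gen (sgen ` I)"
proof -
  have "w \<in> gen (sgen ` I)" if "m \<le> n" "w \<in> C" "w \<in> W_BC m" for m w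
    using that
  proof (induction m arbitrary: w)
    case 0
    have "w i = i" for i using W_BC_D(3,4)[OF 0(3)] by (cases "i = 0") auto
    hence "w = id" by (simp add: fun_eq_iff)
    thus ?case by (simp only: id_in_gen)
  next
    case (Suc m)
    obtain u where u: "u \<in> gen (sgen ` I)" "u \<in> W_BC (Suc m)" "u (w (int (Suc m))) = int (Suc m)"
      using tr[of "Suc m" w] Suc.prems by auto
    define v where "v = u \<circ> w"
    have vW: "v \<in> W_BC (Suc m)" unfolding v_def using perm_group.comp_mem[OF W_BC_perm_group u(2) Suc.prems(3)] .
    have vC: "v \<in> C" unfolding v_def using C sub u(1) Suc.prems(2) by blast
    have v1: "v (int (Suc m)) = int (Suc m)" using u(3) by (simp add: v_def)
    have "v i = i" if i: "\<bar>i\<bar> > int m" for i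
    proof -
      consider "\<bar>i\<bar> > int (Suc m)" | "i = int (Suc m)" | "i = - int (Suc m)" using i by linarith
      thus ?thesis
      proof cases
        case 1
        thus ?thesis by (rule W_BC_D(3)[OF vW])
      next
        case 2
        thus ?thesis using v1 by simp
      next
        case 3
        thus ?thesis using v1 W_BC_D(2)[OF vW, of "int (Suc m)"] by simp
      qed
    qed
    hence "v \<in> W_BC m" using vW unfolding W_BC_def by blast
    hence vg: "v \<in> gen (sgen ` I)" using Suc.IH[OF _ vC] Suc.prems(1) by simp
    obtain u' where u': "u' \<in> gen (sgen ` I)" "u' \<circ> u = id" using gen_inverse[OF I u(1)] by blast
    have "u' \<circ> v = w" unfolding v_def o_assoc u'(2) by simp
    thus ?case using gen_comp[OF u'(1) vg] by simp
  qed
  thus ?thesis using w by blast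
qed

section \<open>Parity of sign changes\<close>

definition negs :: "nat \<Rightarrow> perm \<Rightarrow> int set" where "negs n w = {i \<in> {1..int n}. w i < 0}"

lemma W_D_iff: "w \<in> W_D n \<longleftrightarrow> w \<in> W_BC n \<and> even (card (negs n w))"
  by (simp add: W_D_def negs_def)

lemma finite_negs: "finite (negs n w)"
  by (rule finite_subset[of _ "{1..int n}"]) (auto simp: negs_def)

lemma even_card_sym_diff:
  assumes "finite A" "finite B"
  shows "even (card ((A - B) \<union> (B - A))) \<longleftrightarrow> (even (card A) \<longleftrightarrow> even (card B))"
proof -
  have 1: "card ((A - B) \<union> (B - A)) = card (A - B) + card (B - A)"
    using assms by (intro card_Un_disjoint) auto
  have "A = (A - B) \<union> (A \<inter> B)" "(A - B) \<inter> (A \<inter> B) = {}" by auto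
  hence 2: "card A = card (A - B) + card (A \<inter> B)" using assms card_Un_disjoint[of "A - B" "A \<inter> B"] by simp
  have "B = (B - A) \<union> (A \<inter> B)" "(B - A) \<inter> (A \<inter> B) = {}" by auto
  hence 3: "card B = card (B - A) + card (A \<inter> B)" using assms card_Un_disjoint[of "B - A" "A \<inter> B"] by simp
  show ?thesis unfolding 1 2 3 even_add by blast
qed

text \<open>The sign changes of v after w are the symmetric difference of those of w and those of v
  pulled back along i -> |w i|, and cardinalities of symmetric differences add modulo 2.\<close>

lemma even_negs_comp:
  assumes v: "v \<in> W_BC n" and w: "w \<in> W_BC n"
  shows "even (card (negs n (v \<circ> w))) \<longleftrightarrow> (even (card (negs n v)) \<longleftrightarrow> even (card (negs n w)))"
proof -
  define B where "B = {i \<in> {1..int n}. v \<bar>w i\<bar> < 0}"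
  note V = W_BC_D[OF v] and W = W_BC_D[OF w]
  have "i \<in> negs n (v \<circ> w) \<longleftrightarrow> i \<in> (negs n w - B) \<union> (B - negs n w)" for i
  proof (cases "i \<in> {1..int n}")
    case True
    hence w0: "w i \<noteq> 0" using W(5)[of i] by auto
    have "v (w i) \<noteq> 0" using w0 V(5) by simp
    thus ?thesis using True w0 V(2)[of "w i"] by (cases "w i > 0") (auto simp: negs_def B_def)
  qed (auto simp: negs_def B_def)
  hence eq: "negs n (v \<circ> w) = (negs n w - B) \<union> (B - negs n w)" by blast
  have "bij_betw (\<lambda>i. \<bar>w i\<bar>) B (negs n v)"
    unfolding bij_betw_def
  proof
    have winj: "w i = w j \<longleftrightarrow> i = j" for i j using W_BC_inj[OF w] .
    show "inj_on (\<lambda>i. \<bar>w i\<bar>) B"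
    proof (rule inj_onI)
      fix i j assume ij: "i \<in> B" "j \<in> B" "\<bar>w i\<bar> = \<bar>w j\<bar>"
      hence "w i = w j \<or> w i = w (- j)" using W(2)[of j] by linarith
      hence "i = j \<or> i = - j" by (simp only: winj)
      thus "i = j" using ij(1,2) by (auto simp: B_def)
    qed
    show "(\<lambda>i. \<bar>w i\<bar>) ` B = negs n v"
    proof
      show "(\<lambda>i. \<bar>w i\<bar>) ` B \<subseteq> negs n v"
      proof
        fix c assume "c \<in> (\<lambda>i. \<bar>w i\<bar>) ` B"
        then obtain i where i: "c = \<bar>w i\<bar>" "i \<in> {1..int n}" "v c < 0" by (auto simp: B_def)
        have "w i \<noteq> 0" using W(5)[of i] i(2) by auto
        moreover have "\<bar>w i\<bar> \<le> int n" using W(6)[of i] i(2) by auto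
        ultimately show "c \<in> negs n v" using i by (simp add: negs_def)
      qed
      show "negs n v \<subseteq> (\<lambda>i. \<bar>w i\<bar>) ` B"
      proof
        fix c assume c: "c \<in> negs n v"
        obtain j where j: "c = w j" using W(1) by (metis bij_pointE)
        have cn: "c > 0" "c \<le> int n" "v c < 0" using c by (auto simp: negs_def)
        have "\<bar>j\<bar> \<le> int n" using W(6)[of j] j cn by auto
        moreover have "j \<noteq> 0" using j cn W(4) by auto
        moreover have "\<bar>w \<bar>j\<bar>\<bar> = c" using j cn W(2)[of j] by (cases "j > 0") auto
        ultimately show "c \<in> (\<lambda>i. \<bar>w i\<bar>) ` B" using cn by (intro image_eqI[of _ _ "\<bar>j\<bar>"]) (auto simp: B_def)
      qed
    qed
  qed
  hence cB: "card B = card (negs n v)" by (rule bij_betw_same_card)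
  have "finite B" by (rule finite_subset[of _ "{1..int n}"]) (auto simp: B_def)
  thus ?thesis unfolding eq using even_card_sym_diff[OF finite_negs] cB by auto
qed

lemma negs_id: "negs n id = {}" by (auto simp: negs_def)

lemma W_D_perm_group: "perm_group (W_D n)"
proof -
  interpret W: perm_group "W_BC n" by (rule W_BC_perm_group)
  show ?thesis
  proof
    show "finite (W_D n)" by (rule finite_subset[OF _ W.finite_carrier]) (auto simp: W_D_iff)
    show "id \<in> W_D n" unfolding W_D_iff negs_id using W.id_mem by (simp only: card.empty even_zero simp_thms)
    fix g assume g: "g \<in> W_D n"
    hence gW: "g \<in> W_BC n" by (simp add: W_D_iff)
    show "bij g" by (rule W.bij_mem[OF gW])
    show "g \<circ> h \<in> W_D n" if "h \<in> W_D n" for h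
    proof -
      have hW: "h \<in> W_BC n" using that by (simp add: W_D_iff)
      show ?thesis using g that even_negs_comp[OF gW hW] W.comp_mem[OF gW hW] unfolding W_D_iff by blast
    qed
    have iW: "pinv g \<in> W_BC n" by (rule W.inv_mem[OF gW])
    have "even (card (negs n (g \<circ> pinv g)))" unfolding W.comp_inv[OF gW] negs_id by (simp only: card.empty even_zero)
    thus "pinv g \<in> W_D n" using g even_negs_comp[OF gW iW] iW unfolding W_D_iff by blast
  qed
qed

text \<open>The parabolic subgroup of type A or BC is all of \<open>blocks b n k\<close>; in type D it is the intersection with
  \<open>W_D n\<close>.\<close>

definition blocks :: "bool \<Rightarrow> nat \<Rightarrow> nat \<Rightarrow> perm set" where
  "blocks b n k = {w \<in> signed_perms b n. (\<forall>i. \<bar>w i\<bar> \<le> 2 * int k \<longleftrightarrow> \<bar>i\<bar> \<le> 2 * int k) \<and> (\<forall>i > 2 * int k. w i > 0)}"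

section \<open>Parabolic subgroups and centralizers\<close>

lemma blocks_id: "id \<in> blocks b n k"
  using perm_group.id_mem[OF signed_perms_perm_group] unfolding blocks_def by simp

lemma blocks_comp: "u \<in> blocks b n k \<Longrightarrow> v \<in> blocks b n k \<Longrightarrow> u \<circ> v \<in> blocks b n k"
proof -
  assume u: "u \<in> blocks b n k" and v: "v \<in> blocks b n k"
  have "u \<circ> v \<in> signed_perms b n" using u v perm_group.comp_mem[OF signed_perms_perm_group] unfolding blocks_def by blast
  moreover have "(u \<circ> v) i > 0" if i: "i > 2 * int k" for i
  proof -
    have "v i > 0" "\<not> \<bar>v i\<bar> \<le> 2 * int k" using v i unfolding blocks_def by auto
    thus ?thesis using u unfolding blocks_def by auto
  qed
  ultimately show ?thesis using u v unfolding blocks_def by auto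
qed

lemma sgen_blocks:
  assumes "i \<in> {-1..int n - 1}" "i \<noteq> 2 * int k" "i = -1 \<Longrightarrow> n \<ge> 2 \<and> k \<ge> 1" "b \<Longrightarrow> i \<ge> 1" "n \<ge> 1" "i = 0 \<Longrightarrow> k \<ge> 1"
  shows "sgen i \<in> blocks b n k"
proof -
  have "sgen i \<in> W_BC n" using assms by (intro sgen_W_BC) auto
  moreover have "sgen i x > 0" if "b" "x > 0" for x using assms(4) that sgen_pos by blast
  moreover have "\<bar>sgen i x\<bar> \<le> 2 * int k \<longleftrightarrow> \<bar>x\<bar> \<le> 2 * int k" for x
  proof -
    consider "i = 0" | "i = -1" | "i \<ge> 1" using assms(1) by force
    thus ?thesis
    proof cases
      case 1
      thus ?thesis by (auto simp: sgen_def)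
    next
      case 2
      hence "k \<ge> 1" using assms(3) by blast
      thus ?thesis using 2 by (auto simp: sgen_def)
    next
      case 3
      thus ?thesis using assms(2) by (auto simp: sgen_def)
    qed
  qed
  moreover have "sgen i x > 0" if x: "x > 2 * int k" for x
  proof (cases "i \<ge> 1")
    case True
    thus ?thesis using sgen_pos x by auto
  next
    case False
    hence "i = 0 \<or> i = -1" using assms(1) by auto
    hence "k \<ge> 1" using assms(3,6) by blast
    hence "sgen i x = x" using \<open>i = 0 \<or> i = -1\<close> x by (auto simp: sgen_def)
    thus ?thesis using x by simp
  qed
  ultimately show ?thesis unfolding blocks_def signed_perms_def by blast
qed

text \<open>The involution itself, fixing all points beyond 2k, whereas \<open>base\<close> also
  records that the positive ones among them are chosen.\<close>

definition zz :: "nat \<Rightarrow> perm" where "zz k = (\<lambda>i. if \<bar>i\<bar> \<le> 2 * int k then base k i else i)"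

lemma zmin_zz: "zmin k = (zz k, id)"
proof -
  have "wprod (map (\<lambda>j. sgen (2 * int j + 1)) [0..<k]) = zz k"
  proof (induction k)
    case 0
    show ?case by (simp add: wprod_def zz_def base_def fun_eq_iff)
  next
    case (Suc k)
    have "wprod (map (\<lambda>j. sgen (2 * int j + 1)) [0..<Suc k]) = zz k \<circ> sgen (2 * int k + 1)"
      using Suc by (simp add: wprod_append wprod_simps)
    also have "\<dots> = zz (Suc k)"
    proof
      fix i
      consider "i = 2 * int k + 1" | "i = 2 * int k + 2" | "i = - (2 * int k + 1)" | "i = - (2 * int k + 2)"
        | "\<bar>i\<bar> \<le> 2 * int k" | "\<bar>i\<bar> > 2 * int k + 2" by linarith
      thus "(zz k \<circ> sgen (2 * int k + 1)) i = zz (Suc k) i"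
      proof cases
        case 5
        hence "sgen (2 * int k + 1) i = i" by (auto simp: sgen_def)
        thus ?thesis using 5 by (auto simp: zz_def base_def)
      next
        case 6
        hence "sgen (2 * int k + 1) i = i" by (auto simp: sgen_def)
        thus ?thesis using 6 by (auto simp: zz_def)
      qed (simp_all add: zz_def base_def sgen_def)
    qed
    finally show ?case .
  qed
  thus ?thesis by (simp add: zmin_def)
qed

lemma zz_zz: "zz k (zz k i) = i"
proof (cases "i \<noteq> 0 \<and> \<bar>i\<bar> \<le> 2 * int k")
  case True
  thus ?thesis using base_moved(4,6)[of i k] by (simp add: zz_def)
qed (auto simp: zz_def base_def)

lemma zz_W_BC: "2 * k \<le> n \<Longrightarrow> zz k \<in> W_BC n"
proof -
  assume k: "2 * k \<le> n"
  have "bij (zz k)" by (rule o_bij[of "zz k"]) (simp_all add: fun_eq_iff zz_zz)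
  moreover have "zz k (- i) = - zz k i" for i
    using base_moved(5)[of i k] by (cases "i = 0") (auto simp: zz_def base_def)
  moreover have "zz k i = i" if "\<bar>i\<bar> > int n" for i using that k by (simp add: zz_def)
  ultimately show ?thesis by (simp add: W_BC_def)
qed

text \<open>Commuting with \<open>base\<close> means commuting with the involution and preserving
  its chosen fixed points 2k + 1, 2k + 2, ..., and the latter is membership in
  \<open>blocks\<close>. A centralizer taken inside a parabolic subgroup thereby becomes a commutant
  in the whole group.\<close>

lemma commutant_base:
  assumes h: "h \<in> signed_perms b n"
  shows "h \<circ> base k = base k \<circ> h \<longleftrightarrow> h \<in> blocks b n k \<and> h \<circ> zz k = zz k \<circ> h"
proof -
  note H = W_BC_D[OF signed_perms_W_BC[OF h]]
  have inj: "h i = h j \<longleftrightarrow> i = j" for i j using W_BC_inj[OF signed_perms_W_BC[OF h]] .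
  have mv: "base k i \<noteq> i \<and> base k i \<noteq> 0 \<longleftrightarrow> i \<noteq> 0 \<and> \<bar>i\<bar> \<le> 2 * int k" for i
  proof (cases "i \<noteq> 0 \<and> \<bar>i\<bar> \<le> 2 * int k")
    case True
    thus ?thesis using base_moved(1,2)[of i k] by blast
  next
    case False
    thus ?thesis using base_fixed[of k i] by (cases "i = 0") (auto simp: base_def)
  qed
  show ?thesis
  proof
    assume c: "h \<circ> base k = base k \<circ> h"
    have hb: "h (base k i) = base k (h i)" for i using fun_cong[OF c, of i] by (simp only: comp_apply)
    have bl: "\<bar>h i\<bar> \<le> 2 * int k \<longleftrightarrow> \<bar>i\<bar> \<le> 2 * int k" for i
    proof (cases "i = 0")
      case False
      have "base k (h i) \<noteq> h i \<and> base k (h i) \<noteq> 0 \<longleftrightarrow> base k i \<noteq> i \<and> base k i \<noteq> 0"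
        unfolding hb[symmetric] inj H(5) ..
      thus ?thesis unfolding mv using False H(5) by simp
    qed (simp add: H(4))
    have "h i > 0" if i: "i > 2 * int k" for i
    proof -
      have "base k i = i" using i by (simp add: base_fix_iff)
      hence "base k (h i) = h i" using hb[of i] by simp
      hence "h i = 0 \<or> h i > 2 * int k" unfolding base_fix_iff .
      thus ?thesis using H(5)[of i] i by auto
    qed
    hence 1: "h \<in> blocks b n k" using h bl unfolding blocks_def by blast
    have "h (zz k i) = zz k (h i)" for i unfolding zz_def bl using hb by simp
    thus "h \<in> blocks b n k \<and> h \<circ> zz k = zz k \<circ> h" using 1 by (simp add: fun_eq_iff)
  next
    assume a: "h \<in> blocks b n k \<and> h \<circ> zz k = zz k \<circ> h"
    have hz: "h (zz k i) = zz k (h i)" for i using fun_cong[OF conjunct2[OF a], of i] by (simp only: comp_apply)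
    have bl: "\<bar>h i\<bar> \<le> 2 * int k \<longleftrightarrow> \<bar>i\<bar> \<le> 2 * int k" and pos: "i > 2 * int k \<Longrightarrow> h i > 0" for i
      using a unfolding blocks_def by blast+
    have "h (base k i) = base k (h i)" for i
    proof (cases "\<bar>i\<bar> \<le> 2 * int k")
      case True
      thus ?thesis using hz[of i] bl[of i] by (simp add: zz_def)
    next
      case False
      hence l: "\<bar>h i\<bar> > 2 * int k" using bl[of i] by simp
      show ?thesis
      proof (cases "i > 0")
        case True
        hence "h i > 0" using pos False by simp
        thus ?thesis using base_fixed[OF l] base_fixed[of k i] False True by simp
      next
        case i: False
        hence "h (- i) > 0" using pos[of "- i"] False by simp
        hence "h i < 0" using H(2)[of i] by simp
        thus ?thesis using base_fixed[OF l] base_fixed[of k i] False i H(4) by simp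
      qed
    qed
    thus "h \<circ> base k = base k \<circ> h" by (simp add: fun_eq_iff)
  qed
qed

text \<open>The involution swaps 2j + 1 and 2j + 2 without a sign and commutes with h, so h changes
  signs at both of these points or at neither. Beyond 2k there are no sign changes.\<close>

lemma commutant_even_negs:
  assumes h: "h \<in> blocks b n k" "h \<circ> zz k = zz k \<circ> h" and k: "2 * k \<le> n"
  shows "h \<in> W_D n"
proof -
  have hW: "h \<in> W_BC n" using h(1) unfolding blocks_def signed_perms_def by blast
  have hz: "h (zz k i) = zz k (h i)" for i using fun_cong[OF h(2), of i] by (simp only: comp_apply)
  have bl: "\<bar>h i\<bar> \<le> 2 * int k \<longleftrightarrow> \<bar>i\<bar> \<le> 2 * int k" and pos: "i > 2 * int k \<Longrightarrow> h i > 0" for i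
    using h(1) unfolding blocks_def by blast+
  have le: "i \<le> 2 * int k" if "i \<in> negs n h" for i using that pos[of i] by (force simp: negs_def)
  define A where "A = {i \<in> negs n h. odd i}"
  define B where "B = {i \<in> negs n h. even i}"
  have zsgn: "zz k c < 0" if "c < 0" for c using that by (auto simp: zz_def base_def)
  have zn: "zz k i \<in> negs n h" if i: "i \<in> negs n h" for i
  proof -
    have i': "1 \<le> i" "i \<le> 2 * int k" "h i < 0" using i le[OF i] by (auto simp: negs_def)
    have "1 \<le> zz k i \<and> zz k i \<le> 2 * int k"
    proof (cases "odd i")
      case True
      hence "i + 1 \<le> 2 * int k" using i' by presburger
      thus ?thesis using True i' by (simp add: zz_def base_def)
    next
      case False
      hence "i \<ge> 2" using i' by presburger
      thus ?thesis using False i' by (simp add: zz_def base_def)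
    qed
    thus ?thesis using zsgn[OF i'(3)] hz[of i] k by (simp add: negs_def)
  qed
  have par: "even (zz k i) \<longleftrightarrow> odd i" if "i \<in> negs n h" for i
    using that le[OF that] by (auto simp: negs_def zz_def base_def)
  have "bij_betw (zz k) A B"
    by (rule bij_betw_byWitness[of _ "zz k"]) (auto simp: zz_zz A_def B_def zn par)
  hence "card A = card B" by (rule bij_betw_same_card)
  moreover have "negs n h = A \<union> B" "A \<inter> B = {}" by (auto simp: A_def B_def)
  moreover have "finite A" "finite B" using finite_negs[of n h] by (auto simp: A_def B_def)
  ultimately have "card (negs n h) = 2 * card A" using card_Un_disjoint[of A B] by simp
  thus ?thesis using hW by (simp add: W_D_iff)
qed

text \<open>The route from a negative c to m: the inverse of v takes c to -1, the given s takes -1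
  to the positive j, and u takes j up to m. In the applications s is \<open>sgen 0\<close> with j =
  1 or \<open>sgen (-1)\<close> with j = 2.\<close>

lemma neg_transport:
  assumes I: "\<And>i. i \<in> I \<Longrightarrow> i \<ge> -1" "{1..int m - 1} \<subseteq> I"
    and s: "s \<in> gen (sgen ` I)" "s \<in> W_BC m" "s (-1) = j" "1 \<le> j" "j \<le> int m"
    and c: "c < 0" "- c \<le> int m"
  shows "\<exists>u\<in>gen (sgen ` I). u \<in> W_BC m \<and> u c = int m"
proof -
  interpret W: perm_group "W_BC m" by (rule W_BC_perm_group)
  obtain v where v: "v \<in> gen (sgen ` I)" "v 1 = - c" "v \<in> W_BC (nat (- c))"
    using transport_up[of 1 "- c" I] I(2) c by force
  have vW: "v \<in> W_BC m"
  proof -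
    have "nat (- c) \<le> m" using c by linarith
    from W_BC_mono[OF this] v(3) show ?thesis by blast
  qed
  obtain v' where v': "v' \<in> gen (sgen ` I)" "v' \<circ> v = id" "v \<circ> v' = id" using gen_inverse[OF I(1) v(1)] by blast
  have "pinv v = v'" using v'(3,2) by (rule inv_unique_comp)
  hence v'W: "v' \<in> W_BC m" using W.inv_mem[OF vW] by simp
  have "v' (v 1) = 1" using fun_cong[OF v'(2), of 1] by (simp only: comp_apply id_apply)
  hence v'c: "v' c = -1" using W_BC_D(2)[OF v'W, of "- c"] v(2) by simp
  obtain u where u: "u \<in> gen (sgen ` I)" "u j = int m" "u \<in> W_BC m"
    using transport_up[of j "int m" I] I(2) s(4,5) by force
  have "u \<circ> (s \<circ> v') \<in> gen (sgen ` I)" using gen_comp[OF u(1) gen_comp[OF s(1) v'(1)]] .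
  moreover have "u \<circ> (s \<circ> v') \<in> W_BC m" using W.comp_mem[OF u(3) W.comp_mem[OF s(2) v'W]] .
  moreover have "(u \<circ> (s \<circ> v')) c = int m" using v'c s(3) u(2) by simp
  ultimately show ?thesis by blast
qed

text \<open>Both m and its image lie on the same side of 2k, so the transport never uses the missing
  generator \<open>sgen (2 * int k)\<close>.\<close>

lemma blocks_transport:
  assumes w: "w \<in> blocks b n k" "w \<in> W_BC m" and m: "1 \<le> m" "m \<le> n" and p: "w (int m) > 0"
    and I: "{1..int n - 1} - {2 * int k} \<subseteq> I"
  shows "\<exists>u\<in>gen (sgen ` I). u \<in> W_BC m \<and> u (w (int m)) = int m"
proof -
  have le: "w (int m) \<le> int m" using W_BC_D(6)[OF w(2), of "int m"] p by simp
  have "\<bar>w (int m)\<bar> \<le> 2 * int k \<longleftrightarrow> \<bar>int m\<bar> \<le> 2 * int k" using w(1) unfolding blocks_def by blast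
  hence "2 * int k \<notin> {w (int m)..int m - 1}" using p by auto
  hence "{w (int m)..int m - 1} \<subseteq> I" using I p m by auto
  thus ?thesis using transport_up[of "w (int m)" "int m" I] p le by auto
qed

lemma gen_A:
  assumes n: "n \<ge> 1"
  shows "gen (sgen ` ({1..int n - 1} - {2 * int k})) = blocks True n k"
proof
  show sub: "gen (sgen ` ({1..int n - 1} - {2 * int k})) \<subseteq> blocks True n k"
    using n by (intro gen_subset blocks_id blocks_comp image_subsetI sgen_blocks) auto
  show "blocks True n k \<subseteq> gen (sgen ` ({1..int n - 1} - {2 * int k}))"
  proof
    fix w assume w: "w \<in> blocks True n k"
    show "w \<in> gen (sgen ` ({1..int n - 1} - {2 * int k}))"
    proof (rule gen_sufficient[OF _ sub blocks_comp _ w])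
      show "w \<in> W_BC n" using w unfolding blocks_def signed_perms_def by blast
      fix m w assume m: "1 \<le> m" "m \<le> n" and w: "w \<in> blocks True n k" "w \<in> W_BC m"
      have "w (int m) > 0" using w(1) m(1) unfolding blocks_def signed_perms_def by auto
      thus "\<exists>u\<in>gen (sgen ` ({1..int n - 1} - {2 * int k})). u \<in> W_BC m \<and> u (w (int m)) = int m"
        by (rule blocks_transport[OF w m _ subset_refl])
    qed auto
  qed
qed

lemma gen_BC:
  assumes n: "n \<ge> 1"
  shows "gen (sgen ` ({0..int n - 1} - {2 * int k})) = blocks False n k"
proof
  let ?I = "{0..int n - 1} - {2 * int k}"
  show sub: "gen (sgen ` ?I) \<subseteq> blocks False n k"
    using n by (intro gen_subset blocks_id blocks_comp image_subsetI sgen_blocks) auto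
  show "blocks False n k \<subseteq> gen (sgen ` ?I)"
  proof
    fix w assume w: "w \<in> blocks False n k"
    show "w \<in> gen (sgen ` ?I)"
    proof (rule gen_sufficient[OF _ sub blocks_comp _ w])
      show "w \<in> W_BC n" using w unfolding blocks_def signed_perms_def by blast
      fix m w assume m: "1 \<le> m" "m \<le> n" and w: "w \<in> blocks False n k" "w \<in> W_BC m"
      show "\<exists>u\<in>gen (sgen ` ?I). u \<in> W_BC m \<and> u (w (int m)) = int m"
      proof (cases "w (int m) > 0")
        case True
        thus ?thesis by (rule blocks_transport[OF w m]) auto
      next
        case False
        moreover have "w (int m) \<noteq> 0" using W_BC_D(5)[OF w(2), of "int m"] m by simp
        ultimately have neg: "w (int m) < 0" by simp
        \<comment> \<open>A negative image of m is possible only inside the block, so k is positive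
          and \<open>sgen 0\<close> has not been removed.\<close>
        have le: "int m \<le> 2 * int k" using w(1) False unfolding blocks_def by force
        have "0 \<in> ?I" using le m by auto
        hence "sgen 0 \<in> gen (sgen ` ?I)" by (intro gen_incl imageI)
        moreover have "sgen 0 \<in> W_BC m" using m by (intro sgen_W_BC) auto
        moreover have "- w (int m) \<le> int m" using W_BC_D(6)[OF w(2), of "int m"] neg by simp
        ultimately show ?thesis using neg m le by (intro neg_transport[of ?I m "sgen 0" 1]) (auto simp: sgen_def)
      qed
    qed auto
  qed
qed

lemma sgen_W_D:
  assumes "i \<in> {-1} \<union> {1..int n - 1}" "n \<ge> 2"
  shows "sgen i \<in> W_D n"
proof -
  have W: "sgen i \<in> W_BC n" using assms by (intro sgen_W_BC) auto
  have "even (card (negs n (sgen i)))"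
  proof (cases "i = -1")
    case True
    have "negs n (sgen i) = {1, 2}" unfolding True negs_def using assms(2) by (auto simp: sgen_def)
    thus ?thesis by simp
  next
    case False
    hence "i \<ge> 1" using assms(1) by auto
    hence "\<not> sgen i x < 0" if "x \<in> {1..int n}" for x using sgen_pos[of i x] that by simp
    hence "negs n (sgen i) = {}" unfolding negs_def by blast
    thus ?thesis by simp
  qed
  thus ?thesis using W by (simp add: W_D_iff)
qed

lemma gen_D:
  assumes n: "n \<ge> 2" and k: "k \<ge> 1"
  shows "gen (sgen ` (({-1} \<union> {1..int n - 1}) - {2 * int k})) = blocks False n k \<inter> W_D n"
proof
  let ?I = "({-1} \<union> {1..int n - 1}) - {2 * int k}"
  have comp: "u \<circ> v \<in> blocks False n k \<inter> W_D n" if "u \<in> blocks False n k \<inter> W_D n" "v \<in> blocks False n k \<inter> W_D n" for u v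
    using that blocks_comp perm_group.comp_mem[OF W_D_perm_group] by blast
  have gI: "sgen i \<in> blocks False n k \<inter> W_D n" if "i \<in> ?I" for i
    using that n k sgen_W_D[of i n] by (intro IntI sgen_blocks) auto
  show sub: "gen (sgen ` ?I) \<subseteq> blocks False n k \<inter> W_D n"
    using gI blocks_id perm_group.id_mem[OF W_D_perm_group] by (intro gen_subset comp image_subsetI IntI) auto
  show "blocks False n k \<inter> W_D n \<subseteq> gen (sgen ` ?I)"
  proof
    fix w assume w: "w \<in> blocks False n k \<inter> W_D n"
    show "w \<in> gen (sgen ` ?I)"
    proof (rule gen_sufficient[OF _ sub comp _ w])
      show "w \<in> W_BC n" using w unfolding blocks_def signed_perms_def by blast
      fix m w assume m: "1 \<le> m" "m \<le> n" and w': "w \<in> blocks False n k \<inter> W_D n" and wm: "w \<in> W_BC m"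
      have w: "w \<in> blocks False n k" using w' by blast
      show "\<exists>u\<in>gen (sgen ` ?I). u \<in> W_BC m \<and> u (w (int m)) = int m"
      proof (cases "w (int m) > 0")
        case True
        thus ?thesis by (rule blocks_transport[OF w wm m]) auto
      next
        case False
        moreover have "w (int m) \<noteq> 0" using W_BC_D(5)[OF wm, of "int m"] m by simp
        ultimately have neg: "w (int m) < 0" by simp
        have le: "int m \<le> 2 * int k" using w False unfolding blocks_def by force
        have b: "- w (int m) \<le> int m" using W_BC_D(6)[OF wm, of "int m"] neg by simp
        \<comment> \<open>\<open>sgen (-1)\<close> needs room for the points 1 and 2. With m = 1 the
          element would have exactly one sign change, contrary to type D.\<close>
        have "m \<noteq> 1"
        proof
          assume m1: "m = 1"
          have "negs n w = {1}"
          proof (rule Set.set_eqI)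
            fix i
            have "w i = i" if "i > 1" using W_BC_D(3)[OF wm, of i] that m1 by simp
            thus "i \<in> negs n w \<longleftrightarrow> i \<in> {1}" using neg m1 n by (cases "i > 1") (auto simp: negs_def)
          qed
          thus False using w' by (simp add: W_D_iff)
        qed
        hence m2: "m \<ge> 2" using m by simp
        have "-1 \<in> ?I" by auto
        hence "sgen (-1) \<in> gen (sgen ` ?I)" by (intro gen_incl imageI)
        moreover have "sgen (-1) \<in> W_BC m" using m2 by (intro sgen_W_BC) auto
        ultimately show ?thesis using neg b m m2 le by (intro neg_transport[of ?I m "sgen (-1)" 2]) (auto simp: sgen_def)
      qed
    qed auto
  qed
qed

text \<open>The product of the sign of \<open>w\<close> and the sign of \<open>i \<mapsto> \<bar>w i\<bar>\<close> is \<open>-1\<close> on every generator of each of the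
  three types, so it computes the parity of the length in all of them.\<close>

definition absp :: "perm \<Rightarrow> perm" where "absp w = (\<lambda>i. if i > 0 then \<bar>w i\<bar> else i)"

definition eps :: "perm \<Rightarrow> int" where "eps w = sign w * sign (absp w)"

lemma absp_comp:
  assumes "v \<in> W_BC n" "w \<in> W_BC n"
  shows "absp (v \<circ> w) = absp v \<circ> absp w"
proof
  fix i
  show "absp (v \<circ> w) i = (absp v \<circ> absp w) i"
  proof (cases "i > 0")
    case True
    hence "w i \<noteq> 0" using W_BC_D(5)[OF assms(2), of i] by simp
    thus ?thesis using True W_BC_D(2)[OF assms(1), of "w i"] by (cases "w i > 0") (simp_all add: absp_def)
  qed (simp add: absp_def)
qed

lemma absp_permutation:
  assumes w: "w \<in> W_BC n"
  shows "permutation (absp w)"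
proof -
  interpret W: perm_group "W_BC n" by (rule W_BC_perm_group)
  have i: "absp id = id" by (simp add: absp_def fun_eq_iff)
  have "absp w \<circ> absp (pinv w) = id" "absp (pinv w) \<circ> absp w = id"
    unfolding absp_comp[OF w W.inv_mem[OF w], symmetric] absp_comp[OF W.inv_mem[OF w] w, symmetric]
      W.comp_inv[OF w] W.inv_comp[OF w] i by (rule refl)+
  hence "bij (absp w)" by (intro o_bij[of "absp (pinv w)"])
  moreover have "{x. absp w x \<noteq> x} \<subseteq> {1..int n}"
  proof
    fix x assume "x \<in> {x. absp w x \<noteq> x}"
    hence x: "x > 0" "\<bar>w x\<bar> \<noteq> x" by (auto simp: absp_def split: if_splits)
    have "\<not> \<bar>x\<bar> > int n"
    proof
      assume "\<bar>x\<bar> > int n"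
      from W_BC_D(3)[OF w this] x show False by simp
    qed
    thus "x \<in> {1..int n}" using x(1) by simp
  qed
  hence "finite {x. absp w x \<noteq> x}" by (rule finite_subset) simp
  ultimately show ?thesis by (simp add: permutation)
qed

lemma eps_comp:
  assumes "v \<in> W_BC n" "w \<in> W_BC n"
  shows "eps (v \<circ> w) = eps v * eps w"
  unfolding eps_def absp_comp[OF assms]
    sign_compose[OF W_BC_permutation[OF assms(1)] W_BC_permutation[OF assms(2)]]
    sign_compose[OF absp_permutation[OF assms(1)] absp_permutation[OF assms(2)]]
  by (simp only: ac_simps)

text \<open>On signed points \<open>sgen 0\<close> is one transposition, and it is trivial on
  absolute values. Every other generator is a product of two transpositions, but a single one on
  absolute values.\<close>

lemma eps_sgen:
  assumes "i \<ge> -1"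
  shows "eps (sgen i) = -1"
proof -
  consider "i = 0" | "i = -1" | "i \<ge> 1" using assms by force
  thus ?thesis
  proof cases
    case 1
    have "sgen i = transpose 1 (-1)" unfolding 1 by (auto simp: sgen_def fun_eq_iff transpose_def)
    moreover have "absp (sgen i) = id" unfolding 1 by (auto simp: sgen_def absp_def fun_eq_iff)
    ultimately show ?thesis unfolding eps_def by (simp add: sign_swap_id)
  next
    case 2
    have "sgen i = transpose 1 (-2) \<circ> transpose (-1) 2" unfolding 2 by (auto simp: sgen_def fun_eq_iff transpose_def)
    hence "sign (sgen i) = 1" using sign_compose[OF permutation_swap_id permutation_swap_id, of "1::int" "-2" "-1" 2] by (simp add: sign_swap_id)
    moreover have "absp (sgen i) = transpose 1 2" unfolding 2 by (auto simp: sgen_def absp_def fun_eq_iff transpose_def)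
    ultimately show ?thesis unfolding eps_def by (simp add: sign_swap_id)
  next
    case 3
    have "sgen i = transpose i (i + 1) \<circ> transpose (- i) (- i - 1)" using 3 by (auto simp: sgen_def fun_eq_iff transpose_def)
    hence "sign (sgen i) = 1" using sign_compose[OF permutation_swap_id permutation_swap_id, of i "i + 1" "- i" "- i - 1"]
      by (simp add: sign_swap_id)
    moreover have "absp (sgen i) = transpose i (i + 1)" using 3 by (auto simp: sgen_def absp_def fun_eq_iff transpose_def)
    ultimately show ?thesis unfolding eps_def by (simp add: sign_swap_id)
  qed
qed

lemma clength_attained:
  assumes "u \<in> gen S"
  shows "\<exists>ws. set ws \<subseteq> S \<and> length ws = clength S u \<and> wprod ws = u"
proof -
  obtain ws where "set ws \<subseteq> S" "u = wprod ws" using assms unfolding gen_def by blast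
  hence "\<exists>m. \<exists>ws. set ws \<subseteq> S \<and> length ws = m \<and> wprod ws = u" by blast
  from LeastI_ex[OF this] show ?thesis unfolding clength_def .
qed

text \<open>Multiplicativity of \<open>eps\<close> makes the parity of a shortest word a function of
  u alone, the same for all the generating sets considered.\<close>

lemma sgnC_eps:
  assumes I: "\<And>i. i \<in> I \<Longrightarrow> i \<ge> -1" "sgen ` I \<subseteq> W_BC n" and u: "u \<in> gen (sgen ` I)"
  shows "sgnC (sgen ` I) u = of_int (eps u)"
proof -
  obtain ws where ws: "set ws \<subseteq> sgen ` I" "length ws = clength (sgen ` I) u" "wprod ws = u"
    using clength_attained[OF u] by blast
  have "set ws \<subseteq> sgen ` I \<Longrightarrow> wprod ws \<in> W_BC n \<and> eps (wprod ws) = (-1) ^ length ws" for ws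
  proof (induction ws)
    case Nil
    have "absp id = id" by (simp add: absp_def fun_eq_iff)
    hence "eps id = 1" unfolding eps_def by (simp only: sign_id mult_1)
    thus ?case unfolding wprod_simps using perm_group.id_mem[OF W_BC_perm_group] by (simp only: list.size power_0 simp_thms)
  next
    case (Cons s ws)
    hence ih: "wprod ws \<in> W_BC n" "eps (wprod ws) = (-1) ^ length ws" by auto
    obtain i where i: "i \<in> I" "s = sgen i" using Cons.prems by auto
    have sW: "s \<in> W_BC n" using I(2) i by auto
    have es: "eps s = -1" unfolding i(2) by (rule eps_sgen[OF I(1)[OF i(1)]])
    show ?case unfolding wprod_simps eps_comp[OF sW ih(1)] ih(2) es
      using perm_group.comp_mem[OF W_BC_perm_group sW ih(1)] by (simp only: list.size add_0_right power_Suc add_Suc_right simp_thms)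
  qed
  from this[OF ws(1)] ws(2,3) show ?thesis unfolding sgnC_def by simp
qed

text \<open>A positive element acts on the negative half as a copy of its action on the positive
  half. Its sign on all signed points is therefore a square, and only the factor from absolute
  values remains.\<close>

lemma eps_positive:
  assumes u: "u \<in> signed_perms True n"
  shows "eps u = sign (restr {i. i > 0} u)"
proof -
  have uW: "u \<in> W_BC n" using u by (rule signed_perms_W_BC)
  note U = W_BC_D[OF uW]
  have pos: "u i > 0" if "i > 0" for i using u that by (simp add: signed_perms_def)
  have sgn: "u i > 0 \<longleftrightarrow> i > 0" "u i < 0 \<longleftrightarrow> i < 0" for i
  proof -
    consider "i > 0" "u i > 0" | "i = 0" "u i = 0" | "i < 0" "u i < 0"
      using pos[of i] pos[of "- i"] U(2)[of i] U(4) by (metis linorder_neqE_linordered_idom neg_0_less_iff_less)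
    thus "u i > 0 \<longleftrightarrow> i > 0" "u i < 0 \<longleftrightarrow> i < 0" by (cases; simp)+
  qed
  have P: "permutation u" by (rule W_BC_permutation[OF uW])
  \<comment> \<open>Negation cut off at n, so that it has finite support; u does nothing beyond
    n.\<close>
  define N where "N = (\<lambda>i::int. if \<bar>i\<bar> \<le> int n then - i else i)"
  have NN: "N (N i) = i" for i by (simp add: N_def)
  have Nb: "bij N" by (rule o_bij[of N]) (simp_all add: fun_eq_iff NN)
  have "{x. N x \<noteq> x} \<subseteq> {- int n..int n}" by (auto simp: N_def split: if_splits)
  hence "finite {x. N x \<noteq> x}" by (rule finite_subset) simp
  hence NP: "permutation N" using Nb by (simp add: permutation)
  define r where "r = restr {i. i > 0} u"
  define r' where "r' = restr {i. i < 0} u"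
  have rP: "permutation r" "permutation r'"
    unfolding r_def r'_def by (rule permutation_restr[OF P], unfold mem_Collect_eq, rule sgn)+
  have "r' = N \<circ> (r \<circ> N)"
  proof
    fix i
    show "r' i = (N \<circ> (r \<circ> N)) i"
    proof (cases "\<bar>i\<bar> \<le> int n")
      case True
      have "\<bar>u (- i)\<bar> \<le> int n" using U(6)[of "- i"] True by simp
      thus ?thesis using True U(2)[of i] by (auto simp: r'_def r_def restr_def N_def)
    next
      case False
      hence "u i = i" using U(3)[of i] by simp
      thus ?thesis using False by (auto simp: r'_def r_def restr_def N_def)
    qed
  qed
  hence "sign r' = sign N * (sign r * sign N)"
    using sign_compose[OF NP permutation_compose[OF rP(1) NP]] sign_compose[OF rP(1) NP] by simp
  also have "\<dots> = (sign N * sign N) * sign r" by (simp only: ac_simps)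
  also have "\<dots> = sign r" by simp
  finally have e: "sign r' = sign r" .
  have "u = restr ({i. i > 0} \<union> {i. i < 0}) u"
  proof
    fix i
    show "u i = restr ({i. i > 0} \<union> {i. i < 0}) u i" using U(4) by (cases "i = 0") (auto simp: restr_def)
  qed
  moreover have "sign (restr ({i. i > 0} \<union> {i. i < 0}) u) = sign r * sign r'" unfolding r_def r'_def

    by (rule sign_restr_Un[OF P], unfold mem_Collect_eq, (rule sgn)+) auto
  ultimately have "sign u = sign r * sign r'" by simp
  hence "sign u = 1" unfolding e by simp
  moreover have "absp u = r"
  proof
    fix i
    show "absp u i = r i"
    proof (cases "i > 0")
      case True
      thus ?thesis using pos[OF True] by (simp add: absp_def r_def restr_def)
    qed (simp add: absp_def r_def restr_def)
  qed
  ultimately show ?thesis unfolding eps_def r_def by simp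
qed

text \<open>The second component of h has no sign changes, so it is a product of the generators with
  indices 1, ..., n - 1, and the parity of its length is an ordinary sign. It acts only beyond 2k,
  so its positive half may be replaced by the fixed points of \<open>base k\<close>; the extra point
  0 is fixed anyway.\<close>

lemma sigma_k_sign:
  assumes I: "\<And>i. i \<in> I \<Longrightarrow> i \<ge> -1" "sgen ` I \<subseteq> W_BC n" "{1..int n - 1} \<subseteq> I" and n: "n \<ge> 1"
    and h: "h \<in> blocks b n k"
  shows "sigma_k (sgen ` I) k h = of_int (sign (restr {i. base k i = i} h))"
proof -
  have hW: "h \<in> W_BC n" using h unfolding blocks_def signed_perms_def by blast
  note H = W_BC_D[OF hW]
  have bl: "\<bar>h i\<bar> \<le> 2 * int k \<longleftrightarrow> \<bar>i\<bar> \<le> 2 * int k" and pos: "i > 2 * int k \<Longrightarrow> h i > 0" for i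
    using h unfolding blocks_def by blast+
  define u where "u = comp2 k h"
  have ur: "u = restr {i. \<bar>i\<bar> > 2 * int k} h" unfolding u_def comp2_def restr_def by simp
  have "permutation u" unfolding ur
  proof (rule permutation_restr[OF W_BC_permutation[OF hW]])
    show "h i \<in> {i. \<bar>i\<bar> > 2 * int k} \<longleftrightarrow> i \<in> {i. \<bar>i\<bar> > 2 * int k}" for i using bl[of i] by auto
  qed
  hence "bij u" by (simp add: permutation)
  moreover have "u (- i) = - u i" for i using H(2)[of i] by (simp add: ur restr_def)
  moreover have "u i = i" if "\<bar>i\<bar> > int n" for i using H(3)[OF that] by (simp add: ur restr_def)
  moreover have "u i > 0" if "i > 0" for i using pos[of i] that by (simp add: ur restr_def)
  ultimately have uS: "u \<in> signed_perms True n" by (simp add: signed_perms_def W_BC_def)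
  have "u \<in> blocks True n 0"
  proof -
    have "\<bar>u i\<bar> \<le> 0 \<longleftrightarrow> \<bar>i\<bar> \<le> 0" for i using W_BC_D(5)[OF signed_perms_W_BC[OF uS], of i] by simp
    thus ?thesis using uS unfolding blocks_def signed_perms_def by simp
  qed
  hence "u \<in> gen (sgen ` ({1..int n - 1} - {2 * int 0}))" unfolding gen_A[OF n] .
  moreover have "sgen ` ({1..int n - 1} - {2 * int 0}) \<subseteq> sgen ` I" using I(3) by blast
  ultimately have "u \<in> gen (sgen ` I)" using gen_mono by blast
  hence "sgnC (sgen ` I) u = of_int (eps u)" by (intro sgnC_eps[OF _ I(2)] I(1))
  also have "eps u = sign (restr {i. i > 0} u)" by (rule eps_positive[OF uS])
  also have "restr {i. i > 0} u = restr {i. base k i = i} h"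
  proof
    fix i
    show "restr {i. i > 0} u i = restr {i. base k i = i} h i"
      unfolding ur restr_def using H(4) by (auto simp: base_fix_iff)
  qed
  finally show ?thesis unfolding sigma_k_def u_def .
qed

section \<open>Model triples\<close>

lemma zz_base_moved:
  assumes "a \<noteq> 0" "\<bar>a\<bar> \<le> 2 * int k"
  shows "zz k a \<noteq> 0" "zz k a \<noteq> a" "zz k a \<noteq> - a"
  using base_moved[OF assms] assms by (simp_all add: zz_def)

lemma zz_odd: "zz k (- i) = - zz k i"
  using W_BC_D(2)[OF zz_W_BC[of k "2 * k"]] by simp

lemma refl_at_disjoint:
  assumes "{a, c, - a, - c} \<inter> {a2, c2, - a2, - c2} = {}"
  shows "refl_at a c (refl_at a2 c2 x) = refl_at a2 c2 (refl_at a c x)"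
proof -
  have fx: "refl_at a c x = x" if "x \<notin> {a, c, - a, - c}" for a c x using that by (simp add: refl_at_def)
  have mem: "refl_at a c x \<in> {a, c, - a, - c}" if "x \<in> {a, c, - a, - c}" for a c x
    using that unfolding refl_at_def by auto
  consider "x \<in> {a, c, - a, - c}" "x \<notin> {a2, c2, - a2, - c2}" | "x \<notin> {a, c, - a, - c}" "x \<in> {a2, c2, - a2, - c2}"
    | "x \<notin> {a, c, - a, - c}" "x \<notin> {a2, c2, - a2, - c2}" using assms by blast
  thus ?thesis
  proof cases
    case 1
    have "refl_at a c x \<notin> {a2, c2, - a2, - c2}" using mem[OF 1(1)] assms by blast
    from fx[OF this] fx[OF 1(2)] show ?thesis by (simp only:)
  next
    case 2
    have "refl_at a2 c2 x \<notin> {a, c, - a, - c}" using mem[OF 2(2)] assms by blast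
    from fx[OF this] fx[OF 2(1)] show ?thesis by (simp only:)
  next
    case 3
    show ?thesis by (simp only: fx[OF 3(1)] fx[OF 3(2)])
  qed
qed

text \<open>Conjugating the reflection by the involution gives either the same reflection, which
  happens when a and c lie outside the block or are swapped up to sign, or one with disjoint
  support. The two commute in both cases.\<close>

lemma refl_at_zz_commute:
  assumes a: "a \<noteq> 0" "c \<noteq> 0" "a \<noteq> c" and bl: "\<bar>a\<bar> \<le> 2 * int k \<longleftrightarrow> \<bar>c\<bar> \<le> 2 * int k"
  shows "refl_at a c (refl_at (zz k a) (zz k c) x) = refl_at (zz k a) (zz k c) (refl_at a c x)"
proof (cases "\<bar>a\<bar> \<le> 2 * int k")
  case False
  hence "zz k a = a" "zz k c = c" using bl by (simp_all add: zz_def)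
  thus ?thesis by simp
next
  case True
  hence cl: "\<bar>c\<bar> \<le> 2 * int k" using bl by simp
  define a2 where "a2 = zz k a"
  define c2 where "c2 = zz k c"
  have za: "zz k a2 = a" "zz k c2 = c" by (simp_all add: a2_def c2_def zz_zz)
  have A: "a2 \<noteq> 0" "a2 \<noteq> a" "a2 \<noteq> - a" using zz_base_moved[OF a(1) True] by (simp_all add: a2_def)
  have C: "c2 \<noteq> 0" "c2 \<noteq> c" "c2 \<noteq> - c" using zz_base_moved[OF a(2) cl] by (simp_all add: c2_def)
  consider "a2 = c" | "a2 = - c" | "a2 \<noteq> c" "a2 \<noteq> - c" by blast
  thus ?thesis unfolding a2_def[symmetric] c2_def[symmetric]
  proof cases
    case 1
    hence "c2 = a" using za(1) by (simp add: c2_def)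
    hence "refl_at a2 c2 = refl_at a c" using 1 by (auto simp: refl_at_def fun_eq_iff)
    thus "refl_at a c (refl_at a2 c2 x) = refl_at a2 c2 (refl_at a c x)" by simp
  next
    case 2
    have "c2 = - a" using za(1) 2 zz_odd[of k c] by (simp add: c2_def)
    hence "refl_at a2 c2 = refl_at a c" using 2 a by (auto simp: refl_at_def fun_eq_iff)
    thus "refl_at a c (refl_at a2 c2 x) = refl_at a2 c2 (refl_at a c x)" by simp
  next
    case 3
    have "c2 \<noteq> a" using 3 za(2) by (auto simp: a2_def)
    moreover have "c2 \<noteq> - a" using 3 za(2) zz_odd[of k a] by (auto simp: a2_def)
    ultimately have "{a, c, - a, - c} \<inter> {a2, c2, - a2, - c2} = {}" using A(2,3) C(2,3) 3 by auto
    thus "refl_at a c (refl_at a2 c2 x) = refl_at a2 c2 (refl_at a c x)" by (rule refl_at_disjoint)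
  qed
qed

lemma sgen_refl_block:
  assumes "i \<ge> -1" "i \<noteq> 2 * int k" "i \<le> 0 \<Longrightarrow> k \<ge> 1"
  shows "\<exists>a c. sgen i = refl_at a c \<and> a \<noteq> 0 \<and> c \<noteq> 0 \<and> a \<noteq> c \<and> (\<bar>a\<bar> \<le> 2 * int k \<longleftrightarrow> \<bar>c\<bar> \<le> 2 * int k)"
proof -
  consider "i = 0" | "i = -1" | "i \<ge> 1" using assms(1) by force
  thus ?thesis
  proof cases
    case 1
    show ?thesis unfolding 1 by (intro exI[of _ 1] exI[of _ "-1"] conjI sgen_refl(1)) auto
  next
    case 2
    hence "k \<ge> 1" using assms(3) by simp
    thus ?thesis unfolding 2 by (intro exI[of _ 1] exI[of _ "-2"] conjI sgen_refl(2)) auto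
  next
    case 3
    thus ?thesis using assms(2) by (intro exI[of _ i] exI[of _ "i + 1"] conjI sgen_refl(3)) auto
  qed
qed

lemma ppow_4: "ppow x 4 = pmul x (pmul x (pmul x (pmul x pone)))"
  by (simp add: ppow_def numeral_eq_Suc)

text \<open>With t' = z t z the fourth power of z t is the square of t' t, which is 1 because t and
  t' are commuting involutions. Every reflection is conjugate to a generator by an element
  preserving the block, so its two points lie on the same side of 2k.\<close>

lemma zmin_perfect:
  assumes I: "\<And>i. i \<in> I \<Longrightarrow> i \<ge> -1" "\<And>i. i \<in> I \<Longrightarrow> i \<noteq> 2 * int k" "\<And>i. i \<in> I \<Longrightarrow> i \<le> 0 \<Longrightarrow> k \<ge> 1"
    and sub: "gen (sgen ` I) \<subseteq> blocks b n k" and z: "zz k \<in> gen (sgen ` I)" and k: "2 * k \<le> n"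
  shows "zmin k \<in> perfect_inv (sgen ` I)"
proof -
  have "id \<in> autJ (sgen ` I)" unfolding autJ_def by (simp add: bij_betw_def)
  hence W: "zmin k \<in> Wplus (sgen ` I)" unfolding Wplus_def zmin_zz using z by simp
  have 2: "pmul (zmin k) (zmin k) = pone" by (simp add: zmin_zz pmul_def pone_def fun_eq_iff zz_zz)
  have "ppow (pmul (zmin k) (t, id)) 4 = pone" if t: "t \<in> reflections (sgen ` I)" for t
  proof -
    obtain w i where w: "w \<in> gen (sgen ` I)" and i: "i \<in> I" and t: "t = w \<circ> sgen i \<circ> pinv w"
      using t unfolding reflections_def by blast
    obtain a c where ac: "sgen i = refl_at a c" "a \<noteq> 0" "c \<noteq> 0" "a \<noteq> c" "\<bar>a\<bar> \<le> 2 * int k \<longleftrightarrow> \<bar>c\<bar> \<le> 2 * int k"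
      using sgen_refl_block[OF I(1)[OF i] I(2)[OF i] I(3)[OF i]] by blast
    have wb: "w \<in> blocks b n k" using sub w by blast
    have wW: "w \<in> W_BC n" using wb unfolding blocks_def signed_perms_def by blast
    have bl: "\<bar>w j\<bar> \<le> 2 * int k \<longleftrightarrow> \<bar>j\<bar> \<le> 2 * int k" for j using wb unfolding blocks_def by blast
    have t': "t = refl_at (w a) (w c)" unfolding t ac(1) by (rule refl_at_conj[OF wW])
    have ne: "w a \<noteq> 0" "w c \<noteq> 0" "w a \<noteq> w c" using ac W_BC_D(5)[OF wW] W_BC_inj[OF wW] by simp_all
    define t2 where "t2 = refl_at (zz k (w a)) (zz k (w c))"
    have "pinv (zz k) = zz k" by (rule inv_unique_comp) (simp_all add: fun_eq_iff zz_zz)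
    hence "zz k \<circ> t \<circ> zz k = t2" unfolding t' t2_def using refl_at_conj[OF zz_W_BC[OF k], of "w a" "w c"] by simp
    from fun_cong[OF this] have zt: "zz k (t (zz k x)) = t2 x" for x by (simp only: comp_apply)
    have com: "t (t2 x) = t2 (t x)" for x unfolding t' t2_def by (rule refl_at_zz_commute[OF ne]) (simp only: bl ac(5))
    have tt: "t (t x) = x" for x unfolding t' by (rule refl_at_involution[OF ne])
    have t22: "t2 (t2 x) = x" for x by (simp only: zt[symmetric] zz_zz tt)
    have "zz k (t (zz k (t (zz k (t (zz k (t x))))))) = x" for x
      by (simp only: zt com tt t22)
    thus ?thesis unfolding ppow_4 zmin_zz by (simp add: pmul_def pone_def fun_eq_iff)
  qed
  thus ?thesis unfolding perfect_inv_def using W 2 by blast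
qed

section \<open>Minimality of the involution\<close>

lemma zz_in_gen:
  assumes "\<And>j. j < k \<Longrightarrow> 2 * int j + 1 \<in> I"
  shows "zz k \<in> gen (sgen ` I)" "clength (sgen ` I) (zz k) \<le> k"
proof -
  define ws where "ws = map (\<lambda>j. sgen (2 * int j + 1)) [0..<k]"
  have "wprod ws = zz k" using zmin_zz[of k] by (simp add: zmin_def ws_def)
  moreover have "set ws \<subseteq> sgen ` I" using assms by (auto simp: ws_def)
  moreover have "length ws = k" by (simp add: ws_def)
  ultimately have ex: "\<exists>ws. set ws \<subseteq> sgen ` I \<and> length ws = k \<and> wprod ws = zz k" by blast
  then obtain ws' where "set ws' \<subseteq> sgen ` I" "zz k = wprod ws'" by metis
  thus "zz k \<in> gen (sgen ` I)" unfolding gen_def by (intro CollectI exI[of _ ws'] conjI)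
  show "clength (sgen ` I) (zz k) \<le> k" unfolding clength_def by (rule Least_le) (rule ex)
qed

lemma sgen_moves_four: "i \<ge> -1 \<Longrightarrow> finite {x. sgen i x \<noteq> x} \<and> card {x. sgen i x \<noteq> x} \<le> 4"
proof -
  assume i: "i \<ge> -1"
  consider "i = 0" | "i = -1" | "i \<ge> 1" using i by force
  hence "\<exists>a c. sgen i = refl_at a c"
  proof cases
    case 1
    show ?thesis unfolding 1 sgen_refl(1) by (rule exI, rule exI, rule refl)
  next
    case 2
    show ?thesis unfolding 2 sgen_refl(2) by (rule exI, rule exI, rule refl)
  next
    case 3
    show ?thesis unfolding sgen_refl(3)[OF 3] by (rule exI, rule exI, rule refl)
  qed
  then obtain a c where ac: "sgen i = refl_at a c" by (elim exE)
  have sub: "{x. sgen i x \<noteq> x} \<subseteq> set [a, c, - a, - c]" unfolding ac refl_at_def by auto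
  have "card {x. sgen i x \<noteq> x} \<le> card (set [a, c, - a, - c])" by (rule card_mono[OF _ sub]) simp
  also have "\<dots> \<le> length [a, c, - a, - c]" by (rule card_length)
  finally show ?thesis using finite_subset[OF sub] by simp
qed

lemma word_moves:
  assumes I: "\<And>i. i \<in> I \<Longrightarrow> i \<ge> -1" and ws: "set ws \<subseteq> sgen ` I"
  shows "finite {x. wprod ws x \<noteq> x} \<and> card {x. wprod ws x \<noteq> x} \<le> 4 * length ws"
  using ws
proof (induction ws)
  case Nil
  show ?case by (simp add: wprod_simps)
next
  case (Cons s ws)
  obtain i where i: "i \<in> I" "s = sgen i" using Cons.prems by auto
  have s: "finite {x. s x \<noteq> x}" "card {x. s x \<noteq> x} \<le> 4" using sgen_moves_four[OF I[OF i(1)]] i(2) by auto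
  have ih: "finite {x. wprod ws x \<noteq> x}" "card {x. wprod ws x \<noteq> x} \<le> 4 * length ws" using Cons by auto
  have sub: "{x. wprod (s # ws) x \<noteq> x} \<subseteq> {x. s x \<noteq> x} \<union> {x. wprod ws x \<noteq> x}"
  proof
    fix x assume "x \<in> {x. wprod (s # ws) x \<noteq> x}"
    hence "s (wprod ws x) \<noteq> x" by (simp add: wprod_simps)
    thus "x \<in> {x. s x \<noteq> x} \<union> {x. wprod ws x \<noteq> x}" by (cases "wprod ws x = x") auto
  qed
  have "card {x. wprod (s # ws) x \<noteq> x} \<le> card ({x. s x \<noteq> x} \<union> {x. wprod ws x \<noteq> x})"
    using s(1) ih(1) by (intro card_mono[OF _ sub]) simp
  also have "\<dots> \<le> 4 + 4 * length ws" using card_Un_le[of "{x. s x \<noteq> x}" "{x. wprod ws x \<noteq> x}"] s(2) ih(2) by linarith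
  finally show ?case using finite_subset[OF sub] s(1) ih(1) by simp
qed

lemma zz_moves: "{x. zz k x \<noteq> x} = {- (2 * int k)..2 * int k} - {0}"
proof (rule Set.set_eqI)
  fix i
  show "i \<in> {x. zz k x \<noteq> x} \<longleftrightarrow> i \<in> {- (2 * int k)..2 * int k} - {0}"
  proof (cases "i \<noteq> 0 \<and> \<bar>i\<bar> \<le> 2 * int k")
    case True
    thus ?thesis using zz_base_moved(2)[of i k] by (auto simp: abs_le_iff)
  next
    case False
    hence "zz k i = i" by (auto simp: zz_def base_def)
    thus ?thesis using False by auto
  qed
qed

lemma card_zz_moves: "card {x. zz k x \<noteq> x} = 4 * k"
  unfolding zz_moves by simp

lemma zmin_inj: "zmin k = zmin l \<Longrightarrow> k = l"
proof -
  assume "zmin k = zmin l"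
  hence eq: "zz k = zz l" unfolding zmin_zz by (rule Pair_inject)
  have "4 * k = 4 * l" unfolding card_zz_moves[symmetric] eq ..
  thus ?thesis by simp
qed

text \<open>Both lengths are compared with k. The defining word has length k, while every conjugate
  moves 4k points and a generator moves at most four, so no conjugate is shorter than k.\<close>

lemma zmin_minimal:
  assumes I: "\<And>i. i \<in> I \<Longrightarrow> i \<ge> -1" and J: "I' \<subseteq> I" and odds: "\<And>j. j < k \<Longrightarrow> 2 * int j + 1 \<in> I"
  shows "WJ_minimal (sgen ` I) (sgen ` I') (zmin k)"
  unfolding WJ_minimal_def
proof
  fix s assume "s \<in> sgen ` I'"
  then obtain i where i: "i \<in> I" "s = sgen i" using J by blast
  have ss: "s (s x) = x" for x using fun_cong[OF sgen_involution[OF I[OF i(1)]], of x] i(2) by simp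
  define u where "u = s \<circ> zz k \<circ> s"
  have "s \<in> gen (sgen ` I)" using i by (auto intro: gen_incl)
  hence ug: "u \<in> gen (sgen ` I)" unfolding u_def using gen_comp zz_in_gen(1)[of k I, OF odds] by blast
  obtain ws where ws: "set ws \<subseteq> sgen ` I" "length ws = clength (sgen ` I) u" "wprod ws = u"
    using clength_attained[OF ug] by blast
  have "{x. u x \<noteq> x} = s ` {x. zz k x \<noteq> x}"
  proof
    have *: "u x = x \<longleftrightarrow> zz k (s x) = s x" for x
    proof
      assume "u x = x"
      hence "s (s (zz k (s x))) = s x" by (simp add: u_def)
      thus "zz k (s x) = s x" by (simp only: ss)
    qed (simp add: u_def ss)
    show "{x. u x \<noteq> x} \<subseteq> s ` {x. zz k x \<noteq> x}"
    proof
      fix x assume "x \<in> {x. u x \<noteq> x}"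
      hence "s x \<in> {x. zz k x \<noteq> x}" using *[of x] by simp
      thus "x \<in> s ` {x. zz k x \<noteq> x}" using ss[of x] by (intro image_eqI[of _ _ "s x"]) simp_all
    qed
    show "s ` {x. zz k x \<noteq> x} \<subseteq> {x. u x \<noteq> x}"
    proof
      fix x assume "x \<in> s ` {x. zz k x \<noteq> x}"
      then obtain c where "x = s c" "zz k c \<noteq> c" by blast
      thus "x \<in> {x. u x \<noteq> x}" using *[of x] ss[of c] by simp
    qed
  qed
  moreover have "inj_on s {x. zz k x \<noteq> x}" using ss by (rule inj_on_inverseI)
  ultimately have "card {x. u x \<noteq> x} = 4 * k" by (simp add: card_image card_zz_moves)
  hence "4 * k \<le> 4 * length ws" using word_moves[OF I ws(1)] ws(3) by simp
  hence "k \<le> clength (sgen ` I) u" using ws(2) by simp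
  hence "clength (sgen ` I) (zz k) \<le> clength (sgen ` I) u" using zz_in_gen(2)[of k I, OF odds] by simp
  moreover have "fst (pmul (pmul (s, id) (zmin k)) (s, id)) = u" unfolding zmin_zz pmul_def u_def by simp
  ultimately show "clength (sgen ` I) (fst (zmin k)) \<le> clength (sgen ` I) (fst (pmul (pmul (s, id) (zmin k)) (s, id)))"
    unfolding zmin_zz by simp
qed

section \<open>The linear characters and the models of types A and BC\<close>

lemma blocks_fix_invariant:
  assumes h: "h \<in> blocks b n k"
  shows "h i \<in> {i. base k i = i} \<longleftrightarrow> i \<in> {i. base k i = i}"
proof -
  have hW: "h \<in> W_BC n" using h unfolding blocks_def signed_perms_def by blast
  note H = W_BC_D[OF hW]
  have bl: "\<bar>h i\<bar> \<le> 2 * int k \<longleftrightarrow> \<bar>i\<bar> \<le> 2 * int k" and pos: "i > 2 * int k \<Longrightarrow> h i > 0" for i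
    using h unfolding blocks_def by blast+
  have "h i = 0 \<or> h i > 2 * int k \<longleftrightarrow> i = 0 \<or> i > 2 * int k"
    using H(5)[of i] H(2)[of i] bl[of i] pos[of i] pos[of "- i"] by linarith
  thus ?thesis by (simp add: base_fix_iff)
qed

lemma sign_fix_hom:
  assumes v: "v \<in> blocks b n k" and w: "w \<in> blocks b n k"
  shows "sign (restr {i. base k i = i} (v \<circ> w)) = sign (restr {i. base k i = i} v) * sign (restr {i. base k i = i} w)"
proof -
  have W: "v \<in> W_BC n" "w \<in> W_BC n" using v w unfolding blocks_def signed_perms_def by blast+
  have "restr {i. base k i = i} (v \<circ> w) = restr {i. base k i = i} v \<circ> restr {i. base k i = i} w"
  proof
    fix i
    show "restr {i. base k i = i} (v \<circ> w) i = (restr {i. base k i = i} v \<circ> restr {i. base k i = i} w) i"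
      using blocks_fix_invariant[OF w, of i] by (simp add: restr_def)
  qed
  thus ?thesis
    using sign_compose[OF permutation_restr[OF W_BC_permutation[OF W(1)] blocks_fix_invariant[OF v]]
        permutation_restr[OF W_BC_permutation[OF W(2)] blocks_fix_invariant[OF w]]] by simp
qed

lemma sign_pm1: "(of_int (sign w) :: complex) \<in> {1, -1}"
  by (simp add: sign_def)

lemma linear_char_homI:
  assumes sub: "gen J \<subseteq> blocks b n k"
    and \<sigma>: "\<And>h. h \<in> blocks b n k \<Longrightarrow> \<sigma> h = of_int (sign (restr {i. base k i = i} h))"
  shows "linear_char_hom J \<sigma>"
  unfolding linear_char_hom_def
proof (intro conjI ballI)
  fix v assume v: "v \<in> gen J"
  hence vb: "v \<in> blocks b n k" using sub by blast
  show "\<sigma> v \<in> {1, -1}" unfolding \<sigma>[OF vb] by (rule sign_pm1)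
  fix w assume "w \<in> gen J"
  hence wb: "w \<in> blocks b n k" using sub by blast
  show "\<sigma> (v \<circ> w) = \<sigma> v * \<sigma> w" unfolding \<sigma>[OF vb] \<sigma>[OF wb] \<sigma>[OF blocks_comp[OF vb wb]] sign_fix_hom[OF vb wb] by simp
qed

lemma (in perm_group) commutant_perm_group: "perm_group {h \<in> G. h \<circ> y = y \<circ> h}"
proof
  show "finite {h \<in> G. h \<circ> y = y \<circ> h}" using finite_carrier by simp
  show "id \<in> {h \<in> G. h \<circ> y = y \<circ> h}" using id_mem by (simp only: mem_Collect_eq id_comp comp_id simp_thms)
  fix g assume "g \<in> {h \<in> G. h \<circ> y = y \<circ> h}"
  hence g: "g \<in> G" "g \<circ> y = y \<circ> g" by blast+
  show "bij g" by (rule bij_mem[OF g(1)])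
  show "g \<circ> h \<in> {h \<in> G. h \<circ> y = y \<circ> h}" if h': "h \<in> {h \<in> G. h \<circ> y = y \<circ> h}" for h
  proof -
    have h: "h \<in> G" "h \<circ> y = y \<circ> h" using h' by blast+
    have "(g \<circ> h) \<circ> y = g \<circ> (h \<circ> y)" by (rule o_assoc[symmetric])
    also have "\<dots> = (g \<circ> y) \<circ> h" unfolding h(2) by (rule o_assoc)
    also have "\<dots> = y \<circ> (g \<circ> h)" unfolding g(2) by (rule o_assoc[symmetric])
    finally show ?thesis using comp_mem[OF g(1) h(1)] by blast
  qed
  have "pinv g \<circ> y = pinv g \<circ> (y \<circ> g) \<circ> pinv g" unfolding o_assoc cancel(3)[OF g(1)] ..
  also have "pinv g \<circ> (y \<circ> g) = y" unfolding g(2)[symmetric] by (rule cancel(2)[OF g(1)])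
  finally show "pinv g \<in> {h \<in> G. h \<circ> y = y \<circ> h}" using inv_mem[OF g(1)] by blast
qed

lemma centraliser_zmin: "centraliser J (zmin k) = {w \<in> gen J. w \<circ> zz k = zz k \<circ> w}"
  unfolding centraliser_def zmin_zz pmul_def by simp

lemma induce_cong: "(\<And>h. h \<in> H \<Longrightarrow> \<psi> h = \<psi>' h) \<Longrightarrow> induce G H \<psi> g = induce G H \<psi>' g"
  unfolding induce_def by (intro arg_cong2[of _ _ _ _ "(/)"] sum.cong refl) auto

lemma signed_model_sum:
  assumes \<sigma>: "\<And>k h. h \<in> blocks b n k \<Longrightarrow> \<sigma> k h = of_int (sign (restr {i. base k i = i} h))"
    and g: "g \<in> signed_perms b n"
  shows "(\<Sum>k\<in>{0..n div 2}. induce (signed_perms b n) {h \<in> signed_perms b n. h \<circ> base k = base k \<circ> h} (\<sigma> k) g)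
    = (\<Sum>\<chi>\<in>Irr (signed_perms b n). \<chi> g)"
proof -
  interpret S: perm_group "signed_perms b n" by (rule signed_perms_perm_group)
  have bl: "h \<in> blocks b n k" if "h \<in> {h \<in> signed_perms b n. h \<circ> base k = base k \<circ> h}" for h k
    using that commutant_base[of h b n k] by blast
  show ?thesis
  proof (rule S.square_root_count_is_model[OF _ S.commutant_perm_group _ _ _ _ _ g])
    show "\<sigma> k h \<in> {1, -1}" if h: "h \<in> {h \<in> signed_perms b n. h \<circ> base k = base k \<circ> h}" for k h
      unfolding \<sigma>[OF bl[OF h]] by (rule sign_pm1)
    show "\<sigma> k (h \<circ> h') = \<sigma> k h * \<sigma> k h'" if h: "h \<in> {h \<in> signed_perms b n. h \<circ> base k = base k \<circ> h}"
      "h' \<in> {h \<in> signed_perms b n. h \<circ> base k = base k \<circ> h}" for k h h'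
      unfolding \<sigma>[OF bl[OF h(1)]] \<sigma>[OF bl[OF h(2)]] \<sigma>[OF blocks_comp[OF bl[OF h(1)] bl[OF h(2)]]]
        sign_fix_hom[OF bl[OF h(1)] bl[OF h(2)]] by simp
    show "\<exists>h\<in>signed_perms b n. h \<circ> x \<circ> pinv h = pinv x" if "x \<in> signed_perms b n" for x
      by (rule signed_perm.conjugate_to_inverse, unfold_locales, rule that)
    show "(\<Sum>k\<in>{0..n div 2}. induce (signed_perms b n) {h \<in> signed_perms b n. h \<circ> base k = base k \<circ> h} (\<sigma> k) x)
      = of_nat (card {w \<in> signed_perms b n. w \<circ> w = x})" if "x \<in> signed_perms b n" for x
    proof (rule sum_induced_eq_square_roots[OF _ that])
      show "\<sigma> k h = of_int (sign (restr {i. base k i = i} h))"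
        if "h \<in> signed_perms b n" "h \<circ> base k = base k \<circ> h" for k h using \<sigma> bl that by blast
    qed
  qed auto
qed

lemma commutant_eq: "{w \<in> blocks b n k. w \<circ> zz k = zz k \<circ> w} = {h \<in> signed_perms b n. h \<circ> base k = base k \<circ> h}"
proof -
  have "w \<in> signed_perms b n" if "w \<in> blocks b n k" for w using that unfolding blocks_def by blast
  thus ?thesis using commutant_base[of _ b n k] by blast
qed

text \<open>Types A and BC differ only in the index set I, which is {1..n-1} or {0..n-1}, and in the
  flag b.\<close>

lemma perfect_model_signed:
  assumes n: "n \<ge> 1" and I: "{1..int n - 1} \<subseteq> I" "I \<subseteq> {0..int n - 1}"
    and gI: "\<And>k. gen (sgen ` (I - {2 * int k})) = blocks b n k"
  shows "perfect_model (signed_perms b n) (sgen ` I)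
    ((\<lambda>k. (sgen ` (I - {2 * int k}), zmin k, sigma_k (sgen ` I) k)) ` {0..n div 2})"
proof -
  define f where "f k = (sgen ` (I - {2 * int k}), zmin k, sigma_k (sgen ` I) k)" for k
  have Ige: "i \<ge> -1" if "i \<in> I" for i using that I(2) by auto
  have IW: "sgen ` I \<subseteq> W_BC n"
  proof (rule image_subsetI)
    fix i assume "i \<in> I"
    thus "sgen i \<in> W_BC n" using I(2) n by (intro sgen_W_BC) auto
  qed
  note sig = sigma_k_sign[OF Ige IW I(1) n]
  have odds: "2 * int j + 1 \<in> I - {2 * int k}" if "k \<le> n div 2" "j < k" for j k
  proof -
    have "2 * int j + 1 \<in> {1..int n - 1}" using that by auto
    moreover have "2 * int j + 1 \<noteq> 2 * int k" by presburger
    ultimately show ?thesis using I(1) by blast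
  qed
  have mt: "model_triple (sgen ` I) (f k)" if k: "k \<le> n div 2" for k
  proof -
    have z: "zz k \<in> gen (sgen ` (I - {2 * int k}))" using odds[OF k] by (rule zz_in_gen(1))
    have "zmin k \<in> perfect_inv (sgen ` (I - {2 * int k}))"
    proof (rule zmin_perfect[OF _ _ _ _ z])
      show "i \<ge> -1" if "i \<in> I - {2 * int k}" for i using that Ige by blast
      show "i \<noteq> 2 * int k" if "i \<in> I - {2 * int k}" for i using that by blast
      show "k \<ge> 1" if "i \<in> I - {2 * int k}" "i \<le> 0" for i using that I(2) by force
      show "gen (sgen ` (I - {2 * int k})) \<subseteq> blocks b n k" unfolding gI by (rule subset_refl)
      show "2 * k \<le> n" using k by simp
    qed
    moreover have "WJ_minimal (sgen ` I) (sgen ` (I - {2 * int k})) (zmin k)"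
    proof (rule zmin_minimal[OF Ige])
      show "2 * int j + 1 \<in> I" if "j < k" for j using odds[OF k that] by blast
    qed auto
    moreover have "linear_char_hom (sgen ` (I - {2 * int k})) (sigma_k (sgen ` I) k)"
      by (rule linear_char_homI[of _ b n k]) (unfold gI, rule subset_refl, rule sig)
    ultimately show ?thesis unfolding model_triple_def f_def by auto
  qed
  \<comment> \<open>The model is a set of triples; injectivity in k turns the sum over it into a sum
    over k.\<close>
  have inj: "inj_on f {0..n div 2}" unfolding f_def using zmin_inj by (auto intro!: inj_onI)
  have cen: "centraliser (sgen ` (I - {2 * int k})) (zmin k) = {h \<in> signed_perms b n. h \<circ> base k = base k \<circ> h}" for k
    unfolding centraliser_zmin gI by (rule commutant_eq)
  have "(\<Sum>(J, z, \<sigma>)\<in>f ` {0..n div 2}. induce (signed_perms b n) (centraliser J z) \<sigma> g) = (\<Sum>\<chi>\<in>Irr (signed_perms b n). \<chi> g)"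
    if g: "g \<in> signed_perms b n" for g
  proof -
    have "(\<Sum>(J, z, \<sigma>)\<in>f ` {0..n div 2}. induce (signed_perms b n) (centraliser J z) \<sigma> g)
      = (\<Sum>k\<in>{0..n div 2}. induce (signed_perms b n) {h \<in> signed_perms b n. h \<circ> base k = base k \<circ> h} (sigma_k (sgen ` I) k) g)"
      unfolding sum.reindex[OF inj] by (rule sum.cong[OF refl]) (simp only: comp_apply f_def prod.case cen)
    also have "\<dots> = (\<Sum>\<chi>\<in>Irr (signed_perms b n). \<chi> g)" by (rule signed_model_sum[OF sig g])
    finally show ?thesis .
  qed
  thus ?thesis unfolding perfect_model_def f_def[symmetric] using mt by auto
qed

section \<open>Type D of odd rank\<close>

definition neg_one :: "nat \<Rightarrow> perm" where "neg_one n = (\<lambda>i. if \<bar>i\<bar> \<le> int n then - i else i)"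

lemma neg_one_facts:
  shows "neg_one n \<in> W_BC n" "neg_one n \<circ> neg_one n = id"
    "x \<in> W_BC n \<Longrightarrow> neg_one n \<circ> x = x \<circ> neg_one n" "odd n \<Longrightarrow> x \<in> W_BC n \<Longrightarrow> neg_one n \<circ> x \<in> W_D n \<longleftrightarrow> x \<notin> W_D n"
proof -
  have nn: "neg_one n (neg_one n i) = i" for i by (simp add: neg_one_def)
  thus "neg_one n \<circ> neg_one n = id" by (simp add: fun_eq_iff)
  have "bij (neg_one n)" by (rule o_bij[of "neg_one n"]) (simp_all add: fun_eq_iff nn)
  thus W: "neg_one n \<in> W_BC n" unfolding W_BC_def by (simp add: neg_one_def)
  show "neg_one n \<circ> x = x \<circ> neg_one n" if x: "x \<in> W_BC n"
  proof
    fix i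
    show "(neg_one n \<circ> x) i = (x \<circ> neg_one n) i"
      unfolding comp_apply neg_one_def W_BC_D(6)[OF x] using W_BC_D(2)[OF x] by simp
  qed
  show "neg_one n \<circ> x \<in> W_D n \<longleftrightarrow> x \<notin> W_D n" if n: "odd n" and x: "x \<in> W_BC n"
  proof -
    have "negs n (neg_one n) = {1..int n}" by (auto simp: negs_def neg_one_def)
    hence "odd (card (negs n (neg_one n)))" using n by simp
    thus ?thesis unfolding W_D_iff
      using even_negs_comp[OF W x] perm_group.comp_mem[OF W_BC_perm_group W x] x by blast
  qed
qed

text \<open>Multiplication by -1 exchanges the type D subgroup with its complement, because -1
  changes n signs and n is odd.\<close>

lemma sum_W_BC_odd:
  fixes F :: "perm \<Rightarrow> 'a :: comm_semiring_1"
  assumes n: "odd n" and F: "\<And>x. x \<in> W_BC n \<Longrightarrow> F (neg_one n \<circ> x) = F x"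
  shows "(\<Sum>x\<in>W_BC n. F x) = 2 * (\<Sum>x\<in>W_D n. F x)"
proof -
  note N = neg_one_facts[where n = n]
  have fin: "finite (W_BC n)" using perm_group.finite_carrier[OF W_BC_perm_group] .
  have DB: "W_D n \<subseteq> W_BC n" by (auto simp: W_D_iff)
  have NN: "neg_one n \<circ> (neg_one n \<circ> x) = x" for x unfolding o_assoc N(2) by simp
  have C: "neg_one n \<circ> x \<in> W_BC n" if "x \<in> W_BC n" for x using perm_group.comp_mem[OF W_BC_perm_group N(1) that] .
  have "(\<Sum>x\<in>W_BC n - W_D n. F x) = (\<Sum>x\<in>W_D n. F x)"
  proof (rule sum.reindex_bij_witness[of _ "\<lambda>x. neg_one n \<circ> x" "\<lambda>x. neg_one n \<circ> x"])
    fix x assume x: "x \<in> W_BC n - W_D n"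
    thus "neg_one n \<circ> x \<in> W_D n" using N(4)[OF n] by blast
    show "neg_one n \<circ> (neg_one n \<circ> x) = x" by (rule NN)
    show "F (neg_one n \<circ> x) = F x" using F x by blast
  next
    fix x assume x: "x \<in> W_D n"
    thus "neg_one n \<circ> x \<in> W_BC n - W_D n" using N(4)[OF n, of x] C[of x] DB by blast
    show "neg_one n \<circ> (neg_one n \<circ> x) = x" by (rule NN)
  qed
  moreover have "(\<Sum>x\<in>W_BC n. F x) = (\<Sum>x\<in>W_BC n - W_D n. F x) + (\<Sum>x\<in>W_D n. F x)"
    by (rule sum.subset_diff[OF DB fin])
  ultimately show ?thesis by (simp add: mult_2)
qed

lemma conj_neg_one:
  assumes x: "x \<in> W_BC n" and g: "g \<in> W_BC n"
  shows "(neg_one n \<circ> x) \<circ> g \<circ> pinv (neg_one n \<circ> x) = x \<circ> g \<circ> pinv x"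
proof -
  interpret W: perm_group "W_BC n" by (rule W_BC_perm_group)
  note N = neg_one_facts[where n = n]
  define w where "w = x \<circ> g \<circ> pinv x"
  have w: "w \<in> W_BC n" unfolding w_def by (rule W.comp_mem[OF W.comp_mem[OF x g] W.inv_mem[OF x]])
  have "(neg_one n \<circ> x) \<circ> g \<circ> pinv (neg_one n \<circ> x) = (neg_one n \<circ> w) \<circ> pinv (neg_one n)"
    unfolding W.inv_of_comp[OF N(1) x] w_def by (simp only: o_assoc)
  also have "\<dots> = w" unfolding N(3)[OF w] by (rule W.cancel(3)[OF N(1)])
  finally show ?thesis unfolding w_def .
qed

text \<open>Conjugation does not see the central element -1, so the inducing sum doubles, while H
  and with it the divisor stay the same.\<close>

lemma induce_W_D_odd:
  assumes n: "odd n" and g: "g \<in> W_D n"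
  shows "induce (W_BC n) H \<psi> g = 2 * induce (W_D n) H \<psi> g"
proof -
  have gB: "g \<in> W_BC n" using g by (simp add: W_D_iff)
  have "(\<Sum>x\<in>W_BC n. if x \<circ> g \<circ> pinv x \<in> H then \<psi> (x \<circ> g \<circ> pinv x) else 0)
    = 2 * (\<Sum>x\<in>W_D n. if x \<circ> g \<circ> pinv x \<in> H then \<psi> (x \<circ> g \<circ> pinv x) else 0)"
    by (rule sum_W_BC_odd[OF n]) (simp only: conj_neg_one[OF _ gB])
  thus ?thesis unfolding induce_def by simp
qed

lemma card_roots_W_D_odd:
  assumes n: "odd n"
  shows "card {x \<in> W_BC n. x \<circ> x = g} = 2 * card {x \<in> W_D n. x \<circ> x = g}"
proof -
  note N = neg_one_facts[where n = n]
  have sq: "(neg_one n \<circ> x) \<circ> (neg_one n \<circ> x) = x \<circ> x" if x: "x \<in> W_BC n" for x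
  proof -
    have "(neg_one n \<circ> x) \<circ> (neg_one n \<circ> x) = (neg_one n \<circ> x) \<circ> (x \<circ> neg_one n)" by (simp only: N(3)[OF x])
    also have "\<dots> = (neg_one n \<circ> (x \<circ> x)) \<circ> neg_one n" by (simp only: o_assoc)
    also have "\<dots> = ((x \<circ> x) \<circ> neg_one n) \<circ> neg_one n"
      by (simp only: N(3)[OF perm_group.comp_mem[OF W_BC_perm_group x x]])
    also have "\<dots> = (x \<circ> x) \<circ> (neg_one n \<circ> neg_one n)" by (simp only: o_assoc)
    finally show ?thesis unfolding N(2) comp_id .
  qed
  have fin: "finite (W_BC n)" "finite (W_D n)"
    using perm_group.finite_carrier[OF W_BC_perm_group] perm_group.finite_carrier[OF W_D_perm_group] by blast+
  have c: "card {x \<in> A. x \<circ> x = g} = (\<Sum>x\<in>A. if x \<circ> x = g then 1 else 0)" if "finite A" for A :: "perm set"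
    using that by (simp add: sum.inter_filter[symmetric])
  have "(\<Sum>x\<in>W_BC n. if x \<circ> x = g then 1 else 0) = 2 * (\<Sum>x\<in>W_D n. if x \<circ> x = g then 1 else (0::nat))"
    by (rule sum_W_BC_odd[OF n]) (simp only: sq)
  thus ?thesis unfolding c[OF fin(1)] c[OF fin(2)] .
qed

text \<open>The count of square roots known in type BC is halved on both sides. It has to be checked
  that the inducing subgroups agree in both types: the centralizers lie in type D by
  \<open>commutant_even_negs\<close>, and the separate triple of the symmetric group supplies k =
  0.\<close>

lemma perfect_model_D_odd:
  assumes n: "odd n" "n \<ge> 2"
  shows "perfect_model (W_D n) (gens_D n) (P_D n)"
proof -
  define I where "I = {-1} \<union> {1..int n - 1}"
  have S: "gens_D n = sgen ` I" by (simp add: gens_D_def I_def)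
  define J where "J k = sgen ` (I - {2 * int k})" for k
  define f where "f k = (J k, zmin k, sigma_k (sgen ` I) k)" for k
  define e where "e = (sgen ` {1..int n - 1}, (id :: perm, id :: autom), sgnC (sgen ` I))"
  have P: "P_D n = f ` {1..n div 2} \<union> {e}" unfolding P_D_def S f_def J_def e_def I_def ..
  define H where "H k = {h \<in> W_BC n. h \<circ> base k = base k \<circ> h}" for k
  interpret D: perm_group "W_D n" by (rule W_D_perm_group)
  interpret B: perm_group "W_BC n" by (rule W_BC_perm_group)
  have Ige: "i \<ge> -1" if "i \<in> I" for i using that by (auto simp: I_def)
  have IW: "sgen ` I \<subseteq> W_BC n"
  proof (rule image_subsetI)
    fix i assume "i \<in> I"
    thus "sgen i \<in> W_BC n" using n by (intro sgen_W_BC) (auto simp: I_def)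
  qed
  have I1: "{1..int n - 1} \<subseteq> I" by (auto simp: I_def)
  have n1: "n \<ge> 1" using n by simp
  have sig: "sigma_k (sgen ` I) k h = of_int (sign (restr {i. base k i = i} h))" if h: "h \<in> blocks False n k" for h k
    using sigma_k_sign[OF _ IW I1 n1 h] Ige by blast
  have Hbl: "H k = {w \<in> blocks False n k. w \<circ> zz k = zz k \<circ> w}" for k
    unfolding H_def commutant_eq by simp
  have HD: "H k \<subseteq> W_D n" if "k \<le> n div 2" for k
    unfolding Hbl using commutant_even_negs[of _ False n k] that by auto
  have genJ: "gen (J k) = blocks False n k \<inter> W_D n" if "k \<ge> 1" for k
    unfolding J_def I_def by (rule gen_D[OF n(2) that])
  have genA: "gen (sgen ` {1..int n - 1}) = blocks True n 0"
    using gen_A[OF n1, of 0] by simp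
  \<comment> \<open>For k = 0, membership in \<open>blocks\<close> already forces positivity on all
    positive points, so the flag makes no difference.\<close>
  have bl0: "blocks True n 0 = blocks False n 0" unfolding blocks_def signed_perms_def by auto
  have zz0: "zz 0 = id" by (auto simp: zz_def base_def fun_eq_iff)
  have cen: "centraliser (J k) (zmin k) = H k" if k: "k \<in> {1..n div 2}" for k
  proof -
    have "gen (J k) = blocks False n k \<inter> W_D n" using k by (intro genJ) simp
    moreover have "H k \<subseteq> W_D n" using k by (intro HD) simp
    ultimately show ?thesis unfolding centraliser_zmin Hbl by blast
  qed
  have cen0: "centraliser (sgen ` {1..int n - 1}) (id, id) = H 0"
    unfolding Hbl zz0 centraliser_def pmul_def genA bl0 by simp
  have sig0: "sgnC (sgen ` I) h = sigma_k (sgen ` I) 0 h" if h: "h \<in> blocks b n 0" for h b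
  proof -
    have "h \<in> W_BC n" using h unfolding blocks_def signed_perms_def by blast
    hence "comp2 0 h = h" using W_BC_D(4)[of h n] by (auto simp: comp2_def fun_eq_iff)
    thus ?thesis by (simp add: sigma_k_def)
  qed
  have odds: "2 * int j + 1 \<in> I - {2 * int k}" if "k \<le> n div 2" "j < k" for j k
  proof -
    have "2 * int j + 1 \<in> {1..int n - 1}" using that by auto
    moreover have "2 * int j + 1 \<noteq> 2 * int k" by presburger
    ultimately show ?thesis using I1 by blast
  qed
  have mt: "model_triple (sgen ` I) (f k)" if k: "k \<in> {1..n div 2}" for k
  proof -
    have kn: "k \<le> n div 2" "k \<ge> 1" using k by auto
    have sub: "gen (J k) \<subseteq> blocks False n k" unfolding genJ[OF kn(2)] by blast
    have z: "zz k \<in> gen (J k)" unfolding J_def using odds[OF kn(1)] by (rule zz_in_gen(1))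
    have "zmin k \<in> perfect_inv (J k)"
      unfolding J_def
    proof (rule zmin_perfect[OF _ _ _ _ z[unfolded J_def]])
      show "i \<ge> -1" if "i \<in> I - {2 * int k}" for i using that Ige by blast
      show "i \<noteq> 2 * int k" if "i \<in> I - {2 * int k}" for i using that by blast
      show "k \<ge> 1" by (rule kn(2))
      show "gen (sgen ` (I - {2 * int k})) \<subseteq> blocks False n k" using sub unfolding J_def .
      show "2 * k \<le> n" using kn(1) by simp
    qed
    moreover have "WJ_minimal (sgen ` I) (J k) (zmin k)"
      unfolding J_def
    proof (rule zmin_minimal[OF Ige])
      show "2 * int j + 1 \<in> I" if "j < k" for j using odds[OF kn(1) that] by blast
    qed auto
    moreover have "linear_char_hom (J k) (sigma_k (sgen ` I) k)" using sub sig by (rule linear_char_homI)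
    moreover have "J k \<subseteq> sgen ` I" unfolding J_def by blast
    ultimately show ?thesis unfolding model_triple_def f_def by simp
  qed
  have mt0: "model_triple (sgen ` I) e"
  proof -
    have zm: "zmin 0 = (id, id)" unfolding zmin_zz zz0 ..
    have sub: "gen (sgen ` {1..int n - 1}) \<subseteq> blocks False n 0" unfolding genA bl0 by (rule subset_refl)
    have "zmin 0 \<in> perfect_inv (sgen ` {1..int n - 1})"
      by (rule zmin_perfect[OF _ _ _ sub]) (use id_in_gen zz0 in auto)
    moreover have "WJ_minimal (sgen ` I) (sgen ` {1..int n - 1}) (zmin 0)"
      by (rule zmin_minimal[OF Ige I1]) auto
    moreover have "linear_char_hom (sgen ` {1..int n - 1}) (sgnC (sgen ` I))"
    proof (rule linear_char_homI[OF sub])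
      show "sgnC (sgen ` I) h = of_int (sign (restr {i. base 0 i = i} h))" if "h \<in> blocks False n 0" for h
        unfolding sig0[OF that] by (rule sig[OF that])
    qed
    moreover have "sgen ` {1..int n - 1} \<subseteq> sgen ` I" using I1 by blast
    ultimately show ?thesis unfolding model_triple_def e_def zm by simp
  qed
  have inj: "inj_on f {1..n div 2}" unfolding f_def using zmin_inj by (auto intro!: inj_onI)
  \<comment> \<open>If the separate triple coincided with another one, the sum over the set would
    lose a term.\<close>
  have enot: "e \<notin> f ` {1..n div 2}"
  proof
    assume "e \<in> f ` {1..n div 2}"
    then obtain k where k: "k \<in> {1..n div 2}" "e = f k" by blast
    hence "zmin k = zmin 0" unfolding e_def f_def zmin_zz zz0 by simp
    thus False using zmin_inj[of k 0] k(1) by simp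
  qed
  have eq: "(\<Sum>(J, z, \<sigma>)\<in>P_D n. induce (W_D n) (centraliser J z) \<sigma> g)
      = (\<Sum>k\<in>{0..n div 2}. induce (W_D n) (H k) (sigma_k (sgen ` I) k) g)" for g
  proof -
    have "(\<Sum>(J, z, \<sigma>)\<in>P_D n. induce (W_D n) (centraliser J z) \<sigma> g)
      = induce (W_D n) (H 0) (sgnC (sgen ` I)) g
        + (\<Sum>(J, z, \<sigma>)\<in>f ` {1..n div 2}. induce (W_D n) (centraliser J z) \<sigma> g)"
      unfolding P Un_insert_right Un_empty_right using enot
      by (subst sum.insert) (simp_all add: e_def cen0)
    also have "(\<Sum>(J, z, \<sigma>)\<in>f ` {1..n div 2}. induce (W_D n) (centraliser J z) \<sigma> g)
      = (\<Sum>k\<in>{1..n div 2}. induce (W_D n) (H k) (sigma_k (sgen ` I) k) g)"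
      unfolding sum.reindex[OF inj] by (rule sum.cong[OF refl]) (simp only: comp_apply f_def prod.case cen)
    also have "induce (W_D n) (H 0) (sgnC (sgen ` I)) g = induce (W_D n) (H 0) (sigma_k (sgen ` I) 0) g"
      by (rule induce_cong, rule sig0[of _ False]) (simp add: Hbl)
    also have "induce (W_D n) (H 0) (sigma_k (sgen ` I) 0) g
        + (\<Sum>k\<in>{1..n div 2}. induce (W_D n) (H k) (sigma_k (sgen ` I) k) g)
      = (\<Sum>k\<in>{0..n div 2}. induce (W_D n) (H k) (sigma_k (sgen ` I) k) g)"
      by (subst (2) sum.atLeast_Suc_atMost) simp_all
    finally show ?thesis .
  qed
  have hbl: "h \<in> blocks False n k" if "h \<in> H k" for h k using that unfolding Hbl by blast
  have "(\<Sum>k\<in>{0..n div 2}. induce (W_D n) (H k) (sigma_k (sgen ` I) k) g) = (\<Sum>\<chi>\<in>Irr (W_D n). \<chi> g)"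
    if g: "g \<in> W_D n" for g
  proof (rule D.square_root_count_is_model[OF _ _ _ _ _ _ _ g])
    show "perm_group (H k)" for k unfolding H_def by (rule B.commutant_perm_group)
    show "H k \<subseteq> W_D n" if "k \<in> {0..n div 2}" for k using that by (intro HD) simp
    show "sigma_k (sgen ` I) k h \<in> {1, -1}" if "h \<in> H k" for k h
      unfolding sig[OF hbl[OF that]] by (rule sign_pm1)
    show "sigma_k (sgen ` I) k (h \<circ> h') = sigma_k (sgen ` I) k h * sigma_k (sgen ` I) k h'"
      if h: "h \<in> H k" "h' \<in> H k" for k h h'
      unfolding sig[OF hbl[OF h(1)]] sig[OF hbl[OF h(2)]] sig[OF blocks_comp[OF hbl[OF h(1)] hbl[OF h(2)]]]
        sign_fix_hom[OF hbl[OF h(1)] hbl[OF h(2)]] by simp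
    \<comment> \<open>A conjugating element found in type BC but outside type D is corrected by the
      central element -1.\<close>
    show "\<exists>h\<in>W_D n. h \<circ> x \<circ> pinv h = pinv x" if x: "x \<in> W_D n" for x
    proof -
      have xB: "x \<in> W_BC n" using x by (simp add: W_D_iff)
      interpret X: signed_perm False n x by unfold_locales (simp add: xB)
      obtain h where h: "h \<in> W_BC n" "h \<circ> x \<circ> pinv h = pinv x" using X.conjugate_to_inverse by auto
      show ?thesis
      proof (cases "h \<in> W_D n")
        case True
        thus ?thesis using h(2) by blast
      next
        case False
        hence "neg_one n \<circ> h \<in> W_D n" using neg_one_facts(4)[OF n(1) h(1)] by blast
        moreover have "(neg_one n \<circ> h) \<circ> x \<circ> pinv (neg_one n \<circ> h) = pinv x" unfolding conj_neg_one[OF h(1) xB] by (rule h(2))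
        ultimately show ?thesis by blast
      qed
    qed
    show "(\<Sum>k\<in>{0..n div 2}. induce (W_D n) (H k) (sigma_k (sgen ` I) k) x) = of_nat (card {w \<in> W_D n. w \<circ> w = x})"
      if x: "x \<in> W_D n" for x
    proof -
      have xB: "x \<in> W_BC n" using x by (simp add: W_D_iff)
      have "(\<Sum>k\<in>{0..n div 2}. induce (W_BC n) (H k) (sigma_k (sgen ` I) k) x) = of_nat (card {w \<in> W_BC n. w \<circ> w = x})"
        unfolding H_def
      proof (rule sum_induced_eq_square_roots[of n False, unfolded signed_perms_False])
        show "sigma_k (sgen ` I) k h = of_int (sign (restr {i. base k i = i} h))"
          if "h \<in> W_BC n" "h \<circ> base k = base k \<circ> h" for k h
        proof (rule sig[OF hbl])
          show "h \<in> H k" unfolding H_def using that by blast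
        qed
      qed (rule xB)
      hence "2 * (\<Sum>k\<in>{0..n div 2}. induce (W_D n) (H k) (sigma_k (sgen ` I) k) x) = 2 * of_nat (card {w \<in> W_D n. w \<circ> w = x})"
        unfolding induce_W_D_odd[OF n(1) x] card_roots_W_D_odd[OF n(1)] by (simp add: sum_distrib_left)
      thus ?thesis by simp
    qed
  qed auto
  thus ?thesis unfolding perfect_model_def eq S using mt mt0 unfolding P by auto
qed

theorem mainTheorem1:
  shows "(\<forall>m::nat. m \<ge> 1 \<longrightarrow> perfect_model (S_A m) (gens_A m) (P_A m))
       \<and> (\<forall>n::nat. n \<ge> 2 \<longrightarrow> perfect_model (W_BC n) (gens_BC n) (P_BC n))
       \<and> (\<forall>n::nat. n \<ge> 2 \<longrightarrow> perfect_model (W_D (2 * n + 1)) (gens_D (2 * n + 1)) (P_D (2 * n + 1)))"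
proof (intro conjI allI impI)
  fix m :: nat assume m: "m \<ge> 1"
  \<comment> \<open>No generator of type A has index 0, so the case k = 0 of \<open>gen_A\<close>
    describes the whole symmetric group.\<close>
  have "blocks True m 0 = signed_perms True m"
  proof -
    have "\<bar>w i\<bar> \<le> 0 \<longleftrightarrow> \<bar>i\<bar> \<le> 0" if "w \<in> W_BC m" for w i using W_BC_D(5)[OF that, of i] by simp
    thus ?thesis unfolding blocks_def signed_perms_def by auto
  qed
  hence "S_A m = signed_perms True m" using gen_A[OF m, of 0] by (simp add: S_A_def)
  thus "perfect_model (S_A m) (gens_A m) (P_A m)"
    using perfect_model_signed[OF m _ _ gen_A[OF m]] by (auto simp: gens_A_def P_A_def)
next
  fix n :: nat assume "n \<ge> 2"
  hence n: "n \<ge> 1" by simp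
  show "perfect_model (W_BC n) (gens_BC n) (P_BC n)"
    using perfect_model_signed[OF n _ _ gen_BC[OF n]] by (auto simp: gens_BC_def P_BC_def)
next
  fix n :: nat assume "n \<ge> 2"
  thus "perfect_model (W_D (2 * n + 1)) (gens_D (2 * n + 1)) (P_D (2 * n + 1))"
    by (intro perfect_model_D_odd) auto
qed

end
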